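(* For every integer $d \geq 4$ there exist constants $\delta > 0$ and $C > 0$, depending only on $d$, such that for every finite, non-empty set $A \subseteq \mathbb{R}^d$ with $\dim(A) = d$, at least one of the following holds: (i) \[ |A-A| \geq \left(2d - 2 + \frac{1}{d-1} + \frac{1}{(2d-3)(d-1)}\right)|A| - C|A|^{1-\delta}; \] (ii) $A$ can be partitioned as $A = A_1 \cup A_2 \cup E$, where $A_1$ and $A_2$ lie in translates of some (common) hyperplane, $\dim(A_1) = \dim(A_2) = d-1$, $|\pi_v(A_1)| = |\pi_v(A_2)| = d-1$ for some $v \in \mathbb{R}^d \setminus \{0\}$, and $|E| \leq C|A|^{1-\delta}$.
   Context: For finite sets $A, B \subseteq \mathbb{R}^d$, $A - B = \{a-b : a \in A,\ b \in B\}$. For a non-empty set $A \subseteq \mathbb{R}^d$, $\dim(A)$ denotes the dimension of the affine subspace spanned by $A$. For $v \in \mathbb{R}^d \setminus \{0\}$, $H_v$ is the hyperplane through the origin orthogonal to $v$ and $\pi_v : \mathbb{R}^d \to H_v$ is the orthogonal projection. *)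

theory Defs
  imports "HOL-Analysis.Analysis"
begin

definition difference_set :: "'a::ab_group_add set \<Rightarrow> 'a set \<Rightarrow> 'a set" where
  "difference_set A B = {a - b | a b. a \<in> A \<and> b \<in> B}"

definition orth_hyperplane :: "'a::euclidean_space \<Rightarrow> 'a set" where
  "orth_hyperplane v = {x. v \<bullet> x = 0}"

text \<open>Meaningful for \<open>v \<noteq> 0\<close> only; the two lemmas below characterise it as the orthogonal
  projection onto the hyperplane.\<close>

definition orth_proj :: "'a::euclidean_space \<Rightarrow> 'a \<Rightarrow> 'a" where
  "orth_proj v x = x - ((v \<bullet> x) / (v \<bullet> v)) *\<^sub>R v"

lemma orth_proj_in_hyperplane:
  "v \<noteq> 0 \<Longrightarrow> orth_proj v x \<in> orth_hyperplane v"
  by (simp add: orth_proj_def orth_hyperplane_def inner_diff_right)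

lemma orth_proj_residual_orthogonal:
  "y \<in> orth_hyperplane v \<Longrightarrow> (x - orth_proj v x) \<bullet> y = 0"
  by (simp add: orth_proj_def orth_hyperplane_def)

end

theory Submission
  imports Defs "HOL-Library.Set_Algebras"
begin

text \<open>If \<open>|A - A| \<le> K|A|\<close>, then \<open>2A - 2A\<close> contains an arithmetic progression \<open>{w, 2w, \<dots>}\<close> whose length is
  a power of \<open>|A|\<close> (Ruzsa's model lemma and Bogolyubov's method), so \<open>A\<close> lies on \<open>O(|A|\<^sup>1\<^sup>-\<^sup>\<sigma>)\<close> lines
  parallel to \<open>w\<close>, and up to \<open>O(|A|\<^sup>1\<^sup>-\<^sup>\<delta>)\<close> points all these lines are rich.

  Project along \<open>w\<close> and put \<open>D = d - 1\<close>. The image \<open>P\<close> carries as weights \<open>a\<^sub>p\<close> the numbers of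
  points on the lines, and \<open>|A - A|\<close> is at least the sum over \<open>x \<in> P - P\<close> of \<open>max {a\<^sub>p + a\<^sub>q | p - q = x} - 1\<close>.
  Slicing the weights by level and adding cross differences with a greedily chosen affine basis
  reduces everything to lower bounds for \<open>|Q - Q|\<close> where \<open>Q\<close> has affine dimension \<open>k \<le> D\<close>.
  Let \<open>F\<close> be the facet of \<open>Q\<close> with the most points and \<open>G\<close> the opposite face. As \<open>G\<close> lies in some facet,
  \<open>|G| \<le> |F|\<close>, whence \<open>2|F - G| \<ge> 2|F| + k(|G| - 1)\<close>; removing \<open>G\<close> and inducting gives
  \<open>|Q - Q| \<ge> k|Q| + max {1, 1 + |Q|/2 - k}\<close>. This is at least \<open>(k + 1/(2D - 1))|Q|\<close> unless
  \<open>k = D\<close>, \<open>|Q| = 2D\<close> and \<open>Q\<close> consists of two parallel facets with \<open>D\<close> points each; for \<open>Q = P\<close> this is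
  alternative (ii).\<close>

section \<open>Pluennecke's inequality\<close>

text \<open>With \<open>D = d - 1\<close> the constant of alternative (i) equals
  \<open>2 * D + 2 / (2 * D - 1)\<close>: twice \<open>D + 1 / (2 * D - 1)\<close>, because every
  difference in the projection receives the weights of two points. The fraction
  \<open>1 / (2 * D - 1)\<close> is an excess of 1 shared by \<open>2 * D - 1\<close> points. At
  \<open>2 * D\<close> points an excess of 1 is too little, which is the exceptional configuration;
  beyond that the excess grows like half the number of points. The obstacle is that lines have
  unequal weights: a level set may lose dimension, or be exceptional although the bottom level is
  not. So a single choice of one representing pair per difference must serve all levels
  simultaneously. Two losses determine the exponent. If lines with fewer than \<open>T\<close>
  points are discarded, at most \<open>T\<close> points per line are lost; the defect of 1 per
  difference costs in total the number of differences used, which is \<open>O(|A| / T)\<close> as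
  each difference of rich lines is the image of at least \<open>T\<close> differences. With
  \<open>O(|A| powr (1 - \<sigma>))\<close> lines, \<open>T\<close> of order
  \<open>|A| powr (\<sigma> / 2)\<close> balances both.\<close>

lemma finite_difference_set [simp, intro]:
  "finite A \<Longrightarrow> finite B \<Longrightarrow> finite (difference_set A B)"
  by (rule finite_subset[of _ "(\<lambda>(a, b). a - b) ` (A \<times> B)"]) (auto simp: difference_set_def)

lemma difference_setI: "a \<in> A \<Longrightarrow> b \<in> B \<Longrightarrow> a - b \<in> difference_set A B"
  by (auto simp: difference_set_def)

lemma difference_set_eq_plus: "difference_set A B = A + uminus ` B"
  by (force simp: difference_set_def set_plus_def)

primrec iter_sumset :: "nat \<Rightarrow> 'a::ab_group_add set \<Rightarrow> 'a set" where
  "iter_sumset 0 A = {0}"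
| "iter_sumset (Suc m) A = A + iter_sumset m A"

lemma finite_iter_sumset [simp, intro]: "finite A \<Longrightarrow> finite (iter_sumset m A)"
  by (induction m) (auto intro: finite_set_plus)

lemma uminus_set_plus: "uminus ` (A + B) = uminus ` A + uminus ` (B :: 'a::ab_group_add set)"
  by (force simp: set_plus_def image_iff)

lemma iter_sumset_uminus: "iter_sumset m (uminus ` A) = uminus ` iter_sumset m A"
  by (induction m) (auto simp: uminus_set_plus)

text \<open>Petridis' argument, adding \<open>C\<close> one point \<open>c\<close> at a time. A
  translate \<open>x + B + c\<close> that already lies in \<open>X + B + C\<close> contributes
  nothing; these \<open>x\<close> form \<open>Z\<close>, so at most
  \<open>card (X + B) - card (Z + B)\<close> new sums appear, and the minimality of \<open>X\<close>
  bounds \<open>card (Z + B)\<close> from below. On the other side \<open>X + C\<close> grows by at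
  least \<open>card X - card Z\<close>.\<close>

lemma petridis:
  fixes X B C :: "'a::ab_group_add set"
  assumes "finite X" "finite B" "finite C"
    and min: "\<And>Z. Z \<subseteq> X \<Longrightarrow> card (X + B) * card Z \<le> card (Z + B) * card X"
  shows "card (X + B + C) * card X \<le> card (X + B) * card (X + C)"
  using \<open>finite C\<close>
proof (induction C rule: finite_induct)
  case empty
  then show ?case by (simp add: set_plus_def)
next
  case (insert c C)
  define Z where "Z = {x \<in> X. \<forall>b\<in>B. x + b + c \<in> X + B + C}"
  define W where "W = {x \<in> X. x + c \<in> X + C}"
  have fin: "finite Z" "finite W" "finite (Z + B)" "finite (X + B)" "finite (X + C)" "finite (X + B + C)"
    using assms insert by (auto simp: Z_def W_def intro!: finite_set_plus)
  have "W \<subseteq> Z"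
  proof
    fix x assume x: "x \<in> W"
    then obtain x' c' where c: "x + c = x' + c'" "x' \<in> X" "c' \<in> C"
      by (auto simp: W_def elim: set_plus_elim)
    have "x + b + c \<in> X + B + C" if "b \<in> B" for b
    proof -
      have "x + b + c = (x + c) + b" by (simp add: algebra_simps)
      also have "\<dots> = (x' + b) + c'" unfolding c by (simp add: algebra_simps)
      finally have e: "x + b + c = (x' + b) + c'" .
      show ?thesis unfolding e using c(2,3) that by (intro set_plus_intro)
    qed
    then show "x \<in> Z" using x by (auto simp: Z_def W_def)
  qed
  then have WZ: "card W \<le> card Z" by (simp add: card_mono fin)
  have ZX: "Z \<subseteq> X" by (auto simp: Z_def)
  have ZB: "Z + B \<subseteq> X + B" using ZX by (intro set_plus_mono2) auto
  have "X + B + insert c C \<subseteq> (X + B + C) \<union> (\<lambda>y. y + c) ` ((X + B) - (Z + B))"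
  proof
    fix y assume "y \<in> X + B + insert c C"
    then obtain x b c' where y: "y = x + b + c'" "x \<in> X" "b \<in> B" "c' \<in> insert c C"
      by (auto elim!: set_plus_elim)
    show "y \<in> (X + B + C) \<union> (\<lambda>y. y + c) ` ((X + B) - (Z + B))"
    proof (cases "y \<in> X + B + C")
      case False
      then have "c' = c" using y by (auto intro: set_plus_intro)
      moreover have "x + b \<notin> Z + B"
      proof
        assume "x + b \<in> Z + B"
        then obtain z b' where z: "x + b = z + b'" "z \<in> Z" "b' \<in> B" by (auto elim: set_plus_elim)
        then show False using False y \<open>c' = c\<close> by (auto simp: Z_def)
      qed
      ultimately show ?thesis using y by (auto intro: set_plus_intro)
    qed auto
  qed
  then have "card (X + B + insert c C) \<le> card ((X + B + C) \<union> (\<lambda>y. y + c) ` ((X + B) - (Z + B)))"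
    using fin by (intro card_mono) auto
  also have "\<dots> \<le> card (X + B + C) + card ((X + B) - (Z + B))"
    using card_Un_le[of "X + B + C"] card_image_le[of "(X + B) - (Z + B)" "\<lambda>y. y + c"] fin
    by (meson add_left_mono dual_order.trans finite_Diff)
  finally have 1: "card (X + B + insert c C) + card (Z + B) \<le> card (X + B + C) + card (X + B)"
    using card_Diff_subset[OF fin(3) ZB] card_mono[OF fin(4) ZB] by linarith
  have "(X + C) \<union> (\<lambda>x. x + c) ` (X - W) \<subseteq> X + insert c C"
    by (auto simp: set_plus_def)
  then have "card ((X + C) \<union> (\<lambda>x. x + c) ` (X - W)) \<le> card (X + insert c C)"
    using assms(1) insert.hyps(1) by (intro card_mono finite_set_plus) auto
  moreover have "(X + C) \<inter> (\<lambda>x. x + c) ` (X - W) = {}" by (auto simp: W_def)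
  ultimately have "card (X + C) + card ((\<lambda>x. x + c) ` (X - W)) \<le> card (X + insert c C)"
    using fin assms by (simp add: card_Un_disjoint)
  moreover have "card ((\<lambda>x. x + c) ` (X - W)) = card X - card W"
    using card_Diff_subset[OF fin(2), of X] by (subst card_image) (auto simp: W_def inj_on_def)
  moreover have "card W \<le> card X" by (rule card_mono) (auto simp: W_def assms)
  ultimately have 2: "card (X + C) + card X \<le> card (X + insert c C) + card Z" using WZ by linarith
  have "card (X + B + insert c C) * card X + card (Z + B) * card X
      \<le> card (X + B + C) * card X + card (X + B) * card X"
    using mult_right_mono[OF 1, of "card X"] by (simp add: algebra_simps)
  also have "\<dots> \<le> card (X + B) * (card (X + C) + card X)"
    using insert.IH by (simp add: algebra_simps)
  also have "\<dots> \<le> card (X + B) * (card (X + insert c C) + card Z)"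
    by (rule mult_left_mono[OF 2]) auto
  finally show ?case using min[OF ZX] by (simp add: algebra_simps)
qed

text \<open>Fix a representation \<open>d = y - y'\<close> of every difference of \<open>Y\<close>
  and send \<open>(x, d)\<close> to \<open>(x - y, x - y')\<close>. The difference of the two
  coordinates recovers \<open>d\<close>, and then \<open>x\<close>.\<close>

lemma ruzsa_triangle:
  fixes X Y :: "'a::ab_group_add set"
  assumes "finite X" "finite Y"
  shows "card X * card (difference_set Y Y) \<le> card (difference_set X Y) ^ 2"
proof -
  have "\<forall>d\<in>difference_set Y Y. \<exists>p. fst p \<in> Y \<and> snd p \<in> Y \<and> d = fst p - snd p"
    by (auto simp: difference_set_def)
  then obtain h where h: "\<And>d. d \<in> difference_set Y Y \<Longrightarrow> fst (h d) \<in> Y \<and> snd (h d) \<in> Y \<and> d = fst (h d) - snd (h d)"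
    by metis
  define F where "F = (\<lambda>(x, d). (x - fst (h d), x - snd (h d)))"
  have "inj_on F (X \<times> difference_set Y Y)"
  proof (rule inj_onI, clarify)
    fix x d x' d' assume d: "d \<in> difference_set Y Y" "d' \<in> difference_set Y Y" "F (x, d) = F (x', d')"
    then have e: "x - fst (h d) = x' - fst (h d')" "x - snd (h d) = x' - snd (h d')" by (auto simp: F_def)
    have "d = (x - snd (h d)) - (x - fst (h d))" using h[OF d(1)] by simp
    also have "\<dots> = (x' - snd (h d')) - (x' - fst (h d'))" by (simp only: e)
    also have "\<dots> = d'" using h[OF d(2)] by simp
    finally have "d = d'" .
    then show "x = x' \<and> d = d'" using e by simp
  qed
  moreover have "F ` (X \<times> difference_set Y Y) \<subseteq> difference_set X Y \<times> difference_set X Y"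
    using h by (auto simp: F_def intro!: difference_setI)
  ultimately have "card (X \<times> difference_set Y Y) \<le> card (difference_set X Y \<times> difference_set X Y)"
    using assms by (intro card_inj_on_le) auto
  then show ?thesis by (simp add: card_cartesian_product power2_eq_square)
qed

text \<open>A non-empty \<open>X \<subseteq> A\<close> with minimal ratio
  \<open>card (X - A) / card X\<close> satisfies the hypothesis of \<open>petridis\<close> for
  \<open>B = - A\<close>. Iterating bounds \<open>X - mA\<close> by \<open>K ^ m * card X\<close>,
  and the triangle inequality through \<open>X\<close> squares the factor.\<close>

lemma pluennecke:
  fixes A :: "'a::ab_group_add set" and K :: real
  assumes "finite A" "A \<noteq> {}" and K: "card (difference_set A A) \<le> K * card A"
  shows "card (difference_set (iter_sumset m A) (iter_sumset m A)) \<le> K ^ (2 * m) * card A"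
proof -
  define B where "B = uminus ` A"
  have finB: "finite B" using assms by (simp add: B_def)
  define R where "R = (\<lambda>X. real (card (X + B)) / real (card X))"
  have "finite (Pow A - {{}})" "Pow A - {{}} \<noteq> {}" using assms by auto
  then obtain X where X: "X \<in> Pow A - {{}}" and Xmin: "\<And>Z. Z \<in> Pow A - {{}} \<Longrightarrow> R X \<le> R Z"
    using arg_min_if_finite[of "Pow A - {{}}" R] by (metis (no_types, lifting) not_le)
  have XA: "X \<subseteq> A" "X \<noteq> {}" "finite X" using X assms finite_subset by auto
  then have cX: "card X > 0" by (simp add: card_gt_0_iff)
  have cA: "card A > 0" using assms by (simp add: card_gt_0_iff)
  have "R X \<le> R A" using assms Xmin by auto
  also have RK: "R A \<le> K" using K cA by (simp add: R_def B_def difference_set_eq_plus field_simps)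
  finally have XK: "card (X + B) \<le> K * card X" using cX by (simp add: R_def field_simps)
  have "R A \<ge> 0" by (simp add: R_def)
  with RK have K0: "K \<ge> 0" by simp
  have mn: "card (X + B) * card Z \<le> card (Z + B) * card X" if "Z \<subseteq> X" for Z
  proof (cases "Z = {}")
    case False
    then have "R X \<le> R Z" "card Z > 0"
      using Xmin[of Z] XA that by (auto simp: card_gt_0_iff intro: finite_subset)
    then have "real (card (X + B)) * card Z \<le> real (card (Z + B)) * card X"
      using cX by (simp add: R_def field_simps)
    then show ?thesis by (metis of_nat_le_iff of_nat_mult)
  qed simp
  have pow: "card (X + iter_sumset m B) \<le> K ^ m * card X" for m
  proof (induction m)
    case 0
    then show ?case by (simp add: set_plus_def)
  next
    case (Suc m)
    have "card (X + B + iter_sumset m B) * card X \<le> card (X + B) * card (X + iter_sumset m B)"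
      using petridis[OF XA(3) finB _ mn] finB by blast
    then have "real (card (X + B + iter_sumset m B)) * card X \<le> real (card (X + B)) * card (X + iter_sumset m B)"
      by (metis of_nat_le_iff of_nat_mult)
    also have "\<dots> \<le> (K * card X) * (K ^ m * card X)"
      using Suc XK K0 by (intro mult_mono) auto
    finally have "real (card (X + B + iter_sumset m B)) \<le> K ^ Suc m * card X"
      using cX by (simp add: algebra_simps)
    then show ?case by (simp add: add.assoc)
  qed
  have "real (card X) * card (difference_set (iter_sumset m A) (iter_sumset m A))
      \<le> (card (difference_set X (iter_sumset m A)))\<^sup>2"
    using ruzsa_triangle[OF XA(3), of "iter_sumset m A"] assms(1)
    by (metis finite_iter_sumset of_nat_le_iff of_nat_mult of_nat_power)
  also have "difference_set X (iter_sumset m A) = X + iter_sumset m B"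
    by (simp add: difference_set_eq_plus B_def iter_sumset_uminus)
  also have "real ((card (X + iter_sumset m B))\<^sup>2) \<le> (K ^ m * card X)\<^sup>2"
    using pow[of m] by (simp add: power_mono)
  also have "\<dots> = card X * (K ^ (2 * m) * card X)"
    by (simp add: power_mult_distrib power2_eq_square mult_2 power_add)
  finally have "card (difference_set (iter_sumset m A) (iter_sumset m A)) \<le> K ^ (2 * m) * card X"
    using cX by simp
  also have "\<dots> \<le> K ^ (2 * m) * card A"
    using XA assms card_mono K0 by (intro mult_left_mono) auto
  finally show ?thesis .
qed

section \<open>A long progression in the difference set\<close>

lemma ex_functional_nonzero:
  fixes S :: "'a::euclidean_space set"
  assumes "finite S" "0 \<notin> S"
  obtains w where "\<And>y. y \<in> S \<Longrightarrow> w \<bullet> y \<noteq> 0"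
proof -
  have "negligible (\<Union>y\<in>S. {x. y \<bullet> x = 0})"
    using assms by (intro negligible_Union) (auto intro!: negligible_hyperplane)
  then have "(\<Union>y\<in>S. {x. y \<bullet> x = 0}) \<noteq> UNIV" using non_negligible_UNIV by metis
  then obtain w where "w \<notin> (\<Union>y\<in>S. {x. y \<bullet> x = 0})" by blast
  then show ?thesis by (intro that[of w]) (auto simp: inner_commute)
qed

text \<open>A measure count. For one \<open>y\<close> the bad \<open>t\<close> fill a proportion
  \<open>2 / M\<close> of a long interval \<open>{0..T}\<close>, up to a boundary term that does not
  depend on \<open>T\<close>. As \<open>M > 3 * card S\<close>, all bad sets together have measure
  at most \<open>2 * T / 3 + c\<close>.\<close>

lemma ex_dilate_far_from_integers:
  fixes S :: "real set" and M :: nat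
  assumes "finite S" "0 \<notin> S" and M: "M > 3 * card S"
  obtains t where "\<And>y i. y \<in> S \<Longrightarrow> \<bar>t * y - of_int i\<bar> \<ge> 1 / M"
proof -
  have "\<exists>t. \<forall>y\<in>S. \<forall>i::int. \<bar>t * y - of_int i\<bar> \<ge> 1 / M"
  proof (rule ccontr)
    assume neg: "\<not> ?thesis"
    have M0: "M > 0" using M by simp
    define c where "c = (\<Sum>y\<in>S. 4 / (M * \<bar>y\<bar>))"
    \<comment> \<open>Any \<open>T > 3 * c\<close> contradicts the final bound
      \<open>T \<le> 2 * T / 3 + c\<close>.\<close>
    define T where "T = 3 * c + 1"
    have c0: "c \<ge> 0" by (auto simp: c_def intro!: sum_nonneg)
    define I where "I = (\<lambda>y::real. {0..\<lfloor>T * \<bar>y\<bar>\<rfloor> + 1})"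
    define J where "J = (\<lambda>(y::real) (i::int). {(of_int i - 1 / M) / \<bar>y\<bar> .. (of_int i + 1 / M) / \<bar>y\<bar>})"
    have cover: "{0..T} \<subseteq> (\<Union>y\<in>S. \<Union>i\<in>I y. J y i)"
    proof
      fix t assume t: "t \<in> {0..T}"
      have "\<not> (\<forall>y\<in>S. \<forall>i::int. \<bar>t * y - of_int i\<bar> \<ge> 1 / M)" using neg by blast
      then obtain y i where y: "y \<in> S" "\<bar>t * y - real_of_int i\<bar> < 1 / M"
        by (meson not_le)
      have yn: "y \<noteq> 0" using y assms by auto
      have "\<exists>i. \<bar>t * \<bar>y\<bar> - of_int i\<bar> < 1 / M"
      proof (cases "y \<ge> 0")
        case False
        then have "\<bar>t * \<bar>y\<bar> - of_int (- i)\<bar> < 1 / M" using y(2) by (simp add: abs_minus_commute)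
        then show ?thesis by blast
      next
        case True
        then show ?thesis using y(2) by auto
      qed
      then obtain k where k: "\<bar>t * \<bar>y\<bar> - of_int k\<bar> < 1 / M" by blast
      have M1: "1 / real M \<le> 1" using M0 by simp
      have "t * \<bar>y\<bar> \<ge> 0" "t * \<bar>y\<bar> \<le> T * \<bar>y\<bar>" using t by (auto intro: mult_right_mono)
      then have kr: "of_int k > (-1::real)" "of_int k < T * \<bar>y\<bar> + 1" using k M1 by linarith+
      then have "k \<in> I y" unfolding I_def by (auto; linarith)
      moreover have "t \<in> J y k" using k yn by (auto simp: J_def field_simps abs_less_iff)
      ultimately show "t \<in> (\<Union>y\<in>S. \<Union>i\<in>I y. J y i)" using y by blast
    qed
    have Jm: "J y i \<in> lmeasurable" for y i by (simp add: J_def)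
    have "T = measure lebesgue {0..T}" using c0 by (simp add: T_def)
    also have "\<dots> \<le> measure lebesgue (\<Union>y\<in>S. \<Union>i\<in>I y. J y i)"
      using cover by (intro measure_mono_fmeasurable fmeasurable.finite_UN assms Jm) (auto simp: I_def)
    also have "\<dots> \<le> (\<Sum>y\<in>S. measure lebesgue (\<Union>i\<in>I y. J y i))"
      by (intro measure_UNION_le assms fmeasurableD fmeasurable.finite_UN Jm) (auto simp: I_def)
    also have "\<dots> \<le> (\<Sum>y\<in>S. \<Sum>i\<in>I y. measure lebesgue (J y i))"
      by (intro sum_mono measure_UNION_le fmeasurableD Jm) (auto simp: I_def)
    also have "\<dots> = (\<Sum>y\<in>S. card (I y) * (2 / (M * \<bar>y\<bar>)))"
    proof (intro sum.cong refl)
      fix y assume "y \<in> S"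
      then have y: "\<bar>y\<bar> > 0" using assms by auto
      have "measure lebesgue (J y i) = 2 / (M * \<bar>y\<bar>)" for i
      proof -
        have "(of_int i - 1 / M) / \<bar>y\<bar> \<le> (of_int i + 1 / M) / \<bar>y\<bar>"
          by (intro divide_right_mono) auto
        then have "measure lebesgue (J y i) = (of_int i + 1 / M) / \<bar>y\<bar> - (of_int i - 1 / M) / \<bar>y\<bar>"
          by (simp add: J_def)
        also have "\<dots> = 2 / (M * \<bar>y\<bar>)" using y M0 by (simp add: field_simps)
        finally show ?thesis .
      qed
      then show "(\<Sum>i\<in>I y. measure lebesgue (J y i)) = card (I y) * (2 / (M * \<bar>y\<bar>))" by simp
    qed
    also have "\<dots> \<le> (\<Sum>y\<in>S. (T * \<bar>y\<bar> + 2) * (2 / (M * \<bar>y\<bar>)))"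
    proof (intro sum_mono mult_right_mono)
      fix y
      have "T * \<bar>y\<bar> \<ge> 0" using c0 by (simp add: T_def)
      then show "real (card (I y)) \<le> T * \<bar>y\<bar> + 2" by (simp add: I_def)
    qed auto
    also have "\<dots> = (\<Sum>y\<in>S. 2 * T / M + 4 / (M * \<bar>y\<bar>))"
    proof (intro sum.cong refl)
      fix y assume "y \<in> S"
      then have "\<bar>y\<bar> \<noteq> 0" using assms by auto
      then show "(T * \<bar>y\<bar> + 2) * (2 / (M * \<bar>y\<bar>)) = 2 * T / M + 4 / (M * \<bar>y\<bar>)"
        using M0 by (simp add: divide_simps)
    qed
    also have "\<dots> = card S * (2 * T / M) + c" by (simp add: sum.distrib c_def)
    also have "card S * (2 * T / M) \<le> 2 * T / 3"
    proof -
      have "3 * real (card S) \<le> M" using M by linarith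
      then have "3 * real (card S) * T \<le> M * T" using c0 by (intro mult_right_mono) (auto simp: T_def)
      then show ?thesis using M0 by (simp add: field_simps)
    qed
    finally show False using c0 by (simp add: T_def)
  qed
  then show ?thesis using that by blast
qed

lemma iter_sumset_sum: "(\<And>i. i < m \<Longrightarrow> x i \<in> A) \<Longrightarrow> (\<Sum>i<m. x i) \<in> iter_sumset m A"
  by (induction m) (auto simp: add.commute[of _ "x _"] intro!: set_plus_intro)

text \<open>Ruzsa's model lemma. A linear functional, dilated so that its nonzero values on \<open>6A - 6A\<close> stay away
  from the integers, is rounded to multiples of \<open>1/M\<close>; \<open>A'\<close> collects the points with nearly the same
  rounding error, which makes the rounding additive on \<open>A'\<close>.\<close>

lemma freiman_model:
  fixes A :: "'a::euclidean_space set" and M :: nat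
  assumes "finite A" "A \<noteq> {}"
    and M: "M > 3 * card (difference_set (iter_sumset 6 A) (iter_sumset 6 A))"
  obtains A' and \<psi> :: "'a \<Rightarrow> int" where "A' \<subseteq> A" "card A \<le> 6 * card A'"
    "\<And>x y. (\<And>i. i < 6 \<Longrightarrow> x i \<in> A' \<and> y i \<in> A') \<Longrightarrow>
      (\<Sum>i<6::nat. x i) = (\<Sum>i<6. y i) \<longleftrightarrow> int M dvd (\<Sum>i<6. \<psi> (x i)) - (\<Sum>i<6. \<psi> (y i))"
proof -
  define S where "S = difference_set (iter_sumset 6 A) (iter_sumset 6 A) - {0}"
  have finS: "finite S" using assms by (auto simp: S_def)
  obtain w where w: "\<And>y. y \<in> S \<Longrightarrow> w \<bullet> y \<noteq> 0"
    using ex_functional_nonzero[of S] finS by (auto simp: S_def)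
  have "card ((\<bullet>) w ` S) \<le> card (difference_set (iter_sumset 6 A) (iter_sumset 6 A))"
    using assms card_image_le[OF finS] by (metis S_def card_Diff1_le dual_order.trans)
  then have "M > 3 * card ((\<bullet>) w ` S)" using M by linarith
  then obtain t where t: "\<And>y i. y \<in> (\<bullet>) w ` S \<Longrightarrow> \<bar>t * y - of_int i\<bar> \<ge> 1 / M"
    using ex_dilate_far_from_integers[of "(\<bullet>) w ` S" M] finS w
    by (metis (no_types, lifting) finite_imageI imageE)
  have M0: "M > 0" using M by simp
  define L where "L = (\<lambda>x. M * (t * (w \<bullet> x)))"
  define \<psi> where "\<psi> = (\<lambda>x. \<lfloor>L x\<rfloor>)"
  \<comment> \<open>Six classes because sums of six points are compared: within one class two
    rounding errors differ by less than \<open>1 / 6\<close>, so the total error \<epsilon> stays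
    below 1.\<close>
  define Ac where "Ac = (\<lambda>k::nat. {x \<in> A. \<lfloor>6 * frac (L x)\<rfloor> = int k})"
  have "\<exists>k<6. card A \<le> 6 * card (Ac k)"
  proof (rule ccontr)
    assume "\<not> ?thesis"
    then have lt: "6 * card (Ac k) < card A" if "k < 6" for k using that by (meson not_le)
    have "A \<subseteq> (\<Union>k<6. Ac k)"
    proof
      fix x assume x: "x \<in> A"
      define m where "m = \<lfloor>6 * frac (L x)\<rfloor>"
      have f: "0 \<le> frac (L x)" "frac (L x) < 1" by (auto simp: frac_lt_1)
      then have "0 \<le> m" "m < 6" unfolding m_def by (simp, subst floor_less_iff, simp)
      then have "nat m < 6" "x \<in> Ac (nat m)" using x by (auto simp: Ac_def m_def[symmetric])
      then show "x \<in> (\<Union>k<6. Ac k)" by blast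
    qed
    then have "card A \<le> card (\<Union>k<6. Ac k)" using assms by (intro card_mono) (auto simp: Ac_def)
    also have "\<dots> \<le> (\<Sum>k<6. card (Ac k))" by (rule card_UN_le) auto
    finally have "6 * card A \<le> (\<Sum>k<6. 6 * card (Ac k))"
      unfolding sum_distrib_left[symmetric] by simp
    also have "\<dots> < (\<Sum>k<(6::nat). card A)" by (rule sum_strict_mono) (use lt in \<open>auto simp: lessThan_empty_iff\<close>)
    finally show False by simp
  qed
  then obtain k where k: "card A \<le> 6 * card (Ac k)" by blast
  show ?thesis
  proof (rule that[OF _ k, of \<psi>])
    show "Ac k \<subseteq> A" by (auto simp: Ac_def)
    fix x y :: "nat \<Rightarrow> 'a"
    assume xy: "\<And>i. i < 6 \<Longrightarrow> x i \<in> Ac k \<and> y i \<in> Ac k"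
    define Y where "Y = (\<Sum>i<6. x i) - (\<Sum>i<6. y i)"
    define Z where "Z = (\<Sum>i<6. \<psi> (x i)) - (\<Sum>i<6. \<psi> (y i))"
    define \<epsilon> where "\<epsilon> = (\<Sum>i<6. frac (L (x i)) - frac (L (y i)))"
    have "\<bar>frac (L (x i)) - frac (L (y i))\<bar> < 1 / 6" if "i < 6" for i
    proof -
      have "k \<le> 6 * frac (L (x i))" "6 * frac (L (x i)) < k + 1"
        "k \<le> 6 * frac (L (y i))" "6 * frac (L (y i)) < k + 1"
        using xy[OF that] by (auto simp: Ac_def floor_eq_iff)
      then show ?thesis by linarith
    qed
    then have "(\<Sum>i<6. \<bar>frac (L (x i)) - frac (L (y i))\<bar>) < (\<Sum>i<(6::nat). 1 / 6)"
      by (intro sum_strict_mono) (auto simp: lessThan_empty_iff)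
    then have "(\<Sum>i<6. \<bar>frac (L (x i)) - frac (L (y i))\<bar>) < 1" by simp
    then have e1: "\<bar>\<epsilon>\<bar> < 1" unfolding \<epsilon>_def by (rule le_less_trans[OF sum_abs])
    have "L Y = (\<Sum>i<6. L (x i)) - (\<Sum>i<6. L (y i))"
      by (simp add: L_def Y_def inner_diff_right inner_sum_right sum_distrib_left right_diff_distrib)
    also have "\<dots> = of_int Z + \<epsilon>"
      by (simp add: Z_def \<epsilon>_def \<psi>_def frac_def sum_subtractf)
    finally have LY: "L Y = of_int Z + \<epsilon>" .
    \<comment> \<open>If \<open>Y = 0\<close>, the integer \<open>Z\<close> has absolute value below
      1 and vanishes. If \<open>M\<close> divides \<open>Z\<close>, then
      \<open>t * (w \<bullet> Y)\<close> is within \<open>1 / M\<close> of an integer, which the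
      choice of \<open>t\<close> forbids for nonzero \<open>Y\<close>.\<close>
    have "(Y = 0) = (int M dvd Z)"
    proof
      assume "Y = 0"
      then have "\<bar>of_int Z :: real\<bar> < 1" using LY e1 by (simp add: L_def)
      then show "int M dvd Z" by (metis dvd_0_right of_int_1 of_int_abs of_int_less_iff zabs_less_one_iff)
    next
      assume "int M dvd Z"
      then obtain z where z: "Z = int M * z" by (auto elim: dvdE)
      have "M * (t * (w \<bullet> Y)) = M * of_int z + \<epsilon>" using LY z by (simp add: L_def)
      then have "t * (w \<bullet> Y) - of_int z = \<epsilon> / M" using M0 by (simp add: field_simps)
      then have "\<bar>t * (w \<bullet> Y) - of_int z\<bar> < 1 / M" using e1 M0 by (simp add: divide_strict_right_mono)
      then have "Y \<notin> S" using t[of "w \<bullet> Y" z] by (meson imageI not_le)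
      moreover have "Y \<in> difference_set (iter_sumset 6 A) (iter_sumset 6 A)" unfolding Y_def
        using xy by (intro difference_setI iter_sumset_sum) (auto simp: Ac_def)
      ultimately show "Y = 0" by (simp add: S_def)
    qed
    then show "(\<Sum>i<6::nat. x i) = (\<Sum>i<6. y i) \<longleftrightarrow> int M dvd (\<Sum>i<6. \<psi> (x i)) - (\<Sum>i<6. \<psi> (y i))"
      by (simp add: Y_def Z_def)
  qed
qed

section \<open>Fourier analysis on residues modulo \<open>M\<close>\<close>

lemma sum_cis_residues:
  fixes M :: nat and n :: int
  assumes "M > 0"
  shows "(\<Sum>\<xi><M. cis (2 * pi * (real_of_int n * real \<xi> / M))) = (if int M dvd n then of_nat M else 0)"
proof -
  define z where "z = cis (2 * pi * (of_int n / M))"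
  have pow: "cis (2 * pi * (real_of_int n * real \<xi> / M)) = z ^ \<xi>" for \<xi> :: nat
  proof -
    have "z ^ \<xi> = cis (real \<xi> * (2 * pi * (real_of_int n / real M)))"
      unfolding z_def by (rule Complex.DeMoivre)
    then show ?thesis by (simp add: mult_ac)
  qed
  have zM: "z ^ M = 1"
    using assms pow[of M] cis_multiple_2pi[of "of_int n"] by simp
  show ?thesis
  proof (cases "int M dvd n")
    case True
    then obtain k where "n = int M * k" by (auto elim: dvdE)
    then have "z = 1" using assms cis_multiple_2pi[of "of_int k"] by (simp add: z_def)
    then show ?thesis unfolding pow using True by simp
  next
    case False
    have "z \<noteq> 1"
    proof
      assume "z = 1"
      then have "cos (2 * pi * (of_int n / M)) = 1" by (metis cis.sel(1) one_complex.sel(1) z_def)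
      then obtain k :: int where "2 * pi * (of_int n / M) = of_int k * 2 * pi"
        using cos_one_2pi_int by blast
      then have "of_int n = (of_int (int M * k) :: real)" using assms by (simp add: field_simps)
      then have "n = int M * k" by (simp only: of_int_eq_iff)
      then show False using False by simp
    qed
    then show ?thesis unfolding pow using False zM by (simp add: geometric_sum)
  qed
qed

text \<open>Bogolyubov's argument: \<open>2B - 2B\<close> contains the Bohr set of the large spectrum of \<open>B\<close>, and Dirichlet's
  theorem yields a \<open>q\<close> whose first \<open>N\<close> multiples lie in that Bohr set.\<close>

lemma bogolyubov_progression:
  fixes B :: "int set" and M N G :: nat and R :: real
  assumes "finite B" "B \<noteq> {}" and inj: "inj_on (\<lambda>b. b mod int M) B"
    and MR: "M \<le> R * card B" and G: "2 * R ^ 2 \<le> G"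
    and "N > 0" and NM: "(4 * N) ^ G < M"
  obtains q :: int where "0 < q" "q < M"
    "\<And>j::nat. j \<le> N \<Longrightarrow> \<exists>a\<in>B. \<exists>b\<in>B. \<exists>c\<in>B. \<exists>d\<in>B. int M dvd a + b - c - d - int j * q"
proof -
  have M0: "M > 0" using NM by simp
  have cB: "card B > 0" using assms by (simp add: card_gt_0_iff)
  have R0: "R > 0"
    by (rule ccontr) (use MR M0 cB in \<open>auto simp: not_less dest!: mult_nonpos_nonneg[of R "card B"]\<close>)
  define e where "e = (\<lambda>(n::int) (\<xi>::nat). cis (2 * pi * (real_of_int n * real \<xi> / M)))"
  have e_add: "e (m + n) \<xi> = e m \<xi> * e n \<xi>" for m n \<xi>
    by (simp add: e_def cis_mult algebra_simps add_divide_distrib)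
  have e_cnj: "cnj (e n \<xi>) = e (- n) \<xi>" for n \<xi> by (simp add: e_def cis_cnj)
  have e_sum: "(\<Sum>\<xi><M. e n \<xi>) = (if int M dvd n then of_nat M else 0)" for n
    unfolding e_def by (rule sum_cis_residues[OF M0])
  define f where "f = (\<lambda>\<xi>. \<Sum>b\<in>B. e b \<xi>)"
  have f0: "f 0 = of_nat (card B)" by (simp add: f_def e_def)
  have dvd_eq: "a = b" if "a \<in> B" "b \<in> B" "int M dvd a - b" for a b
    using inj that by (auto simp: inj_on_def mod_eq_dvd_iff)
  have "(\<Sum>\<xi><M. f \<xi> * cnj (f \<xi>)) = (\<Sum>\<xi><M. \<Sum>a\<in>B. \<Sum>b\<in>B. e (a - b) \<xi>)"
    unfolding f_def cnj_sum sum_product e_cnj by (simp add: e_add[symmetric])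
  also have "\<dots> = (\<Sum>a\<in>B. \<Sum>b\<in>B. \<Sum>\<xi><M. e (a - b) \<xi>)"
    by (subst sum.swap) (simp add: sum.swap[of _ _ "{..<M}"])
  also have "\<dots> = (\<Sum>a\<in>B. \<Sum>b\<in>B. if b = a then of_nat M else 0)"
    unfolding e_sum using dvd_eq by (intro sum.cong refl) auto
  also have "\<dots> = of_nat (M * card B)" using assms by simp
  finally have "of_real (\<Sum>\<xi><M. (cmod (f \<xi>))\<^sup>2) = (of_nat (M * card B) :: complex)"
    unfolding of_real_sum complex_norm_square .
  then have parseval: "(\<Sum>\<xi><M. (cmod (f \<xi>))\<^sup>2) = M * card B"
    by (metis of_real_eq_iff of_real_of_nat_eq)
  \<comment> \<open>The threshold is half of what the trivial frequency can afford: by Parseval and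
    \<open>M \<le> R * card B\<close>, the frequencies outside \<Gamma> contribute at most
    \<open>card B ^ 4 / 2\<close> to the fourth moment below.\<close>
  define \<Gamma> where "\<Gamma> = {\<xi>. \<xi> < M \<and> (card B)\<^sup>2 / (2 * R) \<le> (cmod (f \<xi>))\<^sup>2}"
  have fin\<Gamma>: "finite \<Gamma>" and sub\<Gamma>: "\<Gamma> \<subseteq> {..<M}" by (auto simp: \<Gamma>_def)
  have "card \<Gamma> * ((card B)\<^sup>2 / (2 * R)) = (\<Sum>\<xi>\<in>\<Gamma>. (card B)\<^sup>2 / (2 * R))" by simp
  also have "\<dots> \<le> (\<Sum>\<xi>\<in>\<Gamma>. (cmod (f \<xi>))\<^sup>2)" by (intro sum_mono) (auto simp: \<Gamma>_def)
  also have "\<dots> \<le> M * card B"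
    unfolding parseval[symmetric] by (intro sum_mono2 sub\<Gamma>) auto
  also have "\<dots> \<le> R * card B * card B" using MR by (simp add: mult_right_mono)
  finally have "card \<Gamma> \<le> 2 * R ^ 2" using R0 cB by (simp add: field_simps power2_eq_square)
  then have cG: "card \<Gamma> \<le> G" using G by linarith
  obtain h where h: "bij_betw h {0..<card \<Gamma>} \<Gamma>" using ex_bij_betw_nat_finite[OF fin\<Gamma>] by blast
  \<comment> \<open>Precision \<open>1 / (4 * N)\<close> keeps every multiple \<open>j * q\<close>
    with \<open>j \<le> N\<close> within a quarter turn of an integer at all frequencies of
    \<Gamma>, so the cosines there are nonnegative.\<close>
  obtain q p where q: "0 < q" "q \<le> int ((4 * N) ^ card \<Gamma>)"
    and p: "\<And>i. i < card \<Gamma> \<Longrightarrow> \<bar>of_int q * (h i / M) - of_int (p i)\<bar> < 1 / real (4 * N)"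
    using Dirichlet_approx_simult[of "4 * N" "card \<Gamma>" "\<lambda>i. h i / M"] \<open>N > 0\<close> by auto
  have "(4 * N) ^ card \<Gamma> \<le> (4 * N) ^ G" using cG \<open>N > 0\<close> by (intro power_increasing) auto
  then have qM: "q < M" using q NM by linarith
  have cos_per: "cos (x + 2 * pi * real_of_int m) = cos x" for x m
    by (simp add: cos_add cos_int_2pin sin_int_2pin)
  have cos_ge: "cos (2 * pi * (real_of_int (int j * q) * real \<xi> / M)) \<ge> 0" if "j \<le> N" "\<xi> \<in> \<Gamma>" for j \<xi>
  proof -
    have "\<xi> \<in> h ` {0..<card \<Gamma>}" using h that by (simp add: bij_betw_def)
    then obtain i where i: "i < card \<Gamma>" "\<xi> = h i" by auto
    define \<theta> where "\<theta> = of_int q * (h i / M) - of_int (p i)"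
    have "\<bar>real j * \<theta>\<bar> \<le> N * (1 / real (4 * N))"
      unfolding abs_mult \<theta>_def using that p[OF i(1)] by (intro mult_mono) auto
    then have t: "\<bar>real j * \<theta>\<bar> \<le> 1 / 4" using \<open>N > 0\<close> by simp
    have "2 * pi * (real_of_int (int j * q) * real \<xi> / M) = 2 * pi * (j * \<theta>) + 2 * pi * of_int (int j * p i)"
      by (simp add: \<theta>_def i algebra_simps)
    then have "cos (2 * pi * (real_of_int (int j * q) * real \<xi> / M)) = cos (2 * pi * (j * \<theta>))"
      by (simp only: cos_per)
    moreover have "\<bar>2 * pi * (j * \<theta>)\<bar> \<le> pi / 2"
      using mult_left_mono[OF t, of "2 * pi"] by (simp add: abs_mult)
    then have "- (pi / 2) \<le> 2 * pi * (j * \<theta>)" "2 * pi * (j * \<theta>) \<le> pi / 2" by linarith+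
    ultimately show ?thesis using cos_ge_zero by simp
  qed
  show ?thesis
  proof (rule that[OF q(1) qM], rule ccontr)
    fix j :: nat
    assume j: "j \<le> N" and neg: "\<not> (\<exists>a\<in>B. \<exists>b\<in>B. \<exists>c\<in>B. \<exists>d\<in>B. int M dvd a + b - c - d - int j * q)"
    define n where "n = int j * q"
    \<comment> \<open>Summed over \<xi>, this counts \<open>M\<close> times the solutions of
      \<open>a + b - c - d = n\<close> modulo \<open>M\<close>. Without solutions the sum is 0, but
      its real part is at least \<open>card B ^ 4\<close> from frequency 0, plus nonnegative terms
      from \<Gamma>, minus at most half as much from the rest.\<close>
    have "f \<xi> * f \<xi> * cnj (f \<xi>) * cnj (f \<xi>) * e (- n) \<xi>
        = (\<Sum>a\<in>B. \<Sum>b\<in>B. \<Sum>c\<in>B. \<Sum>d\<in>B. e (a + b - c - d - n) \<xi>)" for \<xi>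
      unfolding f_def cnj_sum e_cnj
      by (simp add: sum_distrib_left sum_distrib_right e_add[symmetric] algebra_simps)
    then have "(\<Sum>\<xi><M. f \<xi> * f \<xi> * cnj (f \<xi>) * cnj (f \<xi>) * e (- n) \<xi>)
        = (\<Sum>\<xi><M. \<Sum>a\<in>B. \<Sum>b\<in>B. \<Sum>c\<in>B. \<Sum>d\<in>B. e (a + b - c - d - n) \<xi>)" by simp
    also have "\<dots> = (\<Sum>a\<in>B. \<Sum>b\<in>B. \<Sum>c\<in>B. \<Sum>d\<in>B. \<Sum>\<xi><M. e (a + b - c - d - n) \<xi>)"
      by (simp only: sum.swap[of _ _ "{..<M}"])
    also have "\<dots> = 0"
      unfolding e_sum using neg by (intro sum.neutral ballI) (auto simp: n_def)
    finally have z: "(\<Sum>\<xi><M. f \<xi> * f \<xi> * cnj (f \<xi>) * cnj (f \<xi>) * e (- n) \<xi>) = 0" .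
    have "Re (f \<xi> * f \<xi> * cnj (f \<xi>) * cnj (f \<xi>) * e (- n) \<xi>)
        = (cmod (f \<xi>)) ^ 4 * cos (2 * pi * (real_of_int n * real \<xi> / M))" for \<xi>
    proof -
      have "f \<xi> * f \<xi> * cnj (f \<xi>) * cnj (f \<xi>) = (f \<xi> * cnj (f \<xi>)) * (f \<xi> * cnj (f \<xi>))"
        by (simp add: algebra_simps)
      also have "\<dots> = of_real ((cmod (f \<xi>)) ^ 4)"
        unfolding complex_norm_square[symmetric] of_real_mult[symmetric] by (simp flip: power_add)
      finally show ?thesis by (simp add: e_def)
    qed
    then have "(\<Sum>\<xi><M. (cmod (f \<xi>)) ^ 4 * cos (2 * pi * (real_of_int n * real \<xi> / M))) = 0"
      using z by (metis (mono_tags, lifting) Re_sum sum.cong zero_complex.sel(1))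
    also have "{..<M} = {0} \<union> (\<Gamma> - {0}) \<union> ({..<M} - \<Gamma> - {0})" using M0 sub\<Gamma> by auto
    also have "(\<Sum>\<xi>\<in>\<dots>. (cmod (f \<xi>)) ^ 4 * cos (2 * pi * (real_of_int n * real \<xi> / M)))
       = real (card B) ^ 4 + (\<Sum>\<xi>\<in>\<Gamma> - {0}. (cmod (f \<xi>)) ^ 4 * cos (2 * pi * (real_of_int n * real \<xi> / M)))
         + (\<Sum>\<xi>\<in>{..<M} - \<Gamma> - {0}. (cmod (f \<xi>)) ^ 4 * cos (2 * pi * (real_of_int n * real \<xi> / M)))"
      using fin\<Gamma> by (subst sum.union_disjoint, simp, simp, blast, subst sum.union_disjoint) (auto simp: f0)
    finally have eq: "real (card B) ^ 4 + (\<Sum>\<xi>\<in>\<Gamma> - {0}. (cmod (f \<xi>)) ^ 4 * cos (2 * pi * (real_of_int n * real \<xi> / M)))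
         + (\<Sum>\<xi>\<in>{..<M} - \<Gamma> - {0}. (cmod (f \<xi>)) ^ 4 * cos (2 * pi * (real_of_int n * real \<xi> / M))) = 0" .
    have 1: "(\<Sum>\<xi>\<in>\<Gamma> - {0}. (cmod (f \<xi>)) ^ 4 * cos (2 * pi * (real_of_int n * real \<xi> / M))) \<ge> 0"
      using cos_ge[OF j] by (intro sum_nonneg mult_nonneg_nonneg) (auto simp: n_def)
    have "- (\<Sum>\<xi>\<in>{..<M} - \<Gamma> - {0}. (cmod (f \<xi>)) ^ 4 * cos (2 * pi * (real_of_int n * real \<xi> / M)))
        = (\<Sum>\<xi>\<in>{..<M} - \<Gamma> - {0}. - ((cmod (f \<xi>)) ^ 4 * cos (2 * pi * (real_of_int n * real \<xi> / M))))"
      by (rule sum_negf[symmetric])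
    also have "\<dots> \<le> (\<Sum>\<xi>\<in>{..<M} - \<Gamma> - {0}. (card B)\<^sup>2 / (2 * R) * (cmod (f \<xi>))\<^sup>2)"
    proof (rule sum_mono)
      fix \<xi> assume "\<xi> \<in> {..<M} - \<Gamma> - {0}"
      then have "(cmod (f \<xi>))\<^sup>2 \<le> (card B)\<^sup>2 / (2 * R)" by (auto simp: \<Gamma>_def)
      then have "(cmod (f \<xi>))\<^sup>2 * (cmod (f \<xi>))\<^sup>2 \<le> (card B)\<^sup>2 / (2 * R) * (cmod (f \<xi>))\<^sup>2"
        by (intro mult_right_mono) auto
      moreover have "(cmod (f \<xi>)) ^ 4 * (- cos (2 * pi * (real_of_int n * real \<xi> / M))) \<le> (cmod (f \<xi>)) ^ 4 * 1"
        using cos_ge_minus_one[of "2 * pi * (real_of_int n * real \<xi> / M)"] by (intro mult_left_mono) auto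
      moreover have "(cmod (f \<xi>)) ^ 4 = (cmod (f \<xi>))\<^sup>2 * (cmod (f \<xi>))\<^sup>2"
        by (simp flip: power_add)
      ultimately show "- ((cmod (f \<xi>)) ^ 4 * cos (2 * pi * (real_of_int n * real \<xi> / M))) \<le> (card B)\<^sup>2 / (2 * R) * (cmod (f \<xi>))\<^sup>2"
        by linarith
    qed
    also have "\<dots> \<le> (card B)\<^sup>2 / (2 * R) * (\<Sum>\<xi><M. (cmod (f \<xi>))\<^sup>2)"
      unfolding sum_distrib_left using R0 by (intro sum_mono2) auto
    also have "\<dots> = (card B)\<^sup>2 / (2 * R) * (M * card B)" by (simp only: parseval)
    also have "\<dots> \<le> (card B)\<^sup>2 / (2 * R) * (R * card B * card B)"
      using MR R0 by (intro mult_left_mono) (auto simp: mult_right_mono)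
    also have "\<dots> = real (card B) ^ 4 / 2" using R0 by (simp add: power2_eq_square power4_eq_xxxx)
    finally have "real (card B) ^ 4 \<le> real (card B) ^ 4 / 2" using eq 1 by linarith
    then show False using cB by (simp add: zero_less_power less_le_not_le[symmetric])
  qed
qed

section \<open>Elementary properties of the projection along a vector\<close>

lemma orth_proj_add: "orth_proj v (x + y) = orth_proj v x + orth_proj v y"
  by (simp add: orth_proj_def inner_add_right add_divide_distrib scaleR_left_distrib)

lemma orth_proj_diff: "orth_proj v (x - y) = orth_proj v x - orth_proj v y"
  by (simp add: orth_proj_def inner_diff_right diff_divide_distrib scaleR_left_diff_distrib)

lemma orth_proj_scaleR: "orth_proj v (c *\<^sub>R x) = c *\<^sub>R orth_proj v x"
  by (simp add: orth_proj_def scaleR_right_diff_distrib)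

lemma orth_proj_self: "orth_proj v (c *\<^sub>R v) = 0"
  by (cases "v = 0") (auto simp: orth_proj_def)

lemma linear_orth_proj: "linear (orth_proj v)"
  by (rule linearI) (simp_all add: orth_proj_add orth_proj_scaleR)

lemma orth_proj_eq_iff: "orth_proj v x = orth_proj v y \<longleftrightarrow> (\<exists>c. x = y + c *\<^sub>R v)"
proof
  assume "orth_proj v x = orth_proj v y"
  then have "x = y + ((v \<bullet> x) / (v \<bullet> v) - (v \<bullet> y) / (v \<bullet> v)) *\<^sub>R v"
    by (simp add: orth_proj_def algebra_simps)
  then show "\<exists>c. x = y + c *\<^sub>R v" ..
qed (auto simp: orth_proj_add orth_proj_self)

lemma sum_lessThan_6: "(\<Sum>i<6::nat. f i) = f 0 + f 1 + f 2 + f 3 + f 4 + f (5::nat)"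
  by (simp add: eval_nat_numeral)

text \<open>The progression found modulo \<open>M\<close> is pulled back through the model. Its step
  relation \<open>X (Suc j) = X j + X 1\<close> is an equation between two sums of six points of
  \<open>A'\<close>, which explains the 6 in \<open>freiman_model\<close> and, by
  \<open>pluennecke\<close>, the exponent 12.\<close>

lemma long_progression:
  fixes A :: "'a::euclidean_space set" and K :: real
  assumes "finite A" "A \<noteq> {}" and K: "card (difference_set A A) \<le> K * card A" and "K \<ge> 1"
    and G: "2 * (30 * K ^ 12) ^ 2 \<le> real G" and "N > 0" and N: "(4 * N) ^ G \<le> card A"
  obtains w where "w \<noteq> 0" "\<And>j::nat. 1 \<le> j \<Longrightarrow> j \<le> N \<Longrightarrow>
    \<exists>a\<in>A. \<exists>b\<in>A. \<exists>c\<in>A. \<exists>d\<in>A. real j *\<^sub>R w = a + b - c - d"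
proof -
  define S where "S = difference_set (iter_sumset 6 A) (iter_sumset 6 A)"
  \<comment> \<open>Large enough for the model (\<open>3 * card S\<close>) and to exceed
    \<open>(4 * N) ^ G\<close> (the term \<open>card A\<close>), yet at most
    \<open>5 * K ^ 12 * card A\<close>. As \<open>A'\<close> keeps a sixth of \<open>A\<close>, the
    density parameter becomes \<open>30 * K ^ 12\<close>.\<close>
  define M where "M = 3 * card S + card A + 1"
  have cA: "card A > 0" using assms by (simp add: card_gt_0_iff)
  obtain A' \<psi> where A': "A' \<subseteq> A" "card A \<le> 6 * card A'"
    and iso0: "\<And>x y. (\<And>i. i < 6 \<Longrightarrow> x i \<in> A' \<and> y i \<in> A') \<Longrightarrow>
      (\<Sum>i<6::nat. x i) = (\<Sum>i<6. y i) \<longleftrightarrow> int M dvd (\<Sum>i<6. \<psi> (x i)) - (\<Sum>i<6. \<psi> (y i))"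
    using freiman_model[OF assms(1,2), of M] by (auto simp: M_def S_def)
  have iso: "x0 + x1 + x2 + x3 + x4 + x5 = y0 + y1 + y2 + y3 + y4 + y5 \<longleftrightarrow>
      int M dvd (\<psi> x0 + \<psi> x1 + \<psi> x2 + \<psi> x3 + \<psi> x4 + \<psi> x5) - (\<psi> y0 + \<psi> y1 + \<psi> y2 + \<psi> y3 + \<psi> y4 + \<psi> y5)"
    if xs: "x0 \<in> A'" "x1 \<in> A'" "x2 \<in> A'" "x3 \<in> A'" "x4 \<in> A'" "x5 \<in> A'"
      and ys: "y0 \<in> A'" "y1 \<in> A'" "y2 \<in> A'" "y3 \<in> A'" "y4 \<in> A'" "y5 \<in> A'"
    for x0 x1 x2 x3 x4 x5 y0 y1 y2 y3 y4 y5
  proof -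
    have "[x0, x1, x2, x3, x4, x5] ! i \<in> A' \<and> [y0, y1, y2, y3, y4, y5] ! i \<in> A'" if "i < 6" for i
    proof -
      have "i = 0 \<or> i = 1 \<or> i = 2 \<or> i = 3 \<or> i = 4 \<or> i = 5" using \<open>i < 6\<close> by linarith
      then show ?thesis using xs ys by (elim disjE) simp_all
    qed
    from iso0[of "\<lambda>i. [x0, x1, x2, x3, x4, x5] ! i" "\<lambda>i. [y0, y1, y2, y3, y4, y5] ! i", OF this]
    show ?thesis by (simp add: sum_lessThan_6)
  qed
  define B where "B = \<psi> ` A'"
  have finA': "finite A'" using A' assms finite_subset by auto
  have neA': "A' \<noteq> {}" using A'(2) cA by auto
  have inj1: "x = y" if "x \<in> A'" "y \<in> A'" "int M dvd \<psi> x - \<psi> y" for x y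
    using iso[of x y y y y y y y y y y y] that by simp
  have injm: "inj_on (\<lambda>b. b mod int M) B"
    using inj1 by (auto simp: inj_on_def B_def mod_eq_dvd_iff)
  have "inj_on \<psi> A'" using inj1 by (auto simp: inj_on_def)
  then have cB: "card B = card A'" by (simp add: B_def card_image)
  have "real (card S) \<le> K ^ 12 * card A"
    using pluennecke[OF assms(1,2) K, of 6] by (simp add: S_def)
  moreover have "real (card A) \<le> K ^ 12 * card A" "1 \<le> K ^ 12 * card A"
    using \<open>K \<ge> 1\<close> cA mult_mono[of 1 "K ^ 12" 1 "real (card A)"]
    by (auto simp: one_le_power mult_le_cancel_right1)
  ultimately have "real M \<le> 5 * (K ^ 12 * card A)" by (simp add: M_def)
  also have "\<dots> \<le> 5 * (K ^ 12 * (6 * card A'))"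
    using A'(2) \<open>K \<ge> 1\<close> by (intro mult_left_mono) auto
  finally have MR: "real M \<le> 30 * K ^ 12 * card B" by (simp add: cB)
  have NM: "(4 * N) ^ G < M" using N by (simp add: M_def)
  have finB: "finite B" "B \<noteq> {}" using finA' neA' by (auto simp: B_def)
  obtain q :: int where q: "0 < q" "q < M"
    and ex: "\<And>j::nat. j \<le> N \<Longrightarrow> \<exists>a\<in>B. \<exists>b\<in>B. \<exists>c\<in>B. \<exists>d\<in>B. int M dvd a + b - c - d - int j * q"
    by (rule bogolyubov_progression[OF finB injm MR G \<open>N > 0\<close> NM]) (rule that)
  have "\<exists>a\<in>A'. \<exists>b\<in>A'. \<exists>c\<in>A'. \<exists>d\<in>A'. int M dvd \<psi> a + \<psi> b - \<psi> c - \<psi> d - int j * q" if "j \<le> N" for j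
    using ex[OF that] by (auto simp: B_def)
  then obtain \<alpha> \<beta> \<gamma> \<delta> where mem: "\<And>j. j \<le> N \<Longrightarrow> \<alpha> j \<in> A' \<and> \<beta> j \<in> A' \<and> \<gamma> j \<in> A' \<and> \<delta> j \<in> A'"
    and dv: "\<And>j. j \<le> N \<Longrightarrow> int M dvd \<psi> (\<alpha> j) + \<psi> (\<beta> j) - \<psi> (\<gamma> j) - \<psi> (\<delta> j) - int j * q"
    by metis
  define X where "X = (\<lambda>j. \<alpha> j + \<beta> j - \<gamma> j - \<delta> j)"
  have step: "X (Suc j) = X j + X 1" if "Suc j \<le> N" for j
  proof -
    have m: "\<alpha> (Suc j) \<in> A'" "\<beta> (Suc j) \<in> A'" "\<gamma> (Suc j) \<in> A'" "\<delta> (Suc j) \<in> A'"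
      "\<alpha> j \<in> A'" "\<beta> j \<in> A'" "\<gamma> j \<in> A'" "\<delta> j \<in> A'" "\<alpha> 1 \<in> A'" "\<beta> 1 \<in> A'" "\<gamma> 1 \<in> A'" "\<delta> 1 \<in> A'"
      using mem[of "Suc j"] mem[of j] mem[of 1] that by auto
    have "int M dvd (\<psi> (\<alpha> (Suc j)) + \<psi> (\<beta> (Suc j)) - \<psi> (\<gamma> (Suc j)) - \<psi> (\<delta> (Suc j)) - int (Suc j) * q)
      - (\<psi> (\<alpha> j) + \<psi> (\<beta> j) - \<psi> (\<gamma> j) - \<psi> (\<delta> j) - int j * q)
      - (\<psi> (\<alpha> 1) + \<psi> (\<beta> 1) - \<psi> (\<gamma> 1) - \<psi> (\<delta> 1) - int 1 * q)"
      by (rule dvd_diff[OF dvd_diff[OF dv dv] dv]) (use that in auto)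
    then have "\<alpha> (Suc j) + \<beta> (Suc j) + \<gamma> j + \<delta> j + \<gamma> 1 + \<delta> 1
        = \<gamma> (Suc j) + \<delta> (Suc j) + \<alpha> j + \<beta> j + \<alpha> 1 + \<beta> 1"
      by (subst iso) (use m in \<open>simp_all add: algebra_simps\<close>)
    then have "X (Suc j) - X j - X 1 = 0" by (simp add: X_def algebra_simps)
    then show ?thesis by (simp add: algebra_simps)
  qed
  have X1: "X 1 \<noteq> 0"
  proof
    assume "X 1 = 0"
    have m: "\<alpha> 1 \<in> A'" "\<beta> 1 \<in> A'" "\<gamma> 1 \<in> A'" "\<delta> 1 \<in> A'" using mem[of 1] \<open>N > 0\<close> by auto
    have "\<alpha> 1 + \<beta> 1 = \<gamma> 1 + \<delta> 1" using \<open>X 1 = 0\<close> by (simp add: X_def algebra_simps)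
    \<comment> \<open>Four copies of \<open>\<alpha> 1\<close> pad the relation to the six terms
      that \<open>iso\<close> needs; the conclusion \<open>M dvd q\<close> contradicts
      \<open>0 < q < M\<close>.\<close>
    then have "\<alpha> 1 + \<beta> 1 + \<alpha> 1 + \<alpha> 1 + \<alpha> 1 + \<alpha> 1 = \<gamma> 1 + \<delta> 1 + \<alpha> 1 + \<alpha> 1 + \<alpha> 1 + \<alpha> 1" by simp
    then have "int M dvd \<psi> (\<alpha> 1) + \<psi> (\<beta> 1) - \<psi> (\<gamma> 1) - \<psi> (\<delta> 1)"
      by (subst (asm) iso) (use m in \<open>simp_all add: algebra_simps\<close>)
    then have "int M dvd \<psi> (\<alpha> 1) + \<psi> (\<beta> 1) - \<psi> (\<gamma> 1) - \<psi> (\<delta> 1)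
        - (\<psi> (\<alpha> 1) + \<psi> (\<beta> 1) - \<psi> (\<gamma> 1) - \<psi> (\<delta> 1) - int 1 * q)"
      by (rule dvd_diff[OF _ dv]) (use \<open>N > 0\<close> in auto)
    then have "int M dvd q" by simp
    then show False using q zdvd_not_zless by blast
  qed
  have mult: "X j = real j *\<^sub>R X 1" if "1 \<le> j" "j \<le> N" for j
    using that
  proof (induction j rule: dec_induct)
    case (step j)
    then show ?case using \<open>\<And>j. Suc j \<le> N \<Longrightarrow> X (Suc j) = X j + X 1\<close>[of j] by (simp add: algebra_simps)
  qed simp
  have "\<exists>a\<in>A. \<exists>b\<in>A. \<exists>c\<in>A. \<exists>d\<in>A. real j *\<^sub>R X 1 = a + b - c - d" if "1 \<le> j" "j \<le> N" for j
  proof -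
    have "real j *\<^sub>R X 1 = X j" using mult[OF that] by simp
    also have "X j = \<alpha> j + \<beta> j - \<gamma> j - \<delta> j" by (simp add: X_def)
    finally show ?thesis using mem[of j] that(2) A'(1) by blast
  qed
  with X1 show ?thesis by (rule that)
qed

text \<open>The progression \<open>{w, \<dots>, Nw} \<subseteq> 2A - 2A\<close> makes every line in direction \<open>w\<close> that meets \<open>A\<close> meet
  \<open>3A - 2A\<close> in at least \<open>N\<close> points.\<close>

lemma card_orth_proj_le_power:
  fixes K :: real
  assumes "K \<ge> 1"
  obtains \<sigma> C :: real where "0 < \<sigma>" "\<sigma> < 1" "0 < C"
    "\<And>A :: 'a::euclidean_space set. finite A \<Longrightarrow> A \<noteq> {} \<Longrightarrow> card (difference_set A A) \<le> K * card A \<Longrightarrow>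
      \<exists>v. v \<noteq> 0 \<and> card (orth_proj v ` A) \<le> C * card A powr (1 - \<sigma>)"
proof -
  define G where "G = nat \<lceil>2 * (30 * K ^ 12) ^ 2\<rceil>"
  have G: "2 * (30 * K ^ 12) ^ 2 \<le> real G" unfolding G_def by linarith
  have "1 \<le> 30 * K ^ 12" using one_le_power[OF assms, of 12] by linarith
  then have "1 \<le> (30 * K ^ 12) ^ 2" by (rule one_le_power)
  then have G1: "real G > 1" using G by linarith
  \<comment> \<open>With \<open>y = card A powr \<sigma>\<close> one has
    \<open>y ^ G = card A\<close>, so \<open>N = \<lfloor>y / 4\<rfloor>\<close> meets the condition
    \<open>(4 * N) ^ G \<le> card A\<close>.\<close>
  define \<sigma> where "\<sigma> = 1 / real G"
  \<comment> \<open>\<open>K ^ 6\<close> is the bound for \<open>3A - 3A\<close> and 8 comes from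
    \<open>N \<ge> y / 8\<close>; the 4 covers small sets, where \<open>N = 0\<close> and
    \<open>y \<le> 4\<close>.\<close>
  define C where "C = 8 * K ^ 6 + 4"
  have K6: "K ^ 6 \<ge> 0" using assms by simp
  show ?thesis
  proof (rule that[of \<sigma> C])
    show "0 < \<sigma>" "\<sigma> < 1" using G1 by (auto simp: \<sigma>_def)
    show "0 < C" using K6 unfolding C_def by linarith
    fix A :: "'a set"
    assume A: "finite A" "A \<noteq> {}" "card (difference_set A A) \<le> K * card A"
    have cA: "card A > 0" using A by (simp add: card_gt_0_iff)
    define y where "y = real (card A) powr \<sigma>"
    have y0: "y > 0" using cA by (simp add: y_def)
    have yG: "y ^ G = card A"
      using cA G1 by (simp add: y_def \<sigma>_def powr_powr flip: powr_realpow)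
    have split: "real (card A) = card A powr (1 - \<sigma>) * y"
      using cA by (simp add: y_def flip: powr_add)
    define N where "N = nat \<lfloor>y / 4\<rfloor>"
    show "\<exists>v. v \<noteq> 0 \<and> card (orth_proj v ` A) \<le> C * card A powr (1 - \<sigma>)"
    proof (cases "N = 0")
      case True
      then have "y \<le> 4" using y0 unfolding N_def by simp
      obtain v :: 'a where v: "v \<noteq> 0" using nonempty_Basis nonzero_Basis by blast
      have "real (card (orth_proj v ` A)) \<le> card A" using card_image_le[OF A(1)] by simp
      also have "\<dots> \<le> card A powr (1 - \<sigma>) * 4"
        by (rule order_trans[OF eq_refl[OF split]], rule mult_left_mono) (use \<open>y \<le> 4\<close> in auto)
      also have "\<dots> \<le> C * card A powr (1 - \<sigma>)"
        using K6 by (simp add: C_def algebra_simps)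
      finally show ?thesis using v by blast
    next
      case False
      then have N: "real N \<le> y / 4" "y / 8 \<le> real N" unfolding N_def by linarith+
      have "real ((4 * N) ^ G) \<le> y ^ G"
        unfolding of_nat_power using N by (intro power_mono) auto
      then have hN: "(4 * N) ^ G \<le> card A" unfolding yG of_nat_le_iff .
      have N0: "N > 0" using False by simp
      obtain w where w: "w \<noteq> 0" and ap: "\<And>j::nat. 1 \<le> j \<Longrightarrow> j \<le> N \<Longrightarrow>
          \<exists>a\<in>A. \<exists>b\<in>A. \<exists>c\<in>A. \<exists>d\<in>A. real j *\<^sub>R w = a + b - c - d"
        by (rule long_progression[OF A assms G N0 hN]) (rule that)
      obtain a0 where a0: "a0 \<in> A" using A by blast
      \<comment> \<open>Subtracting the fixed point \<open>a0\<close> does not affect injectivity;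
        it only balances the expression to three summands on each side, as \<open>pluennecke\<close>
        requires.\<close>
      define F where "F = (\<lambda>(p, j). inv_into A (orth_proj w) p + real j *\<^sub>R w - a0)"
      define D where "D = difference_set (iter_sumset 3 A) (iter_sumset 3 A)"
      have sum3: "x + y + z \<in> iter_sumset 3 A" if "x \<in> A" "y \<in> A" "z \<in> A" for x y z
      proof -
        have "x + (y + (z + 0)) \<in> A + (A + (A + {0}))" using that by (intro set_plus_intro) auto
        then show ?thesis by (simp add: eval_nat_numeral add.assoc)
      qed
      have "F ` ((orth_proj w ` A) \<times> {1..N}) \<subseteq> D"
      proof clarify
        fix x j assume x: "x \<in> A" and j: "j \<in> {1..N}"
        obtain a b c d where abcd: "a \<in> A" "b \<in> A" "c \<in> A" "d \<in> A" "real j *\<^sub>R w = a + b - c - d"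
          using ap[of j] j by auto
        define x' where "x' = inv_into A (orth_proj w) (orth_proj w x)"
        have "x' \<in> A" using x by (simp add: x'_def inv_into_into)
        then have "(x' + a + b) - (c + d + a0) \<in> D"
          unfolding D_def using abcd a0 by (intro difference_setI sum3)
        moreover have "F (orth_proj w x, j) = (x' + a + b) - (c + d + a0)"
          by (simp add: F_def x'_def abcd algebra_simps)
        ultimately show "F (orth_proj w x, j) \<in> D" by simp
      qed
      moreover have "inj_on F ((orth_proj w ` A) \<times> {1..N})"
      proof (rule inj_onI, clarify)
        fix x j x' j' assume x: "x \<in> A" "x' \<in> A" and eq: "F (orth_proj w x, j) = F (orth_proj w x', j')"
        have p: "orth_proj w (F (p, k) + a0) = p" if "p \<in> orth_proj w ` A" for p k
          using that by (simp add: F_def orth_proj_add orth_proj_self f_inv_into_f)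
        have "orth_proj w x = orth_proj w x'"
          using p[of "orth_proj w x" j] p[of "orth_proj w x'" j'] eq x by simp
        moreover from this eq have "real j *\<^sub>R w = real j' *\<^sub>R w" by (simp add: F_def)
        ultimately show "orth_proj w x = orth_proj w x' \<and> j = j'" using w by simp
      qed
      ultimately have "card ((orth_proj w ` A) \<times> {1..N}) \<le> card D"
        using A by (intro card_inj_on_le) (auto simp: D_def)
      then have "card (orth_proj w ` A) * N \<le> card D" by (simp add: card_cartesian_product)
      then have "real (card (orth_proj w ` A)) * N \<le> card D" by (metis of_nat_le_iff of_nat_mult)
      also have "\<dots> \<le> K ^ 6 * card A" using pluennecke[OF A, of 3] by (simp add: D_def)
      finally have "real (card (orth_proj w ` A)) * N \<le> K ^ 6 * card A" .
      moreover have "real (card (orth_proj w ` A)) * (y / 8) \<le> real (card (orth_proj w ` A)) * N"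
        using N by (intro mult_left_mono) auto
      ultimately have "real (card (orth_proj w ` A)) * (y / 8) \<le> K ^ 6 * (card A powr (1 - \<sigma>) * y)"
        using split by simp
      then have "real (card (orth_proj w ` A)) \<le> 8 * K ^ 6 * card A powr (1 - \<sigma>)"
        using y0 by (simp add: field_simps)
      also have "\<dots> \<le> C * card A powr (1 - \<sigma>)" by (intro mult_right_mono) (auto simp: C_def)
      finally show ?thesis using w by blast
    qed
  qed
qed

section \<open>Supporting faces and cosets\<close>

text \<open>Faces are kept as subsets of the finite set itself, so that their points can be counted.
  The face is all of \<open>S\<close> exactly when the functional is constant on \<open>S\<close>;
  it is then not proper, a case that has to be excluded repeatedly.\<close>

definition minface :: "'a::euclidean_space \<Rightarrow> 'a set \<Rightarrow> 'a set" where
  "minface u S = {x \<in> S. \<forall>y\<in>S. u \<bullet> x \<le> u \<bullet> y}"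

lemma minface_subset: "minface u S \<subseteq> S"
  by (auto simp: minface_def)

lemma minface_nonempty:
  assumes "finite S" "S \<noteq> {}"
  shows "minface u S \<noteq> {}"
proof -
  obtain x where "x \<in> S" "\<And>y. y \<in> S \<Longrightarrow> u \<bullet> x \<le> u \<bullet> y"
    using arg_min_if_finite[OF assms, of "\<lambda>x. u \<bullet> x"] by (metis not_le)
  then show ?thesis by (auto simp: minface_def)
qed

lemma minface_less: "x \<in> minface u S \<Longrightarrow> y \<in> S \<Longrightarrow> y \<notin> minface u S \<Longrightarrow> u \<bullet> x < u \<bullet> y"
  unfolding minface_def by (smt (verit) mem_Collect_eq)

lemma minface_eq: "x \<in> minface u S \<Longrightarrow> y \<in> minface u S \<Longrightarrow> u \<bullet> x = u \<bullet> y"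
  unfolding minface_def by (simp add: order_antisym)

lemma face_of_convex_hull_Int:
  fixes S :: "'a::euclidean_space set"
  assumes "finite S" "F face_of convex hull S"
  shows "F = convex hull (S \<inter> F)"
proof -
  obtain S' where S': "S' \<subseteq> S" "F = convex hull S'"
    using face_of_convex_hull_subset[OF finite_imp_compact[OF assms(1)] assms(2)] by blast
  have "S' \<subseteq> S \<inter> F" using S' hull_subset[of S' convex] by blast
  then have "F \<subseteq> convex hull (S \<inter> F)" using S' hull_mono by metis
  moreover have "convex hull (S \<inter> F) \<subseteq> F"
    using S' by (intro hull_minimal) auto
  ultimately show ?thesis by blast
qed

text \<open>In the polytope \<open>convex hull S\<close> a proper nonempty face lies in a facet, and
  facets of polyhedra are exposed. The negated outer normal serves as \<open>u\<close>; since a face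
  is the hull of the points of \<open>S\<close> on it, no dimension is lost in going back to
  \<open>S\<close>.\<close>

lemma minface_subset_facet:
  fixes S :: "'a::euclidean_space set"
  assumes "finite S" "minface w S \<noteq> S"
  obtains u where "minface w S \<subseteq> minface u S" "aff_dim (minface u S) = aff_dim S - 1"
proof -
  have ne: "S \<noteq> {}" using assms by (auto simp: minface_def)
  define P where "P = convex hull S"
  have poly: "polyhedron P" unfolding P_def
    by (intro polytope_imp_polyhedron polytope_convex_hull assms)
  obtain x0 where x0: "x0 \<in> minface w S" using minface_nonempty[OF assms(1) ne] by blast
  define c where "c = P \<inter> {x. w \<bullet> x = w \<bullet> x0}"
  have "P \<subseteq> {x. w \<bullet> x \<ge> w \<bullet> x0}"
    unfolding P_def using x0 by (intro hull_minimal convex_halfspace_ge) (auto simp: minface_def)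
  then have face: "c face_of P"
    unfolding c_def P_def by (intro face_of_Int_supporting_hyperplane_ge) auto
  have sub: "minface w S \<subseteq> c"
    using minface_eq[OF _ x0] minface_subset[of w S] hull_subset[of S convex] unfolding c_def P_def by blast
  obtain y0 where y0: "y0 \<in> S" "y0 \<notin> minface w S" using assms minface_subset by blast
  have "y0 \<in> P" using y0 unfolding P_def by (simp add: hull_inc)
  moreover have "y0 \<notin> c" using minface_less[OF x0 y0] by (simp add: c_def)
  ultimately have "c \<noteq> P" by blast
  moreover have "c \<noteq> {}" using sub x0 by blast
  ultimately obtain F where F: "F facet_of P" "c \<subseteq> F"
    using face_of_polyhedron_subset_facet[OF poly face] by blast
  have Fface: "F face_of P" and Fdim: "aff_dim F = aff_dim P - 1"
    using F(1) by (auto simp: facet_of_def)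
  then have "F exposed_face_of P" using exposed_face_of_polyhedron[OF poly] by blast
  then obtain a b where ab: "P \<subseteq> {x. a \<bullet> x \<le> b}" "F = P \<inter> {x. a \<bullet> x = b}"
    by (auto simp: exposed_face_of_def)
  have x0F: "x0 \<in> F" "x0 \<in> S" using x0 sub F(2) minface_subset[of w S] by auto
  have "minface (- a) S = S \<inter> F"
  proof -
    have S: "S \<subseteq> P" unfolding P_def by (rule hull_subset)
    have "x \<in> minface (- a) S \<longleftrightarrow> x \<in> S \<and> a \<bullet> x = b" for x
    proof -
      have "a \<bullet> y \<le> b" if "y \<in> S" for y using ab(1) S that by blast
      moreover have "a \<bullet> x0 = b" using x0F ab(2) by blast
      ultimately show ?thesis using x0F(2) unfolding minface_def
        by (auto intro: order_antisym)
    qed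
    then show ?thesis using ab(2) S by blast
  qed
  moreover have "aff_dim (S \<inter> F) = aff_dim S - 1"
    using Fdim face_of_convex_hull_Int[OF assms(1), of F] Fface unfolding P_def
    by (metis aff_dim_convex_hull)
  moreover have "minface w S \<subseteq> S \<inter> F" using sub F(2) minface_subset by blast
  ultimately show ?thesis using that[of "- a"] by simp
qed

lemma ex_facet:
  assumes "finite S" "aff_dim S \<ge> 1"
  obtains u where "aff_dim (minface u S) = aff_dim S - 1"
proof -
  obtain x y where xy: "x \<in> S" "y \<in> S" "x \<noteq> y"
  proof -
    have "\<not> (\<exists>a. S \<subseteq> {a})"
      using assms(2) aff_dim_subset[of S] aff_dim_sing by (metis linorder_not_less zero_less_one_class.zero_less_one order_trans not_one_le_zero)
    then show ?thesis using that by blast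
  qed
  have "minface (x - y) S \<noteq> S"
  proof
    assume "minface (x - y) S = S"
    then have "(x - y) \<bullet> x = (x - y) \<bullet> y" using xy minface_eq by metis
    then have "(x - y) \<bullet> (x - y) = 0" by (simp add: inner_diff_right)
    then show False using xy by simp
  qed
  then show ?thesis using minface_subset_facet[OF assms(1)] that by metis
qed

text \<open>The direction space of the affine hull. Being linear, it can be compared between sets in
  different positions.\<close>

definition dirspan :: "'a::euclidean_space set \<Rightarrow> 'a set" where
  "dirspan S = span {x - y | x y. x \<in> S \<and> y \<in> S}"

lemma subspace_dirspan: "subspace (dirspan S)"
  by (simp add: dirspan_def)

lemma diff_in_dirspan: "x \<in> S \<Longrightarrow> y \<in> S \<Longrightarrow> x - y \<in> dirspan S"
  unfolding dirspan_def by (rule span_base) auto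

lemma dirspan_subset: "subspace U \<Longrightarrow> (\<And>x y. x \<in> S \<Longrightarrow> y \<in> S \<Longrightarrow> x - y \<in> U) \<Longrightarrow> dirspan S \<subseteq> U"
  unfolding dirspan_def by (rule span_minimal) auto

lemma dim_dirspan:
  assumes "S \<noteq> {}"
  shows "int (dim (dirspan S)) = aff_dim S"
proof -
  obtain a where a: "a \<in> S" using assms by blast
  have "(+) (- a) ` S \<subseteq> dirspan S" using a by (auto intro: diff_in_dirspan)
  moreover have "dirspan S \<subseteq> span ((+) (- a) ` S)"
  proof (rule dirspan_subset)
    fix x y assume "x \<in> S" "y \<in> S"
    then have "- a + x \<in> span ((+) (- a) ` S)" "- a + y \<in> span ((+) (- a) ` S)"
      by (auto intro: span_base)
    then have "(- a + x) - (- a + y) \<in> span ((+) (- a) ` S)" by (rule span_diff)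
    then show "x - y \<in> span ((+) (- a) ` S)" by simp
  qed simp
  ultimately have "dim (dirspan S) = dim ((+) (- a) ` S)"
    by (metis dim_span dim_subset order_antisym)
  then show ?thesis using aff_dim_eq_dim[of a S] a by (simp add: hull_inc)
qed

text \<open>The translate \<open>x + U\<close> as a set, so that the number of translates met by
  \<open>A\<close> is the cardinality of an image.\<close>

definition coset :: "'a::euclidean_space set \<Rightarrow> 'a \<Rightarrow> 'a set" where
  "coset U x = {y. y - x \<in> U}"

lemma coset_eq_iff:
  assumes "subspace U"
  shows "coset U x = coset U y \<longleftrightarrow> x - y \<in> U"
proof
  assume "coset U x = coset U y"
  moreover have "x \<in> coset U x" using assms by (simp add: coset_def subspace_0)
  ultimately show "x - y \<in> U" by (simp add: coset_def)
next
  assume xy: "x - y \<in> U"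
  have "z - x \<in> U \<longleftrightarrow> z - y \<in> U" for z
  proof
    assume "z - x \<in> U"
    then have "(z - x) + (x - y) \<in> U" using xy assms by (intro subspace_add)
    then show "z - y \<in> U" by simp
  next
    assume "z - y \<in> U"
    then have "(z - y) - (x - y) \<in> U" using xy by (rule subspace_diff[OF assms])
    then show "z - x \<in> U" by simp
  qed
  then show "coset U x = coset U y" by (simp add: coset_def)
qed

text \<open>A basis of \<open>U\<close> together with the differences between one coset
  representative and the others spans all directions of \<open>A\<close>.\<close>

lemma aff_dim_le_cosets:
  assumes "finite A" "A \<noteq> {}" "subspace U"
  shows "aff_dim A \<le> int (dim U) + int (card (coset U ` A)) - 1"
proof -
  define r where "r = inv_into A (coset U)"
  define R where "R = r ` coset U ` A"
  have r: "r (coset U a) \<in> A" "a - r (coset U a) \<in> U" if "a \<in> A" for a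
  proof -
    have "coset U a \<in> coset U ` A" using that by blast
    then show "r (coset U a) \<in> A" unfolding r_def by (rule inv_into_into)
    have "coset U a = coset U (r (coset U a))" unfolding r_def
      using that by (metis f_inv_into_f imageI)
    then show "a - r (coset U a) \<in> U" using coset_eq_iff assms by blast
  qed
  obtain a0 where a0: "a0 \<in> A" using assms by blast
  define r0 where "r0 = r (coset U a0)"
  have r0: "r0 \<in> R" "r0 \<in> A" using a0 r unfolding r0_def R_def by auto
  obtain W where W: "W \<subseteq> U" "independent W" "U \<subseteq> span W" "card W = dim U"
    using basis_exists by blast
  define Y where "Y = W \<union> (\<lambda>x. x - r0) ` (R - {r0})"
  have finR: "finite R" using assms by (simp add: R_def)
  have finY: "finite Y" using finR independent_imp_finite[OF W(2)] by (simp add: Y_def)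
  have cR: "card R \<le> card (coset U ` A)" unfolding R_def using assms by (intro card_image_le) auto
  have "card Y \<le> card W + card ((\<lambda>x. x - r0) ` (R - {r0}))" unfolding Y_def by (rule card_Un_le)
  also have "\<dots> \<le> dim U + card (R - {r0})" using W finR by (simp add: card_image_le)
  also have "card (R - {r0}) = card R - 1" using r0 finR by simp
  finally have cY: "card Y \<le> dim U + (card R - 1)" .
  have "dirspan A \<subseteq> span Y"
  proof (rule dirspan_subset)
    have sp: "a - r0 \<in> span Y" if a: "a \<in> A" for a
    proof -
      have "U \<subseteq> span Y" using W(3) span_mono[of W Y] by (auto simp: Y_def)
      then have 1: "a - r (coset U a) \<in> span Y" using r(2)[OF a] by blast
      have 2: "r (coset U a) - r0 \<in> span Y"
      proof (cases "r (coset U a) = r0")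
        case False
        then have "r (coset U a) - r0 \<in> Y" using a by (auto simp: Y_def R_def)
        then show ?thesis by (rule span_base)
      qed (simp add: span_zero)
      show ?thesis using span_add[OF 1 2] by simp
    qed
    fix x y assume "x \<in> A" "y \<in> A"
    then show "x - y \<in> span Y" using span_diff[OF sp sp, of x y] by simp
  qed simp
  then have "dim (dirspan A) \<le> card Y" using finY by (metis dim_le_card)
  moreover have "card R \<ge> 1" using r0 finR by (metis One_nat_def Suc_leI card_gt_0_iff empty_iff)
  ultimately have "int (dim (dirspan A)) \<le> int (dim U) + int (card (coset U ` A)) - 1"
    using cY cR by linarith
  then show ?thesis using dim_dirspan assms(2) by metis
qed

lemma card_eq_sum_fibres:
  "finite A \<Longrightarrow> card A = (\<Sum>c\<in>f ` A. card {a \<in> A. f a = c})"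
  unfolding card_eq_sum by (rule sum.image_gen)

text \<open>\<open>B\<close> lies in a single coset of \<open>U\<close>, so adding it moves distinct
  cosets to distinct cosets and the partial sumsets are disjoint.\<close>

lemma card_plus_ge_fibres:
  assumes "finite A" "finite B" "subspace U" "dirspan B \<subseteq> U"
  shows "(\<Sum>c\<in>coset U ` A. card ({a \<in> A. coset U a = c} + B)) \<le> card (A + B)"
proof -
  have "(\<Sum>c\<in>coset U ` A. card ({a \<in> A. coset U a = c} + B))
      = card (\<Union>c\<in>coset U ` A. {a \<in> A. coset U a = c} + B)"
  proof (rule card_UN_disjoint[symmetric])
    show "\<forall>c\<in>coset U ` A. \<forall>c'\<in>coset U ` A. c \<noteq> c' \<longrightarrow>
        ({a \<in> A. coset U a = c} + B) \<inter> ({a \<in> A. coset U a = c'} + B) = {}"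
    proof (intro ballI impI equals0I)
      fix c c' x assume "c \<noteq> c'" and x: "x \<in> ({a \<in> A. coset U a = c} + B) \<inter> ({a \<in> A. coset U a = c'} + B)"
      obtain a b where ab: "coset U a = c" "b \<in> B" "x = a + b"
        using x by (auto elim: set_plus_elim)
      obtain a' b' where ab': "coset U a' = c'" "b' \<in> B" "x = a' + b'"
        using x by (auto elim: set_plus_elim)
      have "a - a' = b' - b" using ab(3) ab'(3) by (simp add: algebra_simps)
      then have "a - a' \<in> U" using assms(4) diff_in_dirspan[OF ab'(2) ab(2)] by auto
      then show False using coset_eq_iff[OF assms(3)] ab ab' \<open>c \<noteq> c'\<close> by blast
    qed
  qed (use assms in \<open>auto intro!: finite_set_plus\<close>)
  also have "\<dots> \<le> card (A + B)"
    using assms by (intro card_mono finite_set_plus UN_least set_plus_mono2) auto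
  finally show ?thesis .
qed

text \<open>On the first sumset \<open>u\<close> takes the least value possible on
  \<open>A + B\<close>; on the second it is strictly larger, because the summand from
  \<open>B\<close> is not minimal.\<close>

lemma card_plus_ge_minface:
  assumes "finite A" "finite B"
  shows "card (minface u A + minface u B) + card (A + (B - minface u B)) \<le> card (A + B)"
proof -
  have "(minface u A + minface u B) \<inter> (A + (B - minface u B)) = {}"
  proof (rule equals0I)
    fix x assume x: "x \<in> (minface u A + minface u B) \<inter> (A + (B - minface u B))"
    obtain a b where ab: "a \<in> minface u A" "b \<in> minface u B" "x = a + b"
      using x by (auto elim: set_plus_elim)
    obtain a' b' where ab': "a' \<in> A" "b' \<in> B" "b' \<notin> minface u B" "x = a' + b'"
      using x by (auto elim: set_plus_elim)
    have "u \<bullet> a \<le> u \<bullet> a'" using ab ab' by (simp add: minface_def)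
    moreover have "u \<bullet> b < u \<bullet> b'" using minface_less ab ab' by blast
    moreover have "u \<bullet> a + u \<bullet> b = u \<bullet> a' + u \<bullet> b'" using ab ab' by (metis inner_add_right)
    ultimately show False by linarith
  qed
  moreover have "minface u A + minface u B \<union> (A + (B - minface u B)) \<subseteq> A + B"
    using minface_subset by (intro Un_least set_plus_mono2) auto
  ultimately show ?thesis
    using assms minface_subset[of u A] minface_subset[of u B]
    by (metis card_Un_disjoint card_mono finite_Diff finite_set_plus finite_subset)
qed

section \<open>Sumsets of sets of given dimension\<close>

lemma dirspan_minface_const:
  assumes "minface u S = S" "z \<in> dirspan S"
  shows "u \<bullet> z = 0"
proof -
  have "dirspan S \<subseteq> {z. u \<bullet> z = 0}"
  proof (rule dirspan_subset)
    show "subspace {z. u \<bullet> z = 0}" by (rule subspace_hyperplane)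
    show "x - y \<in> {z. u \<bullet> z = 0}" if "x \<in> S" "y \<in> S" for x y
      using minface_eq[of x u S y] assms(1) that by (simp add: inner_diff_right)
  qed
  then show ?thesis using assms(2) by blast
qed

lemma minface_eq_self:
  assumes "minface u B = B" "dirspan A \<subseteq> dirspan B"
  shows "minface u A = A"
proof -
  have "u \<bullet> x \<le> u \<bullet> y" if "x \<in> A" "y \<in> A" for x y
  proof -
    have "u \<bullet> (x - y) = 0"
      using dirspan_minface_const[OF assms(1)] assms(2) diff_in_dirspan[OF that] by blast
    then show ?thesis by (simp add: inner_diff_right)
  qed
  then show ?thesis by (auto simp: minface_def)
qed

lemma card_finite_pos: "finite S \<Longrightarrow> S \<noteq> {} \<Longrightarrow> int (card S) \<ge> 1"
  by (simp add: Suc_le_eq card_gt_0_iff)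

lemma aff_dim_plus_1_le_card: "finite S \<Longrightarrow> S \<noteq> {} \<Longrightarrow> aff_dim S + 1 \<le> int (card S)"
  using aff_dim_le_card[of S] by simp

lemma aff_dim_ge_1:
  assumes "card S \<ge> 2"
  shows "aff_dim S \<ge> 1"
proof -
  have "S \<noteq> {}" "\<not> (\<exists>a. S = {a})" using assms by auto
  then have "aff_dim S \<noteq> -1" "aff_dim S \<noteq> 0" by (auto simp: aff_dim_empty aff_dim_eq_0)
  then show ?thesis using aff_dim_geq[of S] by linarith
qed

lemma card_plus_sing: "card (A + {b :: 'a::ab_group_add}) = card A"
proof -
  have "A + {b} = (\<lambda>a. a + b) ` A" by (auto simp: set_plus_def)
  then show ?thesis by (simp add: card_image inj_on_def)
qed

text \<open>Strong induction. Fibring over the direction space of the lower-dimensional summand reduces to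
  the case of equal direction spaces. There, take the largest facet occurring in either summand and
  remove from the other summand the face on which the same functional is minimal.\<close>

lemma card_sumset_ge_dim:
  fixes A B :: "'a::euclidean_space set"
  assumes "finite A" "finite B" "B \<noteq> {}" "card B \<le> card A" "D = aff_dim A \<or> D = aff_dim B"
  shows "2 * int (card (A + B)) \<ge> 2 * int (card A) + (D + 1) * (int (card B) - 1)"
  using assms
proof (induction "card A + card B" arbitrary: A B D rule: less_induct)
  case less
  note fin = less.prems(1,2) and neB = less.prems(3) and le = less.prems(4)
  have neA: "A \<noteq> {}" using le neB fin by auto
  define a where "a = int (card A)"
  define b where "b = int (card B)"
  define dA where "dA = aff_dim A"
  define e where "e = aff_dim B"
  have ab: "b \<le> a" "1 \<le> b" using le card_finite_pos[OF fin(2) neB] by (auto simp: a_def b_def)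
  have dims: "dA + 1 \<le> a" "e + 1 \<le> b" "0 \<le> dA" "0 \<le> e"
    using aff_dim_plus_1_le_card[OF fin(1) neA] aff_dim_plus_1_le_card[OF fin(2) neB] neA neB aff_dim_geq[of A] aff_dim_geq[of B]
      aff_dim_empty[of A] aff_dim_empty[of B]
    by (auto simp: a_def b_def dA_def e_def)
  have IH: "2 * int (card (X + Y)) \<ge> 2 * int (card X) + (aff_dim X + 1) * (int (card Y) - 1) \<and>
      2 * int (card (X + Y)) \<ge> 2 * int (card X) + (aff_dim Y + 1) * (int (card Y) - 1)"
    if "finite X" "finite Y" "Y \<noteq> {}" "card Y \<le> card X" "card X + card Y < card A + card B" for X Y :: "'a set"
    using less.hyps[OF that(5) that(1-4)] by blast
  have IH': "2 * int (card (X + Y)) \<ge> 2 * int (card Y) + (aff_dim X + 1) * (int (card X) - 1) \<and>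
      2 * int (card (X + Y)) \<ge> 2 * int (card Y) + (aff_dim Y + 1) * (int (card X) - 1)"
    if "finite X" "finite Y" "X \<noteq> {}" "card X \<le> card Y" "card X + card Y < card A + card B" for X Y :: "'a set"
    using IH[of Y X] that by (simp add: add.commute)
  have D: "D = dA \<or> D = e" using less.prems(5) by (simp add: dA_def e_def)
  have "2 * int (card (A + B)) \<ge> 2 * a + (D + 1) * (b - 1)"
  proof (cases "b = 1")
    case True
    then obtain x where "B = {x}" using card_1_singletonE[of B] by (auto simp: b_def)
    then show ?thesis using True by (simp add: card_plus_sing a_def)
  next
    case False
    then have b2: "b \<ge> 2" using ab by linarith
    then have e1: "e \<ge> 1" using aff_dim_ge_1[of B] by (simp add: b_def e_def)
    define U where "U = dirspan B"
    have U: "subspace U" "dirspan B \<subseteq> U" by (auto simp: U_def subspace_dirspan)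
    have dimU: "int (dim U) = e" unfolding U_def e_def by (rule dim_dirspan[OF neB])
    define I where "I = coset U ` A"
    define F where "F = (\<lambda>c. {x \<in> A. coset U x = c})"
    define q where "q = int (card I)"
    have finI: "finite I" using fin by (simp add: I_def)
    have F: "finite (F c)" "F c \<subseteq> A" for c using fin by (auto simp: F_def)
    have Fne: "F c \<noteq> {}" if "c \<in> I" for c using that by (auto simp: F_def I_def)
    have q1: "q \<ge> 1" using card_finite_pos[OF finI] neA by (simp add: q_def I_def)
    have dAq: "dA \<le> e + q - 1"
      using aff_dim_le_cosets[OF fin(1) neA U(1)] by (simp add: dA_def dimU q_def I_def)
    show ?thesis
    proof (cases "q \<ge> 2")
      case True
      have suma: "(\<Sum>c\<in>I. int (card (F c))) = a"
        using card_eq_sum_fibres[OF fin(1), of "coset U"] by (simp add: a_def I_def F_def)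
      have Flt: "card (F c) < card A" if "c \<in> I" for c
      proof -
        have "F c \<noteq> A"
        proof
          assume "F c = A"
          then have "I \<subseteq> {c}" by (auto simp: F_def I_def)
          then have "card I \<le> card {c}" by (intro card_mono) auto
          then show False using True by (simp add: q_def)
        qed
        then show ?thesis using F(2)[of c] fin by (meson psubsetI psubset_card_mono)
      qed
      \<comment> \<open>The doubled gain of one fibre. A fibre with at least \<open>b\<close> points
        gains the full \<open>(e + 1) * (b - 1)\<close>; for a smaller one the roles of the summands
        are exchanged in the induction hypothesis. The target is \<open>(e + q) * (b - 1)\<close>,
        since both dimensions are at most \<open>e + q - 1\<close>.\<close>
      define g where "g = (\<lambda>c. 2 * int (card (F c + B)) - 2 * int (card (F c)))"
      have g_big: "g c \<ge> (e + 1) * (b - 1)" if "c \<in> I" "int (card (F c)) \<ge> b" for c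
        using IH[OF F(1)[of c] fin(2) neB] that Flt[of c] by (auto simp: g_def e_def b_def)
      have g_small: "g c \<ge> 2 * (b - 1) + (e - 1) * (int (card (F c)) - 1)" if "c \<in> I" "int (card (F c)) < b" for c
        using IH'[OF F(1)[of c] fin(2) Fne] that Flt[of c] by (auto simp: g_def e_def b_def algebra_simps)
      have g2: "g c \<ge> 2 * (b - 1)" if "c \<in> I" for c
      proof (cases "int (card (F c)) \<ge> b")
        case True
        have "2 * (b - 1) \<le> (e + 1) * (b - 1)" using e1 b2 by (intro mult_right_mono) auto
        then show ?thesis using g_big[OF that True] by (rule order_trans)
      next
        case False
        have "0 \<le> (e - 1) * (int (card (F c)) - 1)"
          using e1 card_finite_pos[OF F(1) Fne[OF that]] by (intro mult_nonneg_nonneg) auto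
        then show ?thesis using g_small[OF that] False by linarith
      qed
      have "(\<Sum>c\<in>I. card (F c + B)) \<le> card (A + B)"
        unfolding I_def F_def by (rule card_plus_ge_fibres[OF fin U])
      then have "int (\<Sum>c\<in>I. card (F c + B)) \<le> int (card (A + B))" by (simp only: of_nat_le_iff)
      then have "2 * int (card (A + B)) \<ge> (\<Sum>c\<in>I. g c) + 2 * a"
        by (simp add: g_def sum_subtractf suma flip: sum_distrib_left)
      moreover have "(\<Sum>c\<in>I. g c) \<ge> (e + q) * (b - 1)"
      proof (cases "\<exists>c0\<in>I. int (card (F c0)) \<ge> b")
        case True
        then obtain c0 where c0: "c0 \<in> I" "int (card (F c0)) \<ge> b" by blast
        have "(\<Sum>c\<in>I. g c) = g c0 + (\<Sum>c\<in>I - {c0}. g c)" using c0 finI by (simp add: sum.remove)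
        moreover have "(\<Sum>c\<in>I - {c0}. g c) \<ge> (\<Sum>c\<in>I - {c0}. 2 * (b - 1))" using g2 by (intro sum_mono) auto
        moreover have "(\<Sum>c\<in>I - {c0}. 2 * (b - 1)) = (q - 1) * (2 * (b - 1))"
          using c0 finI q1 by (simp add: q_def of_nat_diff)
        ultimately have "(\<Sum>c\<in>I. g c) \<ge> (e + 1) * (b - 1) + (q - 1) * (2 * (b - 1))"
          using g_big[OF c0] by linarith
        moreover have "(e + 1) * (b - 1) + (q - 1) * (2 * (b - 1)) = (e + q) * (b - 1) + (q - 1) * (b - 1)"
          by (simp add: algebra_simps)
        moreover have "(q - 1) * (b - 1) \<ge> 0" using q1 b2 by simp
        ultimately show ?thesis by linarith
      next
        case False
        then have "(\<Sum>c\<in>I. g c) \<ge> (\<Sum>c\<in>I. 2 * (b - 1) + (e - 1) * (int (card (F c)) - 1))"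
          using g_small by (intro sum_mono) auto
        moreover have "(\<Sum>c\<in>I. 2 * (b - 1) + (e - 1) * (int (card (F c)) - 1)) = q * (2 * (b - 1)) + (e - 1) * (a - q)"
          by (simp add: sum.distrib sum_subtractf suma q_def flip: sum_distrib_left)
        moreover have "(e - 1) * (a - q) \<ge> (e - 1) * (b - q)" using e1 ab by (intro mult_left_mono) auto
        moreover have "q * (2 * (b - 1)) + (e - 1) * (b - q) = (e + q) * (b - 1) + (q - 1) * (b - e)"
          by (simp add: algebra_simps)
        moreover have "(q - 1) * (b - e) \<ge> 0" using q1 dims by simp
        ultimately show ?thesis by linarith
      qed
      moreover have "(D + 1) * (b - 1) \<le> (e + q) * (b - 1)"
        using D dAq q1 b2 by (intro mult_right_mono) auto
      ultimately show ?thesis by linarith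
    next
      case False
      then have "card I = 1" using q1 by (simp add: q_def)
      then obtain c0 where "I = {c0}" using card_1_singletonE by blast
      then have "x - y \<in> U" if "x \<in> A" "y \<in> A" for x y
        using that coset_eq_iff[OF U(1)] unfolding I_def by (metis imageI singletonD)
      then have sub: "dirspan A \<subseteq> dirspan B" using dirspan_subset U(1) unfolding U_def by blast
      have dAe: "dA \<le> e"
        using dim_subset[OF sub] dim_dirspan[OF neA] dim_dirspan[OF neB] by (simp add: dA_def e_def)
      show ?thesis
      proof (cases "dA < e")
        case True
        \<comment> \<open>Now \<open>B\<close> has more directions than \<open>A\<close>, so it is
          \<open>B\<close> that splits, into \<open>p \<ge> 2\<close> fibres. Each sums with all of
          \<open>A\<close> and so contributes at least \<open>2 * a\<close>.\<close>
        define V where "V = dirspan A"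
        have V: "subspace V" "dirspan A \<subseteq> V" by (auto simp: V_def subspace_dirspan)
        define J where "J = coset V ` B"
        define F where "F = (\<lambda>c. {x \<in> B. coset V x = c})"
        define p where "p = int (card J)"
        have finJ: "finite J" using fin by (simp add: J_def)
        have F: "finite (F c)" "F c \<subseteq> B" for c using fin by (auto simp: F_def)
        have Fne: "F c \<noteq> {}" if "c \<in> J" for c using that by (auto simp: F_def J_def)
        have ep: "e \<le> dA + p - 1"
          using aff_dim_le_cosets[OF fin(2) neB V(1)] dim_dirspan[OF neA]
          by (simp add: dA_def e_def p_def J_def V_def)
        have sumb: "(\<Sum>c\<in>J. int (card (F c))) = b"
          using card_eq_sum_fibres[OF fin(2), of "coset V"] by (simp add: b_def J_def F_def)
        have Flt: "card (F c) < card B" if "c \<in> J" for c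
        proof -
          have "F c \<noteq> B"
          proof
            assume "F c = B"
            then have "J \<subseteq> {c}" by (auto simp: F_def J_def)
            then have "card J \<le> card {c}" by (intro card_mono) auto
            then show False using True ep by (simp add: p_def)
          qed
          then show ?thesis using F(2)[of c] fin by (meson psubsetI psubset_card_mono)
        qed
        have "(\<Sum>c\<in>J. card (F c + A)) \<le> card (B + A)"
          unfolding J_def F_def by (rule card_plus_ge_fibres[OF fin(2,1) V])
        then have "int (\<Sum>c\<in>J. card (F c + A)) \<le> int (card (A + B))"
          by (simp only: of_nat_le_iff add.commute)
        then have "2 * int (card (A + B)) \<ge> (\<Sum>c\<in>J. 2 * int (card (A + F c)))"
          by (simp add: add.commute flip: sum_distrib_left)
        moreover have "(\<Sum>c\<in>J. 2 * int (card (A + F c))) \<ge> (\<Sum>c\<in>J. 2 * a + (dA + 1) * (int (card (F c)) - 1))"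
        proof (rule sum_mono)
          fix c assume c: "c \<in> J"
          then show "2 * a + (dA + 1) * (int (card (F c)) - 1) \<le> 2 * int (card (A + F c))"
            using IH[OF fin(1) F(1) Fne[OF c]] Flt[OF c] le by (simp add: a_def dA_def)
        qed
        moreover have "(\<Sum>c\<in>J. 2 * a + (dA + 1) * (int (card (F c)) - 1)) = p * (2 * a) + (dA + 1) * (b - p)"
          by (simp add: sum.distrib sum_subtractf sumb p_def flip: sum_distrib_left)
        moreover have "(D + 1) * (b - 1) \<le> (dA + p) * (b - 1)"
          using D dAe ep b2 by (intro mult_right_mono) auto
        moreover have "p * (2 * a) + (dA + 1) * (b - p) = 2 * a + (dA + p) * (b - 1) + (p - 1) * ((a - b) + (a - dA))"
          by (simp add: algebra_simps)
        moreover have "(p - 1) * ((a - b) + (a - dA)) \<ge> 0"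
          using ep True ab dims by (intro mult_nonneg_nonneg) auto
        ultimately show ?thesis by linarith
      next
        case False
        then have De: "D = e" "dA = e" using D dAe by auto
        then have "dirspan A = dirspan B"
          using sub dim_dirspan[OF neA] dim_dirspan[OF neB]
          by (intro subspace_dim_equal) (auto simp: subspace_dirspan dA_def e_def)
        then have sub': "dirspan B \<subseteq> dirspan A" by simp
        define Fac where "Fac = {minface u A | u. aff_dim (minface u A) = e - 1} \<union> {minface u B | u. aff_dim (minface u B) = e - 1}"
        have "Fac \<subseteq> Pow A \<union> Pow B" using minface_subset by (fastforce simp: Fac_def)
        then have finFac: "finite Fac" using fin finite_subset by auto
        obtain u0 where "aff_dim (minface u0 A) = aff_dim A - 1"
          using ex_facet[OF fin(1)] De e1 by (auto simp: dA_def)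
        then have "minface u0 A \<in> Fac" using De by (auto simp: Fac_def dA_def)
        then have "Fac \<noteq> {}" by blast
        then obtain Q where Q: "Q \<in> Fac" "\<And>Q'. Q' \<in> Fac \<Longrightarrow> card Q' \<le> card Q"
          using finFac obtains_MAX[of Fac card] by (metis Max_ge finite_imageI imageI)
        have Fac_A: "card (minface u A) \<le> card Q" if ne: "minface u A \<noteq> A" for u
        proof -
          obtain u' where u': "minface u A \<subseteq> minface u' A" "aff_dim (minface u' A) = aff_dim A - 1"
            using minface_subset_facet[OF fin(1) ne] by blast
          then have "minface u' A \<in> Fac" using De by (auto simp: Fac_def dA_def)
          moreover have "card (minface u A) \<le> card (minface u' A)"
            using u' fin minface_subset by (meson card_mono finite_subset)
          ultimately show ?thesis using Q(2) by force
        qed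
        have Fac_B: "card (minface u B) \<le> card Q" if ne: "minface u B \<noteq> B" for u
        proof -
          obtain u' where u': "minface u B \<subseteq> minface u' B" "aff_dim (minface u' B) = aff_dim B - 1"
            using minface_subset_facet[OF fin(2) ne] by blast
          then have "minface u' B \<in> Fac" by (auto simp: Fac_def e_def)
          moreover have "card (minface u B) \<le> card (minface u' B)"
            using u' fin minface_subset by (meson card_mono finite_subset)
          ultimately show ?thesis using Q(2) by force
        qed
        obtain u where u: "Q = minface u A \<or> Q = minface u B" and dQ: "aff_dim Q = e - 1"
          using Q(1) by (auto simp: Fac_def)
        define A0 where "A0 = minface u A"
        define B0 where "B0 = minface u B"
        have sA0: "A0 \<subseteq> A" and sB0: "B0 \<subseteq> B" by (auto simp: A0_def B0_def minface_subset)
        have fin0: "finite A0" "finite B0" using fin sA0 sB0 finite_subset by auto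
        have ne0: "A0 \<noteq> {}" "B0 \<noteq> {}" unfolding A0_def B0_def using minface_nonempty fin neA neB by blast+
        have neAA: "A0 \<noteq> A" and neBB: "B0 \<noteq> B"
        proof -
          have "\<not> (A0 = A \<and> B0 = B)"
            using dQ u De by (auto simp: A0_def B0_def dA_def e_def)
          moreover have "A0 = A \<longleftrightarrow> B0 = B"
            using minface_eq_self sub sub' unfolding A0_def B0_def by blast
          ultimately show "A0 \<noteq> A" "B0 \<noteq> B" by auto
        qed
        define z where "z = int (card A0)"
        define y where "y = int (card B0)"
        have zy: "z \<ge> 1" "y \<ge> 1" using card_finite_pos fin0 ne0 by (auto simp: z_def y_def)
        have lt: "card A0 < card A" "card B0 < card B"
          using sA0 sB0 neAA neBB fin by (meson psubsetI psubset_card_mono)+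
        have cA: "int (card (A - A0)) = a - z" and cB: "int (card (B - B0)) = b - y"
          using sA0 sB0 fin0 fin lt by (auto simp: card_Diff_subset of_nat_diff a_def b_def z_def y_def)
        show ?thesis
        proof (cases "Q = A0")
          case True
          have yz: "y \<le> z" using Fac_B[of u] neBB True by (simp add: y_def z_def B0_def)
          have ez: "e \<le> z" using aff_dim_plus_1_le_card[OF fin0(1) ne0(1)] dQ True by (simp add: z_def)
          have 1: "2 * int (card (A0 + B0)) \<ge> 2 * z + e * (y - 1)"
            using IH[OF fin0 ne0(2)] yz lt dQ True by (simp add: y_def z_def)
          have 2: "2 * int (card (A + (B - B0))) \<ge> 2 * a + (e + 1) * ((b - y) - 1)"
            using IH[OF fin(1), of "B - B0"] fin sB0 neBB lt le cB zy De
            by (auto simp: a_def b_def y_def dA_def)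
          have 3: "int (card (A0 + B0)) + int (card (A + (B - B0))) \<le> int (card (A + B))"
            using card_plus_ge_minface[OF fin, of u] by (simp add: A0_def B0_def flip: of_nat_add)
          \<comment> \<open>The facet only gains \<open>e\<close> per point of \<open>B0\<close>
            instead of \<open>e + 1\<close>, and one constant term \<open>e\<close> is lost by
            splitting \<open>B\<close>. The surplus \<open>2 * z\<close> pays for both, as
            \<open>z\<close> bounds \<open>y\<close> by maximality and \<open>e\<close> by
            dimension.\<close>
          have "2 * z + e * (y - 1) + (2 * a + (e + 1) * ((b - y) - 1))
              = 2 * a + (e + 1) * (b - 1) + ((z - y) + (z - e))" by (simp add: algebra_simps)
          then show ?thesis unfolding De(1) using 1 2 3 yz ez by linarith
        next
          case False
          then have QB: "Q = B0" using u by (auto simp: A0_def B0_def)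
          have zy': "z \<le> y" using Fac_A[of u] neAA QB by (simp add: y_def z_def A0_def)
          have ey: "e \<le> y" using aff_dim_plus_1_le_card[OF fin0(2) ne0(2)] dQ QB by (simp add: y_def)
          have 1: "2 * int (card (A0 + B0)) \<ge> 2 * y + e * (z - 1)"
            using IH'[OF fin0 ne0(1)] zy' lt dQ QB by (simp add: y_def z_def)
          have 3: "int (card (A0 + B0)) + int (card ((A - A0) + B)) \<le> int (card (A + B))"
            using card_plus_ge_minface[OF fin(2,1), of u] by (simp add: A0_def B0_def add.commute flip: of_nat_add)
          \<comment> \<open>Removing \<open>A0\<close> may leave fewer points than \<open>B\<close>
            has; the induction hypothesis then applies with the summands exchanged, which still
            suffices since \<open>b \<le> a\<close>.\<close>
          show ?thesis
          proof (cases "a - z \<ge> b")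
            case True
            have 2: "2 * int (card ((A - A0) + B)) \<ge> 2 * (a - z) + (e + 1) * (b - 1)"
              using IH[of "A - A0" B] fin neB True cA zy by (auto simp: b_def e_def z_def a_def)
            define X where "X = e * (z - 1)"
            define Y where "Y = (e + 1) * (b - 1)"
            have "X \<ge> 0" using e1 zy by (simp add: X_def)
            then show ?thesis using 1 2 3 zy'
              unfolding De(1) X_def[symmetric] Y_def[symmetric] by presburger
          next
            case False
            have 2: "2 * int (card ((A - A0) + B)) \<ge> 2 * b + (e + 1) * ((a - z) - 1)"
              using IH'[of "A - A0" B] fin neB False cA zy sA0 neAA by (auto simp: b_def e_def z_def a_def)
            have "2 * y + e * (z - 1) + (2 * b + (e + 1) * ((a - z) - 1))
              = 2 * a + (e + 1) * (b - 1) + ((e - 1) * (a - b) + ((y - z) + (y - e)))" by (simp add: algebra_simps)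
            moreover have "(e - 1) * (a - b) \<ge> 0" using e1 ab by simp
            ultimately show ?thesis unfolding De(1) using 1 2 3 zy' ey by linarith
          qed
        qed
      qed
    qed
  qed
  then show ?case by (simp add: a_def b_def)
qed

section \<open>Difference sets of sets of given dimension\<close>

lemma card_difference_set_commute: "card (difference_set A B) = card (difference_set B A)"
proof -
  have "difference_set B A = uminus ` difference_set A B"
    by (force simp: difference_set_def image_iff)
  then show ?thesis by (simp add: card_image)
qed

lemma affine_hull_minface:
  assumes "x \<in> minface u S" "y \<in> affine hull (minface u S)"
  shows "u \<bullet> y = u \<bullet> x"
proof -
  have "affine hull (minface u S) \<subseteq> {y. u \<bullet> y = u \<bullet> x}"
    using minface_eq assms(1) by (intro hull_minimal affine_hyperplane) auto
  then show ?thesis using assms(2) by blast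
qed

text \<open>The functional \<open>u\<close> separates three parts of the difference set: its extreme
  values are attained on \<open>F - G\<close> and on \<open>G - F\<close>, and differences within
  \<open>P - G\<close> lie strictly in between. Removing \<open>G\<close> lowers the dimension only
  if nothing but \<open>F\<close> remains, since any further point is off the hyperplane of
  \<open>F\<close>.\<close>

lemma facet_decomposition:
  fixes P :: "'a::euclidean_space set"
  assumes "finite P" "aff_dim P = k" "k \<ge> 1"
  obtains u F G where "F = minface u P" "G = minface (- u) P" "F \<inter> G = {}" "aff_dim F = k - 1"
    "card G \<le> card F" "G \<noteq> {}"
    "\<And>u'. aff_dim (minface u' P) = k - 1 \<Longrightarrow> card (minface u' P) \<le> card F"
    "P - G = F \<or> aff_dim (P - G) = k"
    "int (card (difference_set P P)) \<ge>
      int (card (difference_set (P - G) (P - G))) + 2 * int (card F) + k * (int (card G) - 1)"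
proof -
  have neP: "P \<noteq> {}" using assms by auto
  define Fac where "Fac = {minface u P | u. aff_dim (minface u P) = k - 1}"
  have "Fac \<subseteq> Pow P" using minface_subset by (fastforce simp: Fac_def)
  then have finFac: "finite Fac" using assms finite_subset by auto
  obtain u0 where "aff_dim (minface u0 P) = aff_dim P - 1" using ex_facet[of P] assms by blast
  then have "Fac \<noteq> {}" using assms by (auto simp: Fac_def)
  then obtain F where F: "F \<in> Fac" "\<And>Q. Q \<in> Fac \<Longrightarrow> card Q \<le> card F"
    using finFac obtains_MAX[of Fac card] by (metis Max_ge finite_imageI imageI)
  obtain u where u: "F = minface u P" and dF: "aff_dim F = k - 1" using F(1) by (auto simp: Fac_def)
  define G where "G = minface (- u) P"
  have sub: "F \<subseteq> P" "G \<subseteq> P" by (simp_all add: u G_def minface_subset)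
  have finFG: "finite F" "finite G" using sub assms finite_subset by auto
  have ne: "F \<noteq> {}" "G \<noteq> {}" unfolding u G_def using minface_nonempty assms neP by blast+
  obtain f g where f: "f \<in> F" and g: "g \<in> G" using ne by blast
  have uF: "u \<bullet> x = u \<bullet> f" if "x \<in> F" for x using minface_eq[of x u P f] that f u by simp
  have uG: "u \<bullet> x = u \<bullet> g" if "x \<in> G" for x using minface_eq[of x "- u" P g] that g G_def by simp
  have ge: "u \<bullet> f \<le> u \<bullet> x" if "x \<in> P" for x using f that by (auto simp: u minface_def)
  have le: "u \<bullet> x \<le> u \<bullet> g" if "x \<in> P" for x using g that by (auto simp: G_def minface_def)
  have ltG: "u \<bullet> x < u \<bullet> g" if "x \<in> P" "x \<notin> G" for x
    using minface_less[of g "- u" P x] that g by (simp add: G_def)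
  have fg: "u \<bullet> f < u \<bullet> g"
  proof (rule ccontr)
    assume "\<not> ?thesis"
    then have "u \<bullet> f = u \<bullet> g" using le f sub by force
    then have "F = P" using ge le by (force simp: u minface_def)
    then show False using dF assms by simp
  qed
  have disj: "F \<inter> G = {}" using uF uG fg by force
  have max: "card (minface u' P) \<le> card F" if "aff_dim (minface u' P) = k - 1" for u'
    using F(2) that by (auto simp: Fac_def)
  have "G \<noteq> P" using disj ne sub by blast
  then obtain u' where u': "G \<subseteq> minface u' P" "aff_dim (minface u' P) = aff_dim P - 1"
    using minface_subset_facet[OF assms(1), of "- u"] unfolding G_def by blast
  have "card G \<le> card (minface u' P)"
    using u'(1) assms(1) minface_subset by (meson card_mono finite_subset)
  also have "\<dots> \<le> card F" using max u'(2) assms by blast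
  finally have GF: "card G \<le> card F" .
  have dP': "P - G = F \<or> aff_dim (P - G) = k"
  proof (cases "P - G = F")
    case False
    have FP': "F \<subseteq> P - G" using sub disj by blast
    then obtain y where y: "y \<in> P - G" "y \<notin> F" using False by blast
    have "y \<notin> affine hull F"
    proof
      assume "y \<in> affine hull F"
      then have "u \<bullet> y = u \<bullet> f" using affine_hull_minface f u by blast
      then show False using minface_less[of f u P y] y f u by auto
    qed
    then have "aff_dim (insert y F) = k" using dF by (simp add: aff_dim_insert)
    moreover have "aff_dim (insert y F) \<le> aff_dim (P - G)" using y FP' by (intro aff_dim_subset) auto
    moreover have "aff_dim (P - G) \<le> aff_dim P" by (intro aff_dim_subset) auto
    ultimately show ?thesis using assms by simp
  qed simp
  have "difference_set F G = F + uminus ` G" by (rule difference_set_eq_plus)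
  moreover have "card (uminus ` G) = card G" by (rule card_image) simp
  ultimately have FG: "2 * int (card (difference_set F G)) \<ge> 2 * int (card F) + k * (int (card G) - 1)"
    using card_sumset_ge_dim[of F "uminus ` G" "k - 1"] finFG ne GF dF by simp
  define D0 where "D0 = difference_set (P - G) (P - G)"
  have fin: "finite D0" "finite (difference_set F G)" "finite (difference_set G F)"
    using assms finFG by (auto simp: D0_def)
  have "D0 \<inter> difference_set F G = {}" "D0 \<inter> difference_set G F = {}" "difference_set F G \<inter> difference_set G F = {}"
  proof -
    have 0: "u \<bullet> f - u \<bullet> g < u \<bullet> x \<and> u \<bullet> x < u \<bullet> g - u \<bullet> f" if xD: "x \<in> D0" for x
    proof -
      obtain p q where pq: "p \<in> P" "p \<notin> G" "q \<in> P" "q \<notin> G" "x = p - q"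
        using xD by (auto simp: D0_def difference_set_def)
      show ?thesis using ltG[OF pq(1,2)] ltG[OF pq(3,4)] ge[OF pq(1)] ge[OF pq(3)]
        by (simp add: pq(5) inner_diff_right)
    qed
    have 1: "u \<bullet> x = u \<bullet> f - u \<bullet> g" if "x \<in> difference_set F G" for x
      using that uF uG by (auto simp: difference_set_def inner_diff_right)
    have 2: "u \<bullet> x = u \<bullet> g - u \<bullet> f" if "x \<in> difference_set G F" for x
      using that uF uG by (auto simp: difference_set_def inner_diff_right)
    show "D0 \<inter> difference_set F G = {}" using 0 1 by force
    show "D0 \<inter> difference_set G F = {}" using 0 2 by force
    show "difference_set F G \<inter> difference_set G F = {}"
    proof (rule equals0I)
      fix x assume "x \<in> difference_set F G \<inter> difference_set G F"
      then show False using 1[of x] 2[of x] fg by auto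
    qed
  qed
  then have "card (D0 \<union> difference_set F G \<union> difference_set G F)
      = card D0 + card (difference_set F G) + card (difference_set G F)"
    using fin by (simp add: card_Un_disjoint Int_Un_distrib2)
  moreover have "D0 \<union> difference_set F G \<union> difference_set G F \<subseteq> difference_set P P"
    using sub by (auto simp: D0_def difference_set_def)
  ultimately have "card D0 + 2 * card (difference_set F G) \<le> card (difference_set P P)"
    using card_mono[OF finite_difference_set[OF assms(1,1)]] card_difference_set_commute[of G F]
    by (metis add.assoc mult_2)
  then have fin_le: "int (card (difference_set P P)) \<ge> int (card D0) + 2 * int (card F) + k * (int (card G) - 1)"
    using FG by linarith
  show ?thesis
  proof (rule that)
    show "F = minface u P" by (fact u)
    show "G = minface (- u) P" by (fact G_def)
    show "F \<inter> G = {}" by (fact disj)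
    show "aff_dim F = k - 1" by (fact dF)
    show "card G \<le> card F" by (fact GF)
    show "G \<noteq> {}" by (fact ne(2))
    show "P - G = F \<or> aff_dim (P - G) = k" by (fact dP')
    show "int (card (difference_set P P)) \<ge>
      int (card (difference_set (P - G) (P - G))) + 2 * int (card F) + k * (int (card G) - 1)"
      using fin_le by (simp only: D0_def)
  qed (rule max)
qed

lemma card_Diff_minface:
  assumes "finite P" "F = minface u P" "G = minface (- u) P"
  shows "int (card (P - G)) = int (card P) - int (card G)"
proof -
  have "G \<subseteq> P" by (simp add: assms minface_subset)
  then show ?thesis using assms(1) by (simp add: card_Diff_subset card_mono finite_subset of_nat_diff)
qed

text \<open>Both bounds are carried through one induction. The second fails for a single point,
  hence its restriction to \<open>k \<ge> 1\<close>; when a removal drops the dimension, only the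
  first bound is applied to the remaining facet.\<close>

lemma card_difference_set_lower:
  fixes P :: "'a::euclidean_space set"
  assumes "finite P" "P \<noteq> {}" "aff_dim P = k"
  shows "int (card (difference_set P P)) \<ge> k * int (card P) + 1 \<and>
    (k \<ge> 1 \<longrightarrow> 2 * int (card (difference_set P P)) \<ge> (2 * k + 1) * int (card P) - 2 * k + 2)"
  using assms
proof (induction "card P" arbitrary: P k rule: less_induct)
  case less
  note fin = less.prems(1) and ne = less.prems(2) and k = less.prems(3)
  show ?case
  proof (cases "k \<ge> 1")
    case False
    then have "k = 0" using k ne aff_dim_geq[of P] aff_dim_empty[of P] by fastforce
    moreover have "difference_set P P \<noteq> {}" using ne difference_setI by blast
    then have "card (difference_set P P) \<noteq> 0" using fin by simp
    ultimately show ?thesis by simp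
  next
    case True
    obtain u F G where *: "F = minface u P" "G = minface (- u) P" "F \<inter> G = {}" "aff_dim F = k - 1"
      "card G \<le> card F" "G \<noteq> {}" "P - G = F \<or> aff_dim (P - G) = k"
      "int (card (difference_set P P)) \<ge>
        int (card (difference_set (P - G) (P - G))) + 2 * int (card F) + k * (int (card G) - 1)"
      by (rule facet_decomposition[OF fin k True]) blast
    have neF: "F \<noteq> {}" unfolding * using minface_nonempty fin ne by blast
    have finG: "finite G" "finite F" unfolding * using minface_subset fin by (meson finite_subset)+
    define n where "n = int (card P)"
    define w where "w = int (card F)"
    define x where "x = int (card G)"
    have x1: "x \<ge> 1" using card_finite_pos finG(1) *(6) by (auto simp: x_def)
    have xw: "x \<le> w" using *(5) by (simp add: x_def w_def)
    have kw: "k \<le> w" using aff_dim_plus_1_le_card[OF finG(2) neF] *(4) by (simp add: w_def)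
    have c: "int (card (P - G)) = n - x" using card_Diff_minface[OF fin *(1,2)] by (simp add: n_def x_def)
    then have lt: "card (P - G) < card P" using x1 by (simp add: n_def)
    have neP': "P - G \<noteq> {}" using neF *(1,3) minface_subset by blast
    have finP': "finite (P - G)" using fin by simp
    define d where "d = int (card (difference_set (P - G) (P - G)))"
    have main: "int (card (difference_set P P)) \<ge> d + 2 * w + k * (x - 1)"
      using *(8) by (simp add: d_def w_def x_def)
    show ?thesis
    proof (cases "P - G = F")
      case True
      have "d \<ge> (k - 1) * (n - x) + 1"
        using less.hyps[OF lt finP' neP', of "k - 1"] True *(4) c by (simp add: d_def)
      moreover have nx: "n - x = w" using c True by (simp add: w_def)
      moreover have "(k - 1) * (n - x) + 1 + 2 * w + k * (x - 1) = k * n + 1 + (w - k) + (w - (n - x))"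
        by (simp add: algebra_simps)
      \<comment> \<open>In the two-layer case \<open>n = w + x \<le> 2 * w\<close>, so the excess
        \<open>1 + w - k\<close> already gives the second bound.\<close>
      ultimately have 1: "int (card (difference_set P P)) \<ge> k * n + 1 + (w - k)" using main by linarith
      define Y where "Y = k * n"
      have Y: "(2 * k + 1) * n = 2 * Y + n" by (simp add: Y_def algebra_simps)
      have 2: "2 * int (card (difference_set P P)) \<ge> (2 * k + 1) * n - 2 * k + 2"
        using 1 nx xw unfolding Y Y_def[symmetric] by linarith
      show ?thesis using 1 2 kw by (simp add: n_def)
    next
      case False
      then have dP': "aff_dim (P - G) = k" using *(7) by blast
      have IH: "d \<ge> k * (n - x) + 1" "2 * d \<ge> (2 * k + 1) * (n - x) - 2 * k + 2"
        using less.hyps[OF lt finP' neP' dP'] True c by (simp_all add: d_def)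
      have "k * (n - x) + 1 + 2 * w + k * (x - 1) = k * n + 1 + w + (w - k)" by (simp add: algebra_simps)
      then have 1: "int (card (difference_set P P)) \<ge> k * n + 1" using main IH(1) kw xw x1 by linarith
      define X where "X = k * (x - 1)"
      define Y where "Y = (2 * k + 1) * (n - x)"
      define Z where "Z = (2 * k + 1) * n"
      have XYZ: "Y + 2 * X = Z - 2 * k - x" by (simp add: X_def Y_def Z_def algebra_simps)
      have 2: "2 * int (card (difference_set P P)) \<ge> (2 * k + 1) * n - 2 * k + 2"
        using XYZ main IH(2) kw xw x1 unfolding X_def[symmetric] Y_def[symmetric] Z_def[symmetric] by linarith
      show ?thesis using 1 2 by (simp add: n_def)
    qed
  qed
qed

text \<open>An excess of only 1 leaves no slack in \<open>facet_decomposition\<close>: had the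
  remainder full dimension, the excess would be at least \<open>1 + w\<close>. So \<open>P\<close>
  has two layers, and the excess \<open>1 + w - k\<close> forces \<open>w = k\<close>. A facet
  containing \<open>G\<close> has at most \<open>k\<close> points and therefore equals
  \<open>G\<close>.\<close>

lemma difference_set_extremal:
  fixes P :: "'a::euclidean_space set"
  assumes "finite P" "aff_dim P = k" "k \<ge> 1" "int (card P) = 2 * k"
    and small: "int (card (difference_set P P)) < k * int (card P) + 2"
  obtains u F G where "P = F \<union> G" "F \<inter> G = {}" "F = minface u P" "G = minface (- u) P"
    "int (card F) = k" "int (card G) = k" "aff_dim F = k - 1" "aff_dim G = k - 1"
proof -
  have ne: "P \<noteq> {}" using assms by auto
  obtain u F G where *: "F = minface u P" "G = minface (- u) P" "F \<inter> G = {}" "aff_dim F = k - 1"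
      "card G \<le> card F" "G \<noteq> {}"
      "\<And>u'. aff_dim (minface u' P) = k - 1 \<Longrightarrow> card (minface u' P) \<le> card F"
      "P - G = F \<or> aff_dim (P - G) = k"
      "int (card (difference_set P P)) \<ge>
        int (card (difference_set (P - G) (P - G))) + 2 * int (card F) + k * (int (card G) - 1)"
    by (rule facet_decomposition[OF assms(1-3)]) blast
  have sub: "F \<subseteq> P" "G \<subseteq> P" by (auto simp: * minface_subset)
  have fin: "finite F" "finite G" using sub assms(1) finite_subset by auto
  have neF: "F \<noteq> {}" unfolding * using minface_nonempty assms(1) ne by blast
  define w where "w = int (card F)"
  define x where "x = int (card G)"
  have kw: "k \<le> w" using aff_dim_plus_1_le_card[OF fin(1) neF] *(4) by (simp add: w_def)
  have c: "int (card (P - G)) = 2 * k - x" using card_Diff_minface[OF assms(1) *(1,2)] assms(4) by (simp add: x_def)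
  have neP': "P - G \<noteq> {}" using neF sub *(3) by blast
  have main: "k * (2 * k) + 2 > int (card (difference_set (P - G) (P - G))) + 2 * w + k * (x - 1)"
    using *(9) small assms(4) by (simp add: w_def x_def)
  have PGF: "P - G = F"
  proof (rule ccontr)
    assume "P - G \<noteq> F"
    then have "aff_dim (P - G) = k" using *(8) by blast
    then have "int (card (difference_set (P - G) (P - G))) \<ge> k * (2 * k - x) + 1"
      using card_difference_set_lower[of "P - G" k] assms(1) neP' c by simp
    moreover have "k * (2 * k - x) + 1 + 2 * w + k * (x - 1) = k * (2 * k) + 1 + w + (w - k)" by (simp add: algebra_simps)
    ultimately show False using main kw assms(3) by linarith
  qed
  have "int (card (difference_set (P - G) (P - G))) \<ge> (k - 1) * (2 * k - x) + 1"
    using card_difference_set_lower[of "P - G" "k - 1"] fin(1) neP' c PGF *(4) by simp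
  moreover have xw: "2 * k - x = w" using c PGF by (simp add: w_def)
  moreover have "(k - 1) * (2 * k - x) + 1 + 2 * w + k * (x - 1) = k * (2 * k) + 1 + (w - k) + (w - (2 * k - x))"
    by (simp add: algebra_simps)
  ultimately have "w = k" using main kw by linarith
  then have cards: "int (card F) = k" "int (card G) = k" using xw by (auto simp: w_def x_def)
  have "G \<noteq> P" using sub neF *(3) by blast
  then obtain u' where u': "G \<subseteq> minface u' P" "aff_dim (minface u' P) = aff_dim P - 1"
    using minface_subset_facet[OF assms(1), of "- u"] unfolding * by blast
  have "card (minface u' P) \<le> card G" using *(7)[of u'] u'(2) assms(2) cards by simp
  then have "G = minface u' P"
    using u'(1) finite_subset[OF minface_subset assms(1)] by (intro card_seteq) auto
  then have "aff_dim G = k - 1" using u' assms by simp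
  then show ?thesis using that[of F G u] * cards PGF sub by blast
qed

text \<open>Excess 1 is enough up to \<open>2 * D - 1\<close> points and excess 2 at
  \<open>2 * D\<close> points, where the excluded case is the only one with less. For more points
  the linearly growing bound takes over.\<close>

lemma card_difference_set_gain:
  fixes P :: "'a::euclidean_space set"
  assumes "finite P" "P \<noteq> {}" "aff_dim P = k" "k \<le> D" "D \<ge> 3"
    and ne: "\<not> (k = D \<and> int (card P) = 2 * D \<and> int (card (difference_set P P)) < D * (2 * D) + 2)"
  shows "(2 * D - 1) * (int (card (difference_set P P)) - k * int (card P)) \<ge> int (card P)"
proof -
  define n where "n = int (card P)"
  define E where "E = int (card (difference_set P P)) - k * n"
  have n1: "n \<ge> 1" using card_finite_pos assms by (auto simp: n_def)
  have k0: "k \<ge> 0" "k + 1 \<le> n" using assms aff_dim_geq[of P] aff_dim_empty[of P] aff_dim_plus_1_le_card[of P]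
    by (fastforce simp: n_def)+
  have E1: "E \<ge> 1" and E2: "k \<ge> 1 \<Longrightarrow> 2 * E \<ge> n - 2 * k + 2"
    using card_difference_set_lower[OF assms(1-3)] by (auto simp: E_def n_def algebra_simps)
  have m: "(2 * D - 1) * E \<ge> (2 * D - 1) * t" if "E \<ge> t" for t
    using that assms(5) by (intro mult_left_mono) auto
  have "(2 * D - 1) * E \<ge> n"
  proof (cases "n \<le> 2 * D - 1")
    case True
    then show ?thesis using m[OF E1] by simp
  next
    case False
    show ?thesis
    proof (cases "k = 0")
      case True
      then obtain p where "P = {p}" using assms(3) aff_dim_eq_0 by blast
      then show ?thesis using False assms(5) by (simp add: n_def)
    next
      case k: False
      show ?thesis
      proof (cases "n = 2 * D")
        case True
        have "E \<ge> 2"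
        proof (cases "k = D")
          case True
          then show ?thesis using ne \<open>n = 2 * D\<close> by (auto simp: E_def n_def)
        next
          case False
          then show ?thesis using E2 k k0 assms(4) True by simp
        qed
        then show ?thesis using m[of 2] True assms(5) by simp
      next
        case n2: False
        then have j: "n \<ge> 2 * D + 1" using False by simp
        have "2 * E \<ge> n - 2 * D + 2" using E2 k k0 assms(4) by simp
        then have "(2 * D - 1) * (2 * E) \<ge> (2 * D - 1) * (n - 2 * D + 2)"
          using assms(5) by (intro mult_left_mono) auto
        \<comment> \<open>At \<open>n = 2 * D + 1\<close> only the term \<open>2 * D - 5\<close>
          remains; it is nonnegative because \<open>D \<ge> 3\<close>.\<close>
        moreover have "(2 * D - 1) * (n - 2 * D + 2) = 2 * n + ((2 * D - 3) * (n - 2 * D - 1) + (2 * D - 5))"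
          by (simp add: algebra_simps)
        moreover have "(2 * D - 3) * (n - 2 * D - 1) \<ge> 0" using j assms(5) by simp
        ultimately show ?thesis using assms(5) by linarith
      qed
    qed
  qed
  then show ?thesis by (simp add: E_def n_def)
qed

section \<open>Weighted difference sets\<close>

definition superlevel :: "'a set \<Rightarrow> ('a \<Rightarrow> nat) \<Rightarrow> nat \<Rightarrow> 'a set" where
  "superlevel P w t = {p \<in> P. t \<le> w p}"

lemma superlevel_mono: "s \<le> t \<Longrightarrow> superlevel P w t \<subseteq> superlevel P w s"
  by (auto simp: superlevel_def)

lemma superlevel_subset: "superlevel P w t \<subseteq> P"
  by (auto simp: superlevel_def)

text \<open>The greedy basis, chosen in order of decreasing weight.\<close>

lemma ex_greedy_affine_basis:
  fixes P :: "'a::euclidean_space set" and w :: "'a \<Rightarrow> nat"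
  assumes "finite P"
  obtains B where "B \<subseteq> P" "\<not> affine_dependent B"
    "\<And>t. superlevel P w t \<subseteq> affine hull (B \<inter> superlevel P w t)"
proof -
  define N where "N = Suc (Max (insert 0 (w ` P)))"
  have N: "w p < N" if "p \<in> P" for p
    using assms that by (auto simp: N_def less_Suc_eq_le)
  \<comment> \<open>Downward induction on the level: above all weights the level set is empty, and
    each basis is extended within the next larger level set.\<close>
  have "\<exists>B\<subseteq>superlevel P w (N - m). \<not> affine_dependent B \<and>
      (\<forall>t\<ge>N - m. superlevel P w t \<subseteq> affine hull (B \<inter> superlevel P w t))" for m
  proof (induction m)
    case 0
    have "superlevel P w t = {}" if "t \<ge> N" for t
      using N that by (force simp: superlevel_def)
    then show ?case by (intro exI[of _ "{}"]) auto
  next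
    case (Suc m)
    then obtain B where B: "B \<subseteq> superlevel P w (N - m)" "\<not> affine_dependent B"
      "\<And>t. t \<ge> N - m \<Longrightarrow> superlevel P w t \<subseteq> affine hull (B \<inter> superlevel P w t)" by blast
    have "B \<subseteq> superlevel P w (N - Suc m)"
      using B(1) superlevel_mono[of "N - Suc m" "N - m" P w] diff_le_mono2[of m "Suc m" N] by auto
    then obtain T where T: "\<not> affine_dependent T" "B \<subseteq> T" "T \<subseteq> superlevel P w (N - Suc m)"
      "affine hull T = affine hull (superlevel P w (N - Suc m))"
      using extend_to_affine_basis[OF B(2)] by metis
    have "superlevel P w t \<subseteq> affine hull (T \<inter> superlevel P w t)" if t: "t \<ge> N - Suc m" for t
    proof (cases "t \<ge> N - m")
      case True
      have "affine hull (B \<inter> superlevel P w t) \<subseteq> affine hull (T \<inter> superlevel P w t)"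
        using T(2) by (intro hull_mono) auto
      then show ?thesis using B(3)[OF True] by blast
    next
      case False
      then have "t = N - Suc m" using t by linarith
      then have "T \<inter> superlevel P w t = T" using T(3) by auto
      then show ?thesis using T(4) \<open>t = N - Suc m\<close> by (simp add: hull_subset)
    qed
    then show ?case using T by blast
  qed
  from this[of N] obtain B where B: "B \<subseteq> superlevel P w (N - N)" "\<not> affine_dependent B"
    "\<forall>t\<ge>N - N. superlevel P w t \<subseteq> affine hull (B \<inter> superlevel P w t)" by (elim exE conjE)
  show ?thesis
  proof (rule that[of B])
    show "B \<subseteq> P" using B(1) superlevel_subset by (rule subset_trans)
    show "superlevel P w t \<subseteq> affine hull (B \<inter> superlevel P w t)" for t
      using B(3) by simp
  qed (rule B(2))
qed

definition cross_differences :: "'a::euclidean_space set \<Rightarrow> 'a set \<Rightarrow> 'a set" where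
  "cross_differences Q C = difference_set Q C \<union> difference_set C Q"

lemma finite_cross_differences: "finite Q \<Longrightarrow> finite C \<Longrightarrow> finite (cross_differences Q C)"
  by (simp add: cross_differences_def)

text \<open>Any coincidence among these differences can be solved for a point
  \<open>b \<in> B - Q\<close> as a combination, with coefficients of sum 1, of points of
  \<open>Q\<close> and of other points of \<open>B\<close>. All of these lie in the affine hull of
  \<open>B - {b}\<close>, which contradicts independence. If \<open>b\<close> occurs twice, it is
  the midpoint of two points of \<open>Q\<close>.\<close>

lemma affine_independent_cross:
  fixes B Q :: "'a::euclidean_space set"
  assumes indep: "\<not> affine_dependent B" and Q: "Q \<subseteq> affine hull (B \<inter> Q)" and "finite Q" "finite B"
  shows "difference_set Q Q \<inter> cross_differences Q (B - Q) = {}"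
    and "card (cross_differences Q (B - Q)) = 2 * (card Q * card (B - Q))"
proof -
  have notin: "b \<notin> affine hull (B - {b})" if "b \<in> B" for b
    using indep that by (auto simp: affine_dependent_def)
  have Qin: "q \<in> affine hull (B - {b})" if "q \<in> Q" "b \<in> B - Q" for q b
  proof -
    have "affine hull (B \<inter> Q) \<subseteq> affine hull (B - {b})" using that by (intro hull_mono) auto
    then show ?thesis using Q that by blast
  qed
  have comb: "b \<noteq> u *\<^sub>R x + v *\<^sub>R y + z *\<^sub>R c"
    if "b \<in> B - Q" "x \<in> Q" "y \<in> Q" "c \<in> Q \<or> c \<in> B - {b}" "u + v + z = 1" for b x y c u v z
  proof -
    have "c \<in> affine hull (B - {b})" using that Qin hull_inc by metis
    then have "u *\<^sub>R x + v *\<^sub>R y + z *\<^sub>R c \<in> affine hull (B - {b})"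
      using that Qin by (intro mem_affine_3) auto
    then show ?thesis using notin that by blast
  qed
  have 1: "q - b \<noteq> q' - q''" if "q \<in> Q" "b \<in> B - Q" "q' \<in> Q" "q'' \<in> Q" for q b q' q''
  proof
    assume "q - b = q' - q''"
    then have "b = 1 *\<^sub>R q + (-1) *\<^sub>R q' + 1 *\<^sub>R q''" by (simp add: algebra_simps)
    then show False using comb[of b q q' q'' 1 "-1" 1] that by auto
  qed
  have 2: "b = b'" if "q - b = q' - b'" "q \<in> Q" "b \<in> B - Q" "q' \<in> Q" "b' \<in> B - Q" for q b q' b'
  proof (rule ccontr)
    assume "b \<noteq> b'"
    have "b = 1 *\<^sub>R q + (-1) *\<^sub>R q' + 1 *\<^sub>R b'" using that(1) by (simp add: algebra_simps)
    then show False using comb[of b q q' b' 1 "-1" 1] that \<open>b \<noteq> b'\<close> by auto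
  qed
  have 3: "q - b \<noteq> b' - q'" if "q \<in> Q" "b \<in> B - Q" "q' \<in> Q" "b' \<in> B - Q" for q b q' b'
  proof
    assume eq: "q - b = b' - q'"
    show False
    proof (cases "b = b'")
      case True
      then have "b + b = q + q'" using eq by (simp add: algebra_simps)
      then have "(1/2) *\<^sub>R (b + b) = (1/2) *\<^sub>R (q + q')" by simp
      then have "b = (1/2) *\<^sub>R q + (1/2) *\<^sub>R q' + 0 *\<^sub>R q'" by (simp add: scaleR_add_right flip: scaleR_add_left)
      then show False using comb[of b q q' q' "1/2" "1/2" 0] that by auto
    next
      case False
      have "b = 1 *\<^sub>R q + 1 *\<^sub>R q' + (-1) *\<^sub>R b'" using eq by (simp add: algebra_simps)
      then show False using comb[of b q q' b' 1 1 "-1"] that False by auto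
    qed
  qed
  show "difference_set Q Q \<inter> cross_differences Q (B - Q) = {}"
  proof (rule equals0I)
    fix x assume x: "x \<in> difference_set Q Q \<inter> cross_differences Q (B - Q)"
    then obtain q' q'' where q: "q' \<in> Q" "q'' \<in> Q" "x = q' - q''" by (auto simp: difference_set_def)
    consider q b where "q \<in> Q" "b \<in> B - Q" "x = q - b" | q b where "q \<in> Q" "b \<in> B - Q" "x = b - q"
      using x unfolding cross_differences_def difference_set_def by blast
    then show False
    proof cases
      case (1 q b)
      then show False using \<open>\<And>q b q' q''. q \<in> Q \<Longrightarrow> b \<in> B - Q \<Longrightarrow> q' \<in> Q \<Longrightarrow> q'' \<in> Q \<Longrightarrow> q - b \<noteq> q' - q''\<close> q by blast
    next
      case (2 q b)
      then have "q - b = q'' - q'" using q by (metis minus_diff_eq)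
      then show False using 1 2 q by blast
    qed
  qed
  have inj: "inj_on (\<lambda>(q, b). q - b) (Q \<times> (B - Q))"
  proof (rule inj_onI, clarify)
    fix q b q' b' assume *: "q \<in> Q" "b \<in> B" "b \<notin> Q" "q' \<in> Q" "b' \<in> B" "b' \<notin> Q" "q - b = q' - b'"
    then have "b = b'" using 2 by blast
    then show "q = q' \<and> b = b'" using * by simp
  qed
  have "difference_set Q (B - Q) = (\<lambda>(q, b). q - b) ` (Q \<times> (B - Q))"
    unfolding difference_set_def by force
  then have c1: "card (difference_set Q (B - Q)) = card Q * card (B - Q)"
    using card_image[OF inj] by (simp add: card_cartesian_product)
  have "difference_set Q (B - Q) \<inter> difference_set (B - Q) Q = {}"
    using 3 unfolding difference_set_def by blast
  then show "card (cross_differences Q (B - Q)) = 2 * (card Q * card (B - Q))"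
    unfolding cross_differences_def using assms c1 card_difference_set_commute[of "B - Q" Q]
    by (subst card_Un_disjoint) auto
qed

text \<open>Each difference is represented by the pair maximising first the smaller and then the larger
  weight: such a pair has both weights at least \<open>t\<close>, for every \<open>t\<close> for which some pair does.\<close>

lemma ex_lexicographic_representation:
  fixes P :: "'a::euclidean_space set" and w :: "'a \<Rightarrow> nat"
  assumes "finite P"
  obtains \<rho> where "\<And>x. x \<in> difference_set P P \<Longrightarrow> fst (\<rho> x) \<in> P \<and> snd (\<rho> x) \<in> P \<and> x = fst (\<rho> x) - snd (\<rho> x)"
    "\<And>p q. p \<in> P \<Longrightarrow> q \<in> P \<Longrightarrow> min (w p) (w q) \<le> min (w (fst (\<rho> (p - q)))) (w (snd (\<rho> (p - q))))"
    "\<And>p q. p \<in> P \<Longrightarrow> q \<in> P \<Longrightarrow> min (w p) (w q) = min (w (fst (\<rho> (p - q)))) (w (snd (\<rho> (p - q)))) \<Longrightarrow>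
      max (w p) (w q) \<le> max (w (fst (\<rho> (p - q)))) (w (snd (\<rho> (p - q))))"
proof -
  define N where "N = Suc (Max (insert 0 (w ` P)))"
  have N: "w p < N" if "p \<in> P" for p
    using assms that by (auto simp: N_def less_Suc_eq_le)
  \<comment> \<open>The lexicographic order written in base \<open>N\<close>; all weights are below
    \<open>N\<close>, so the larger weight never outweighs the smaller one.\<close>
  define \<Phi> where "\<Phi> = (\<lambda>r. min (w (fst r)) (w (snd r)) * N + max (w (fst r)) (w (snd r)))"
  have "\<forall>x\<in>difference_set P P. \<exists>r. r \<in> P \<times> P \<and> x = fst r - snd r \<and>
      (\<forall>p\<in>P. \<forall>q\<in>P. p - q = x \<longrightarrow> \<Phi> (p, q) \<le> \<Phi> r)"
  proof
    fix x assume x: "x \<in> difference_set P P"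
    define S where "S = {r \<in> P \<times> P. x = fst r - snd r}"
    have "finite S" "S \<noteq> {}" using assms x by (auto simp: S_def difference_set_def)
    then obtain r where "r \<in> S" "\<And>r'. r' \<in> S \<Longrightarrow> \<Phi> r' \<le> \<Phi> r"
      using obtains_MAX[of S \<Phi>] by (metis Max_ge finite_imageI imageI)
    then show "\<exists>r. r \<in> P \<times> P \<and> x = fst r - snd r \<and> (\<forall>p\<in>P. \<forall>q\<in>P. p - q = x \<longrightarrow> \<Phi> (p, q) \<le> \<Phi> r)"
      by (intro exI[of _ r]) (auto simp: S_def)
  qed
  then obtain \<rho> where \<rho>: "\<And>x. x \<in> difference_set P P \<Longrightarrow> \<rho> x \<in> P \<times> P \<and> x = fst (\<rho> x) - snd (\<rho> x) \<and>
      (\<forall>p\<in>P. \<forall>q\<in>P. p - q = x \<longrightarrow> \<Phi> (p, q) \<le> \<Phi> (\<rho> x))" by metis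
  show ?thesis
  proof (rule that[of \<rho>])
    show "fst (\<rho> x) \<in> P \<and> snd (\<rho> x) \<in> P \<and> x = fst (\<rho> x) - snd (\<rho> x)" if "x \<in> difference_set P P" for x
      using \<rho>[OF that] by (metis mem_Times_iff)
    fix p q assume pq: "p \<in> P" "q \<in> P"
    define r where "r = \<rho> (p - q)"
    have r: "fst r \<in> P" "snd r \<in> P" and le: "\<Phi> (p, q) \<le> \<Phi> r"
      using \<rho>[OF difference_setI[OF pq]] pq unfolding r_def by (metis mem_Times_iff)+
    show "min (w p) (w q) \<le> min (w (fst (\<rho> (p - q)))) (w (snd (\<rho> (p - q))))"
    proof (rule ccontr)
      assume "\<not> ?thesis"
      then have "Suc (min (w (fst r)) (w (snd r))) \<le> min (w p) (w q)" by (simp only: r_def not_le Suc_le_eq)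
      then have "Suc (min (w (fst r)) (w (snd r))) * N \<le> min (w p) (w q) * N" by (rule mult_le_mono1)
      moreover have "max (w (fst r)) (w (snd r)) < N" using r N by simp
      ultimately have "\<Phi> r < \<Phi> (p, q)" unfolding \<Phi>_def fst_conv snd_conv mult_Suc by linarith
      then show False using le by simp
    qed
    show "max (w p) (w q) \<le> max (w (fst (\<rho> (p - q)))) (w (snd (\<rho> (p - q))))"
      if "min (w p) (w q) = min (w (fst (\<rho> (p - q)))) (w (snd (\<rho> (p - q))))"
      using le that by (simp add: \<Phi>_def r_def)
  qed
qed

lemma sum_superlevel_card:
  fixes w :: "'a \<Rightarrow> nat"
  assumes "finite P" "\<And>p. p \<in> P \<Longrightarrow> w p \<le> N"
  shows "(\<Sum>p\<in>P. w p) = (\<Sum>t\<in>{1..N}. card (superlevel P w t))"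
proof -
  have w: "w p = (\<Sum>t\<in>{1..N}. if t \<le> w p then 1 else 0)" if "p \<in> P" for p
  proof -
    have "{1..N} \<inter> {t. t \<le> w p} = {1..w p}" using assms(2)[OF that] by auto
    then show ?thesis by (simp add: sum.If_cases)
  qed
  have "(\<Sum>p\<in>P. w p) = (\<Sum>p\<in>P. \<Sum>t\<in>{1..N}. if t \<le> w p then 1 else 0)"
    using w by (rule sum.cong[OF refl])
  also have "\<dots> = (\<Sum>t\<in>{1..N}. \<Sum>p\<in>P. if t \<le> w p then 1 else 0)" by (rule sum.swap)
  also have "\<dots> = (\<Sum>t\<in>{1..N}. card (superlevel P w t))"
    using assms(1) by (simp add: sum.If_cases superlevel_def Int_def)
  finally show ?thesis .
qed

text \<open>An integer form of \<open>\<Sum>(w(p\<^sub>x) + w(q\<^sub>x)) \<ge> (2D + 2/(2D - 1)) \<Sum>w\<close>, proved level by level. An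
  extremal level that is not the bottom one picks up two further differences, which makes up for its
  deficit.\<close>

lemma weighted_difference_set:
  fixes P :: "'a::euclidean_space set" and w :: "'a \<Rightarrow> nat"
  defines "P1 \<equiv> superlevel P w 1"
  assumes "finite P" "aff_dim P = D" "D \<ge> 3"
    and ne: "\<not> (aff_dim P1 = D \<and> int (card P1) = 2 * D \<and> int (card (difference_set P1 P1)) < D * (2 * D) + 2)"
  obtains X \<rho> where "finite X" "X \<subseteq> difference_set P P"
    "int (card X) \<le> int (card (difference_set P1 P1)) + 2 * (D + 1) * int (card P1)"
    "\<And>x. x \<in> X \<Longrightarrow> fst (\<rho> x) \<in> P \<and> snd (\<rho> x) \<in> P \<and> x = fst (\<rho> x) - snd (\<rho> x)"
    "(2 * D - 1) * (\<Sum>x\<in>X. int (w (fst (\<rho> x)) + w (snd (\<rho> x)))) \<ge> (4 * D * D - 2 * D + 2) * (\<Sum>p\<in>P. int (w p))"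
proof -
  note fin = assms(2) and dimP = assms(3) and D3 = assms(4)
  obtain B where B: "B \<subseteq> P" "\<not> affine_dependent B"
    "\<And>t. superlevel P w t \<subseteq> affine hull (B \<inter> superlevel P w t)"
    by (rule ex_greedy_affine_basis[OF fin, where w = w]) (rule that)
  obtain \<rho> where \<rho>: "\<And>x. x \<in> difference_set P P \<Longrightarrow> fst (\<rho> x) \<in> P \<and> snd (\<rho> x) \<in> P \<and> x = fst (\<rho> x) - snd (\<rho> x)"
    and \<rho>min: "\<And>p q. p \<in> P \<Longrightarrow> q \<in> P \<Longrightarrow> min (w p) (w q) \<le> min (w (fst (\<rho> (p - q)))) (w (snd (\<rho> (p - q))))"
    and \<rho>max: "\<And>p q. p \<in> P \<Longrightarrow> q \<in> P \<Longrightarrow> min (w p) (w q) = min (w (fst (\<rho> (p - q)))) (w (snd (\<rho> (p - q)))) \<Longrightarrow>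
      max (w p) (w q) \<le> max (w (fst (\<rho> (p - q)))) (w (snd (\<rho> (p - q))))"
    by (rule ex_lexicographic_representation[OF fin, where w = w]) (rule that)
  define L where "L = superlevel P w"
  have LP: "L t \<subseteq> P" for t by (simp add: L_def superlevel_subset)
  have finL: "finite (L t)" for t using LP fin finite_subset by blast
  have L1: "L 1 = P1" by (simp add: L_def P1_def)
  have L_anti: "L t \<subseteq> L s" if "s \<le> t" for s t using that superlevel_mono by (simp add: L_def)
  have finB: "finite B" using B(1) fin finite_subset by blast
  define C where "C = (\<lambda>t. B - L t)"
  have disj: "difference_set (L t) (L t) \<inter> cross_differences (L t) (C t) = {}"
    and cardC: "card (cross_differences (L t) (C t)) = 2 * (card (L t) * card (C t))" for t
    using affine_independent_cross[OF B(2) B(3) finite_subset[OF superlevel_subset fin] finB]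
    by (simp_all add: L_def C_def)
  have cC: "int (card (C t)) = D - aff_dim (L t)" for t
  proof -
    have "affine hull (B \<inter> L t) = affine hull (L t)"
    proof
      show "affine hull (B \<inter> L t) \<subseteq> affine hull (L t)" by (intro hull_mono) auto
      show "affine hull (L t) \<subseteq> affine hull (B \<inter> L t)"
        using B(3)[of t] unfolding L_def by (intro hull_minimal affine_affine_hull)
    qed
    moreover have "\<not> affine_dependent (B \<inter> L t)" using B(2) affine_independent_subset by blast
    ultimately have 1: "int (card (B \<inter> L t)) = aff_dim (L t) + 1" using aff_dim_unique by blast
    have "affine hull B = affine hull P"
    proof
      show "affine hull B \<subseteq> affine hull P" by (intro hull_mono B)
      have "superlevel P w 0 = P" by (simp add: superlevel_def)
      then have "P \<subseteq> affine hull (B \<inter> P)" using B(3)[of 0] by simp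
      also have "B \<inter> P = B" using B(1) by blast
      finally show "affine hull P \<subseteq> affine hull B" by (intro hull_minimal affine_affine_hull)
    qed
    then have 2: "int (card B) = D + 1" using aff_dim_unique[of B P] B(2) dimP by simp
    have "card B = card (B \<inter> L t) + card (C t)"
      unfolding C_def using finB by (metis card_Diff_subset_Int card_mono finite_Int inf_le1 le_add_diff_inverse)
    then show ?thesis using 1 2 by linarith
  qed
  \<comment> \<open>Only the bottom level and its cross differences enter. Points of weight 0 are
    thus used merely as basis points, which keeps the size of \<open>X\<close> under
    control.\<close>
  define X where "X = difference_set (L 1) (L 1) \<union> cross_differences (L 1) (C 1)"
  have finX: "finite X" unfolding X_def C_def using finL finB by (intro finite_UnI finite_cross_differences) auto
  have XP: "X \<subseteq> difference_set P P"
    using LP[of 1] B(1) by (auto simp: X_def C_def cross_differences_def difference_set_def)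
  have cX: "int (card X) \<le> int (card (difference_set P1 P1)) + 2 * (D + 1) * int (card P1)"
  proof -
    have "card X \<le> card (difference_set (L 1) (L 1)) + card (cross_differences (L 1) (C 1))"
      unfolding X_def by (rule card_Un_le)
    then have "int (card X) \<le> int (card (difference_set (L 1) (L 1))) + 2 * (int (card (L 1)) * int (card (C 1)))"
      unfolding cardC by (simp flip: of_nat_le_iff[where 'a = int])
    moreover have "int (card (L 1)) * int (card (C 1)) \<le> int (card (L 1)) * (D + 1)"
      using cC[of 1] aff_dim_geq[of "L 1"] by (intro mult_left_mono) auto
    ultimately show ?thesis unfolding L1 by (simp add: algebra_simps)
  qed
  \<comment> \<open>The number of members of the representing pair that are present at level
    \<open>t\<close>; summed over all levels it gives the weight of the pair.\<close>
  define c where "c = (\<lambda>x t. (if t \<le> w (fst (\<rho> x)) then 1 else 0) + (if t \<le> w (snd (\<rho> x)) then 1 else 0 :: nat))"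
  have c2: "c x t = 2" if x: "x \<in> difference_set (L t) (L t)" for x t
  proof -
    obtain p q where pq: "p \<in> P" "q \<in> P" "t \<le> w p" "t \<le> w q" "x = p - q"
      using x by (auto simp: difference_set_def L_def superlevel_def)
    have "t \<le> min (w p) (w q)" using pq(3,4) by simp
    also have "\<dots> \<le> min (w (fst (\<rho> x))) (w (snd (\<rho> x)))" unfolding pq(5) by (rule \<rho>min[OF pq(1,2)])
    finally have "t \<le> min (w (fst (\<rho> x))) (w (snd (\<rho> x)))" .
    then show ?thesis by (simp add: c_def)
  qed
  have mem_diff: "x \<in> difference_set (L s) (L s)" if "x \<in> difference_set P P" "s \<le> min (w (fst (\<rho> x))) (w (snd (\<rho> x)))" for x s
    using \<rho>[OF that(1)] that(2) difference_setI[of "fst (\<rho> x)" "L s" "snd (\<rho> x)" "L s"]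
    by (simp add: L_def superlevel_def)
  \<comment> \<open>If no pair for \<open>p - q\<close> lies in the level just above the smaller
    weight, the representing pair has that same smaller weight. Only then does its second criterion
    guarantee a larger weight of at least \<open>t\<close>.\<close>
  have c1: "c (p - q) t \<ge> 1"
    if pq: "p \<in> P" "q \<in> P" and t: "t \<le> max (w p) (w q)" 
      and notin: "p - q \<notin> difference_set (L (Suc (min (w p) (w q)))) (L (Suc (min (w p) (w q))))" for p q t
  proof -
    have "\<not> Suc (min (w p) (w q)) \<le> min (w (fst (\<rho> (p - q)))) (w (snd (\<rho> (p - q))))"
      using mem_diff[OF difference_setI[OF pq]] notin by blast
    then have "min (w p) (w q) = min (w (fst (\<rho> (p - q)))) (w (snd (\<rho> (p - q))))"
      using \<rho>min[OF pq] by linarith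
    then have "t \<le> max (w (fst (\<rho> (p - q)))) (w (snd (\<rho> (p - q))))" using \<rho>max[OF pq] t by linarith
    then show ?thesis by (auto simp: c_def max_def split: if_splits)
  qed
  have cross: "p - b \<notin> difference_set (L s) (L s)" "b - p \<notin> difference_set (L s) (L s)"
    if "p \<in> L s" "b \<in> C s" for p b s
    using disj[of s] that difference_setI[of p "L s" b "C s"] difference_setI[of b "C s" p "L s"]
    unfolding cross_differences_def by blast+
  have c1C: "c x t \<ge> 1" if x: "x \<in> cross_differences (L t) (C t)" for x t
  proof -
    obtain p b where pb: "p \<in> L t" "b \<in> C t" "x = p - b \<or> x = b - p"
      using x by (auto simp: cross_differences_def difference_set_def)
    have mem: "p \<in> P" "b \<in> P" "t \<le> w p" "w b < t"
      using pb(1,2) B(1) by (auto simp: L_def C_def superlevel_def not_le)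
    \<comment> \<open>The disjointness is needed not at level \<open>t\<close> but at
      \<open>Suc (w b)\<close>, the lowest level that excludes \<open>b\<close>; this is what
      \<open>c1\<close> asks for.\<close>
    have "p \<in> L (Suc (w b))" "b \<in> C (Suc (w b))"
      using pb(2) mem by (auto simp: L_def C_def superlevel_def)
    note nin = cross[OF this]
    have m: "min (w p) (w b) = w b" "min (w b) (w p) = w b" using mem by auto
    show ?thesis using pb(3)
    proof
      assume "x = p - b"
      then show ?thesis using c1[of p b t] mem nin(1) m by simp
    next
      assume "x = b - p"
      then show ?thesis using c1[of b p t] mem nin(2) m by simp
    qed
  qed
  have subX: "difference_set (L t) (L t) \<subseteq> X" "cross_differences (L t) (C t) \<subseteq> X" if "t \<ge> 1" for t
  proof -
    show 1: "difference_set (L t) (L t) \<subseteq> X"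
      using L_anti[OF that] by (auto simp: X_def difference_set_def)
    show "cross_differences (L t) (C t) \<subseteq> X"
    proof
      fix x assume "x \<in> cross_differences (L t) (C t)"
      then obtain p b where pb: "p \<in> L t" "b \<in> C t" "x = p - b \<or> x = b - p"
        by (auto simp: cross_differences_def difference_set_def)
      have p: "p \<in> L 1" using pb(1) L_anti[OF that] by blast
      show "x \<in> X"
      proof (cases "b \<in> L 1")
        case True
        then show ?thesis using p pb(3) difference_setI unfolding X_def by blast
      next
        case False
        then have "b \<in> C 1" using pb(2) by (simp add: C_def)
        then show ?thesis using p pb(3) difference_setI unfolding X_def cross_differences_def by blast
      qed
    qed
  qed
  define g where "g = (\<lambda>t. \<Sum>x\<in>X. int (c x t))"
  \<comment> \<open>Differences within the level count twice and cross differences once. There are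
    \<open>2 * (D - k) * n\<close> of the latter for a level of dimension \<open>k\<close> with
    \<open>n\<close> points, exactly what the missing dimensions cost. \<open>Y\<close> collects
    extra differences for exceptional levels.\<close>
  have g_basic: "g t \<ge> 2 * int (card (difference_set (L t) (L t))) + 2 * (D - aff_dim (L t)) * int (card (L t)) + int (card Y)"
    if t: "t \<ge> 1" and Y: "Y \<subseteq> X" "Y \<inter> difference_set (L t) (L t) = {}" "Y \<inter> cross_differences (L t) (C t) = {}"
      "\<And>x. x \<in> Y \<Longrightarrow> c x t \<ge> 1" for t Y
  proof -
    define S1 where "S1 = difference_set (L t) (L t)"
    define S2 where "S2 = cross_differences (L t) (C t)"
    have S: "S1 \<inter> S2 = {}" "S1 \<subseteq> X" "S2 \<subseteq> X" using disj subX[OF t] by (auto simp: S1_def S2_def)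
    have finS: "finite S1" "finite S2" "finite Y" using S Y finX finite_subset by auto
    have YS: "(S1 \<union> S2) \<inter> Y = {}" using Y by (auto simp: S1_def S2_def)
    have "(\<Sum>x\<in>S1 \<union> S2 \<union> Y. int (c x t)) = (\<Sum>x\<in>S1. int (c x t)) + (\<Sum>x\<in>S2. int (c x t)) + (\<Sum>x\<in>Y. int (c x t))"
      using finS S YS by (simp add: sum.union_disjoint)
    moreover have "(\<Sum>x\<in>S1 \<union> S2 \<union> Y. int (c x t)) \<le> g t"
      unfolding g_def using S Y by (intro sum_mono2 finX) auto
    moreover have "(\<Sum>x\<in>S1. int (c x t)) = 2 * int (card S1)" using c2 by (simp add: S1_def)
    moreover have "(\<Sum>x\<in>S2. int (c x t)) \<ge> (\<Sum>x\<in>S2. 1)" using c1C by (intro sum_mono) (auto simp: S2_def)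
    moreover have "(\<Sum>x\<in>Y. int (c x t)) \<ge> (\<Sum>x\<in>Y. 1)" using Y(4) by (intro sum_mono) auto
    moreover have "int (card S2) = 2 * (D - aff_dim (L t)) * int (card (L t))"
      unfolding S2_def cardC by (simp add: cC[symmetric])
    ultimately show ?thesis by (simp add: S1_def)
  qed
  have level: "(2 * D - 1) * g t \<ge> (4 * D * D - 2 * D + 2) * int (card (L t))" if t: "t \<ge> 1" for t
  proof (cases "L t = {}")
    case True
    then show ?thesis using D3 by (simp add: g_def sum_nonneg)
  next
    case neL: False
    define n where "n = int (card (L t))"
    define \<Delta> where "\<Delta> = int (card (difference_set (L t) (L t)))"
    define k where "k = aff_dim (L t)"
    have kD: "k \<le> D" unfolding k_def dimP[symmetric] by (intro aff_dim_subset LP)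
    show ?thesis
    proof (cases "k = D \<and> n = 2 * D \<and> \<Delta> < D * (2 * D) + 2")
      case False
      then have gain: "(2 * D - 1) * (\<Delta> - k * n) \<ge> n"
        using card_difference_set_gain[OF finL neL, of k D] kD D3 by (simp add: k_def n_def \<Delta>_def)
      have "g t \<ge> 2 * \<Delta> + 2 * (D - k) * n"
        using g_basic[OF t, of "{}"] by (simp add: k_def n_def \<Delta>_def)
      then have "(2 * D - 1) * g t \<ge> (2 * D - 1) * (2 * \<Delta> + 2 * (D - k) * n)"
        using D3 by (intro mult_left_mono) auto
      moreover have "(2 * D - 1) * (2 * \<Delta> + 2 * (D - k) * n)
          = 2 * ((2 * D - 1) * (\<Delta> - k * n)) + (4 * D * D - 2 * D) * n" by (simp add: algebra_simps)
      moreover have "(4 * D * D - 2 * D + 2) * n = (4 * D * D - 2 * D) * n + 2 * n" by (simp add: algebra_simps)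
      ultimately show ?thesis using gain unfolding n_def by linarith
    next
      case True
      then have k: "k = D" and n: "n = 2 * D" and \<Delta>: "\<Delta> < D * (2 * D) + 2" by auto
      have "L t \<noteq> L 1" using ne True unfolding L1 k_def n_def \<Delta>_def by metis
      then have ne1: "L 1 - L t \<noteq> {}" using L_anti[OF t] by blast
      \<comment> \<open>A heaviest point below level \<open>t\<close>. No weight lies strictly
        between \<open>w q\<close> and \<open>t\<close>, so the level just above \<open>q\<close> is
        still \<open>L t\<close>, as \<open>c1\<close> needs. Adding \<open>q\<close> gives
        \<open>2 * D + 1\<close> points and hence a difference outside those of \<open>L t\<close>;
        it involves \<open>q\<close>, and its negative is new as well.\<close>
      then obtain q where q: "q \<in> L 1 - L t" "\<And>q'. q' \<in> L 1 - L t \<Longrightarrow> w q' \<le> w q"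
        using obtains_MAX[of "L 1 - L t" w] finL by (metis Max_ge finite_Diff finite_imageI imageI)
      define s where "s = w q"
      have st: "s < t" "1 \<le> s" and qP: "q \<in> P" using q(1) by (auto simp: L_def superlevel_def s_def)
      have Ls: "L (Suc s) = L t"
      proof
        show "L t \<subseteq> L (Suc s)" using st by (intro L_anti) auto
        show "L (Suc s) \<subseteq> L t"
        proof
          fix y assume y: "y \<in> L (Suc s)"
          then have "y \<in> L 1" using L_anti[of 1 "Suc s"] by auto
          moreover have "\<not> w y \<le> w q" using y by (auto simp: L_def superlevel_def s_def)
          ultimately show "y \<in> L t" using q(2)[of y] by blast
        qed
      qed
      define Q where "Q = insert q (L t)"
      have "aff_dim (L t) \<le> aff_dim Q" "aff_dim Q \<le> aff_dim P"
        using LP qP by (auto simp: Q_def intro!: aff_dim_subset)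
      then have dQ: "aff_dim Q = D" using k dimP by (simp add: k_def)
      have "int (card Q) = 2 * D + 1" using q(1) finL n by (simp add: Q_def n_def)
      then have "int (card (difference_set Q Q)) \<ge> D * (2 * D + 1) + 1"
        using card_difference_set_lower[of Q D] dQ finL by (simp add: Q_def)
      then have "int (card (difference_set Q Q)) > \<Delta>" using \<Delta> D3 by (simp add: algebra_simps)
      then have "\<not> difference_set Q Q \<subseteq> difference_set (L t) (L t)"
        unfolding \<Delta>_def using card_mono[OF finite_difference_set[OF finL finL]] by (metis not_le of_nat_le_iff)
      then obtain x where x: "x \<in> difference_set Q Q" "x \<notin> difference_set (L t) (L t)" by blast
      obtain y0 where "y0 \<in> L t" using neL by blast
      then have "0 \<in> difference_set (L t) (L t)" using difference_setI[of y0 "L t" y0 "L t"] by simp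
      then have x0: "x \<noteq> 0" using x(2) by blast
      obtain y where y: "y \<in> L t" "x = y - q \<or> x = q - y"
        using x x0 unfolding Q_def difference_set_def by auto
      have yP: "y \<in> P" and wy: "t \<le> w y" using y(1) by (auto simp: L_def superlevel_def)
      have neg: "y - q \<notin> difference_set (L t) (L t) \<and> q - y \<notin> difference_set (L t) (L t)"
      proof -
        have sym: "- z \<in> difference_set (L t) (L t)" if "z \<in> difference_set (L t) (L t)" for z
          using that by (force simp: difference_set_def)
        show ?thesis using x(2) y(2) sym[of "y - q"] sym[of "q - y"] by auto
      qed
      have m: "min (w y) (w q) = s" "min (w q) (w y) = s" using wy st by (auto simp: s_def)
      have cc: "c (y - q) t \<ge> 1" "c (q - y) t \<ge> 1"
        using c1[OF yP qP, of t] c1[OF qP yP, of t] wy neg unfolding m Ls by auto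
      define Y where "Y = {y - q, q - y}"
      have "y - q \<noteq> q - y"
      proof
        assume "y - q = q - y"
        then have "2 *\<^sub>R y = 2 *\<^sub>R q" by (simp add: scaleR_2 algebra_simps)
        then have "y = q" by simp
        then show False using x0 y(2) by auto
      qed
      then have cY: "card Y = 2" by (simp add: Y_def)
      have YX: "Y \<subseteq> X" using y(1) L_anti[OF t] q(1) difference_setI
        unfolding Y_def X_def by blast
      have "C t = {}" using cC[of t] k finB by (simp add: k_def C_def)
      then have "cross_differences (L t) (C t) = {}" by (simp add: cross_differences_def difference_set_def)
      moreover have "Y \<inter> difference_set (L t) (L t) = {}" "\<And>x. x \<in> Y \<Longrightarrow> c x t \<ge> 1"
        using neg cc by (auto simp: Y_def)
      ultimately have "g t \<ge> 2 * \<Delta> + 2"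
        using g_basic[OF t YX] k cY by (simp add: \<Delta>_def k_def)
      moreover have "\<Delta> \<ge> D * (2 * D) + 1"
        using card_difference_set_lower[OF finL neL, of D] k n by (simp add: k_def n_def \<Delta>_def)
      ultimately have "g t \<ge> 4 * D * D + 4" by simp
      then have "(2 * D - 1) * g t \<ge> (2 * D - 1) * (4 * D * D + 4)" using D3 by (intro mult_left_mono) auto
      moreover have "(2 * D - 1) * (4 * D * D + 4) = (4 * D * D - 2 * D + 2) * (2 * D) + 4 * (D - 1)"
        by (simp add: algebra_simps)
      ultimately show ?thesis using D3 n unfolding n_def by simp
    qed
  qed
  define N where "N = Max (insert 0 (w ` P))"
  have N: "w p \<le> N" if "p \<in> P" for p using fin that by (auto simp: N_def)
  have cw: "w (fst (\<rho> x)) + w (snd (\<rho> x)) = (\<Sum>t\<in>{1..N}. c x t)" if "x \<in> X" for x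
  proof -
    have "fst (\<rho> x) \<in> P" "snd (\<rho> x) \<in> P" using \<rho> XP that by auto
    then have "{1..N} \<inter> {t. t \<le> w (fst (\<rho> x))} = {1..w (fst (\<rho> x))}"
      "{1..N} \<inter> {t. t \<le> w (snd (\<rho> x))} = {1..w (snd (\<rho> x))}" using N by fastforce+
    then show ?thesis by (simp add: c_def sum.distrib sum.If_cases)
  qed
  have "(\<Sum>x\<in>X. int (w (fst (\<rho> x)) + w (snd (\<rho> x)))) = (\<Sum>x\<in>X. \<Sum>t\<in>{1..N}. int (c x t))"
    using cw by (intro sum.cong refl) simp
  also have "\<dots> = (\<Sum>t\<in>{1..N}. g t)" unfolding g_def by (rule sum.swap)
  finally have tot: "(\<Sum>x\<in>X. int (w (fst (\<rho> x)) + w (snd (\<rho> x)))) = (\<Sum>t\<in>{1..N}. g t)" .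
  have "int (\<Sum>p\<in>P. w p) = int (\<Sum>t\<in>{1..N}. card (L t))"
    unfolding L_def using sum_superlevel_card[OF fin N] by simp
  then have totw: "(\<Sum>p\<in>P. int (w p)) = (\<Sum>t\<in>{1..N}. int (card (L t)))" by simp
  have "(4 * D * D - 2 * D + 2) * (\<Sum>p\<in>P. int (w p)) \<le> (2 * D - 1) * (\<Sum>x\<in>X. int (w (fst (\<rho> x)) + w (snd (\<rho> x))))"
    unfolding tot totw sum_distrib_left using level by (intro sum_mono) auto
  then show ?thesis using that[OF finX XP cX] \<rho> XP by blast
qed

section \<open>Fibring over a hyperplane\<close>

text \<open>If the smaller summand has two points, the larger one has dimension at least 1, and
  \<open>card_sumset_ge_dim\<close> yields the bound known from the line.\<close>

lemma card_difference_set_ge: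
  fixes S T :: "'a::euclidean_space set"
  assumes "finite S" "finite T" "S \<noteq> {}" "T \<noteq> {}"
  shows "card S + card T \<le> card (difference_set S T) + 1"
proof -
  have ge: "card S + card T \<le> card (S + T) + 1"
    if le: "card T \<le> card S" and ne: "T \<noteq> {}" and fin: "finite S" "finite T" for S T :: "'a set"
  proof -
    have T1: "card T \<ge> 1" using ne fin by (simp add: Suc_le_eq card_gt_0_iff)
    have *: "2 * int (card (S + T)) \<ge> 2 * int (card S) + (aff_dim S + 1) * (int (card T) - 1)"
      using card_sumset_ge_dim[OF fin ne le] by blast
    show ?thesis
    proof (cases "card T = 1")
      case True
      then show ?thesis using * by simp
    next
      case False
      then have "aff_dim S \<ge> 1" using aff_dim_ge_1[of S] T1 le by simp
      then have "2 * (int (card T) - 1) \<le> (aff_dim S + 1) * (int (card T) - 1)"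
        using T1 by (intro mult_right_mono) auto
      then have "2 * int (card S) + 2 * (int (card T) - 1) \<le> 2 * int (card (S + T))"
        using * by (meson add_left_mono order_trans)
      then show ?thesis by presburger
    qed
  qed
  have "card (uminus ` T) = card T" by (rule card_image) simp
  moreover have "difference_set S T = S + uminus ` T" by (rule difference_set_eq_plus)
  moreover have "card S + card (uminus ` T) \<le> card (S + uminus ` T) + 1"
  proof (cases "card (uminus ` T) \<le> card S")
    case True
    then show ?thesis using ge[of "uminus ` T" S] assms by simp
  next
    case False
    then show ?thesis using ge[of S "uminus ` T"] assms by (simp add: add.commute)
  qed
  ultimately show ?thesis by simp
qed

lemma orth_proj_inner_commute: "u \<bullet> orth_proj v x = orth_proj v u \<bullet> x"
  by (simp add: orth_proj_def inner_diff_right inner_diff_left inner_commute)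

lemma orth_proj_inner_self: "v \<noteq> 0 \<Longrightarrow> v \<bullet> orth_proj v x = 0"
  by (simp add: orth_proj_def inner_diff_right)

lemma aff_dim_orth_proj_UNIV:
  fixes A :: "'a::euclidean_space set"
  assumes "v \<noteq> 0" "aff_dim A = int DIM('a)"
  shows "aff_dim (orth_proj v ` A) = int DIM('a) - 1"
proof -
  have "affine hull (orth_proj v ` A) = orth_proj v ` (affine hull A)"
    by (rule affine_hull_linear_image[symmetric]) (simp add: linear_linear linear_orth_proj)
  also have "affine hull A = UNIV" using assms(2) aff_dim_eq_full by metis
  also have "orth_proj v ` UNIV = {x. v \<bullet> x = 0}"
  proof
    show "orth_proj v ` UNIV \<subseteq> {x. v \<bullet> x = 0}" using orth_proj_inner_self[OF assms(1)] by auto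
    show "{x. v \<bullet> x = 0} \<subseteq> orth_proj v ` UNIV"
    proof clarify
      fix x assume "v \<bullet> x = 0"
      then have "orth_proj v x = x" by (simp add: orth_proj_def)
      then show "x \<in> orth_proj v ` UNIV" by (metis UNIV_I imageI)
    qed
  qed
  finally have "aff_dim (orth_proj v ` A) = aff_dim {x. v \<bullet> x = 0}" by (metis aff_dim_affine_hull)
  also have "\<dots> = int DIM('a) - 1" using assms(1) by (simp add: aff_dim_hyperplane)
  finally show ?thesis .
qed

text \<open>Two points on one line put \<open>v\<close> among the directions of \<open>A\<close>.
  The affine hull of \<open>A\<close> then contains the projection and, in addition, a point off the
  hyperplane orthogonal to \<open>v\<close>.\<close>

lemma aff_dim_orth_proj_less:
  fixes A :: "'a::euclidean_space set"
  assumes "v \<noteq> 0" "x \<in> A" "y \<in> A" "x \<noteq> y" "orth_proj v x = orth_proj v y"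
  shows "aff_dim (orth_proj v ` A) + 1 \<le> aff_dim A"
proof -
  obtain c where c: "x = y + c *\<^sub>R v" using assms(5) orth_proj_eq_iff by blast
  then have c0: "c \<noteq> 0" using assms(4) by auto
  have shift: "z + s *\<^sub>R v \<in> affine hull A" if "z \<in> A" for z s
  proof -
    have "z + (s / c) *\<^sub>R (x - y) \<in> affine hull A"
      using that assms by (intro mem_affine_3_minus) (auto simp: hull_inc)
    then show ?thesis using c c0 by simp
  qed
  have "orth_proj v z \<in> affine hull A" if "z \<in> A" for z
    using shift[OF that, of "- ((v \<bullet> z) / (v \<bullet> v))"] by (simp add: orth_proj_def)
  moreover have "orth_proj v x + v \<in> affine hull A"
    using shift[OF assms(2), of "1 - (v \<bullet> x) / (v \<bullet> v)"] by (simp add: orth_proj_def algebra_simps)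
  ultimately have "insert (orth_proj v x + v) (orth_proj v ` A) \<subseteq> affine hull A" by blast
  then have "aff_dim (insert (orth_proj v x + v) (orth_proj v ` A)) \<le> aff_dim A"
    by (metis aff_dim_affine_hull aff_dim_subset)
  moreover have "affine hull (orth_proj v ` A) \<subseteq> {z. v \<bullet> z = 0}"
    using orth_proj_inner_self[OF assms(1)] by (intro hull_minimal affine_hyperplane) auto
  then have "orth_proj v x + v \<notin> affine hull (orth_proj v ` A)"
    using assms(1) orth_proj_inner_self[OF assms(1)] by (auto simp: inner_add_right)
  ultimately show ?thesis by (simp add: aff_dim_insert)
qed

text \<open>Differences between the two fibres chosen for \<open>x\<close> project to
  \<open>x\<close>, so different \<open>x\<close> use disjoint parts of \<open>A - A\<close>. Each
  loses 1 in \<open>card_difference_set_ge\<close>, which adds up to \<open>card X\<close>.\<close>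

lemma card_difference_set_fibres:
  fixes A :: "'a::euclidean_space set"
  assumes "finite A" "finite X"
    and \<rho>: "\<And>x. x \<in> X \<Longrightarrow> fst (\<rho> x) \<in> orth_proj v ` A \<and> snd (\<rho> x) \<in> orth_proj v ` A \<and> x = fst (\<rho> x) - snd (\<rho> x)"
  shows "(\<Sum>x\<in>X. card {a \<in> A. orth_proj v a = fst (\<rho> x)} + card {a \<in> A. orth_proj v a = snd (\<rho> x)})
    \<le> card (difference_set A A) + card X"
proof -
  define S where "S = (\<lambda>p. {a \<in> A. orth_proj v a = p})"
  have fS: "finite (S p)" for p using assms(1) by (simp add: S_def)
  define Z where "Z = (\<lambda>x. difference_set (S (fst (\<rho> x))) (S (snd (\<rho> x))))"
  have projZ: "orth_proj v z = x" if "x \<in> X" "z \<in> Z x" for x z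
    using that \<rho>[OF that(1)] by (auto simp: Z_def S_def difference_set_def orth_proj_diff)
  have "(\<Sum>x\<in>X. card (S (fst (\<rho> x))) + card (S (snd (\<rho> x)))) \<le> (\<Sum>x\<in>X. card (Z x) + 1)"
  proof (rule sum_mono)
    fix x assume "x \<in> X"
    then have "S (fst (\<rho> x)) \<noteq> {}" "S (snd (\<rho> x)) \<noteq> {}" using \<rho>[of x] by (auto simp: S_def)
    then show "card (S (fst (\<rho> x))) + card (S (snd (\<rho> x))) \<le> card (Z x) + 1"
      unfolding Z_def using fS by (intro card_difference_set_ge)
  qed
  also have "\<dots> = card (\<Union>x\<in>X. Z x) + card X"
  proof -
    have "card (\<Union>x\<in>X. Z x) = (\<Sum>x\<in>X. card (Z x))"
    proof (rule card_UN_disjoint)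
      show "\<forall>x\<in>X. \<forall>y\<in>X. x \<noteq> y \<longrightarrow> Z x \<inter> Z y = {}"
      proof (intro ballI impI equals0I)
        fix x y z assume xy: "x \<in> X" "y \<in> X" "x \<noteq> y" and z: "z \<in> Z x \<inter> Z y"
        then have "orth_proj v z = x" "orth_proj v z = y" using projZ by blast+
        then show False using xy by simp
      qed
    qed (use assms fS in \<open>auto simp: Z_def\<close>)
    then show ?thesis by (simp add: sum_Suc)
  qed
  also have "card (\<Union>x\<in>X. Z x) \<le> card (difference_set A A)"
    by (rule card_mono[OF finite_difference_set[OF assms(1,1)]]) (auto simp: Z_def S_def difference_set_def)
  finally show ?thesis by (simp add: S_def)
qed

text \<open>Here \<open>T\<close> is the cut-off between sparse and rich lines in direction \<open>v\<close>.\<close>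

lemma structure_from_lines:
  fixes A :: "'a::euclidean_space set" and v :: 'a and T :: nat
  assumes A: "finite A" "aff_dim A = int DIM('a)" and v: "v \<noteq> 0" and D: "D = DIM('a) - 1" "D \<ge> 3" and T: "T \<ge> 2"
  obtains (large) E X :: nat where
      "real (card (difference_set A A)) \<ge> (2 * real D + 2 / (2 * real D - 1)) * (real (card A) - E) - X"
      "E \<le> T * card (orth_proj v ` A)"
      "T * X \<le> card (difference_set A A) + 2 * DIM('a) * card A"
    | (two_layers) A1 A2 E u t1 t2 where
      "A = A1 \<union> A2 \<union> E" "A1 \<inter> A2 = {}" "A1 \<inter> E = {}" "A2 \<inter> E = {}" "u \<noteq> 0"
      "A1 \<subseteq> (+) t1 ` orth_hyperplane u" "A2 \<subseteq> (+) t2 ` orth_hyperplane u"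
      "aff_dim A1 = D" "aff_dim A2 = D" "card (orth_proj v ` A1) = D" "card (orth_proj v ` A2) = D"
      "card E \<le> T * card (orth_proj v ` A)"
proof -
  define P where "P = orth_proj v ` A"
  define S where "S = (\<lambda>p. {a \<in> A. orth_proj v a = p})"
  have fS: "finite (S p)" for p using A by (simp add: S_def)
  \<comment> \<open>Sparse lines get weight 0 instead of being removed, so that \<open>P\<close>
    keeps full dimension \<open>D\<close> and can supply the missing basis points.\<close>
  define w where "w = (\<lambda>p. if card (S p) \<ge> T then card (S p) else 0)"
  define P1 where "P1 = superlevel P w 1"
  have P1: "P1 = {p \<in> P. card (S p) \<ge> T}" using T by (auto simp: P1_def superlevel_def w_def)
  have finP: "finite P" "finite P1" using A by (auto simp: P_def P1)
  have DD: "int DIM('a) = int D + 1" using D DIM_positive[where 'a = 'a] by simp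
  have dP: "aff_dim P = int D" unfolding P_def using aff_dim_orth_proj_UNIV[OF v A(2)] DD by simp
  define E where "E = {a \<in> A. orth_proj v a \<notin> P1}"
  have "E = (\<Union>p\<in>P - P1. S p)" by (auto simp: E_def S_def P_def)
  then have "card E \<le> (\<Sum>p\<in>P - P1. card (S p))" using finP card_UN_le by (metis finite_Diff)
  also have "\<dots> \<le> (\<Sum>p\<in>P - P1. T)" by (intro sum_mono) (auto simp: P1)
  also have "\<dots> \<le> T * card P" using finP by (simp add: card_mono)
  finally have cE: "card E \<le> T * card (orth_proj v ` A)" by (simp add: P_def)
  have card_A: "card A = (\<Sum>p\<in>P. card (S p))"
    unfolding P_def S_def by (rule card_eq_sum_fibres[OF A(1)])
  have "A - E = (\<Union>p\<in>P1. S p)" by (auto simp: E_def S_def P1 P_def)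
  moreover have "card (\<Union>p\<in>P1. S p) = (\<Sum>p\<in>P1. card (S p))"
    by (rule card_UN_disjoint) (use finP fS in \<open>auto simp: S_def\<close>)
  moreover have "(\<Sum>p\<in>P1. card (S p)) = (\<Sum>p\<in>P. w p)"
    by (rule sum.mono_neutral_cong_left) (use finP T in \<open>auto simp: P1 w_def\<close>)
  moreover have "card (A - E) = card A - card E" "card E \<le> card A"
    using A by (auto simp: E_def intro!: card_Diff_subset card_mono)
  ultimately have sumw: "int (\<Sum>p\<in>P. w p) = int (card A) - int (card E)" by simp
  show ?thesis
  proof (cases "aff_dim P1 = int D \<and> int (card P1) = 2 * int D \<and>
      int (card (difference_set P1 P1)) < int D * (2 * int D) + 2")
    case False
    obtain X \<rho> where X: "finite X" "X \<subseteq> difference_set P P"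
      "int (card X) \<le> int (card (difference_set P1 P1)) + 2 * (int D + 1) * int (card P1)"
      and \<rho>: "\<And>x. x \<in> X \<Longrightarrow> fst (\<rho> x) \<in> P \<and> snd (\<rho> x) \<in> P \<and> x = fst (\<rho> x) - snd (\<rho> x)"
      and big: "(2 * int D - 1) * (\<Sum>x\<in>X. int (w (fst (\<rho> x)) + w (snd (\<rho> x)))) \<ge> (4 * int D * int D - 2 * int D + 2) * (\<Sum>p\<in>P. int (w p))"
    proof (rule weighted_difference_set[where P = P and w = w and D = "int D", folded P1_def, OF finP(1) dP _ False])
      show "int D \<ge> 3" using D(2) by simp
    qed (rule that)
    have "(\<Sum>x\<in>X. w (fst (\<rho> x)) + w (snd (\<rho> x))) \<le> (\<Sum>x\<in>X. card (S (fst (\<rho> x))) + card (S (snd (\<rho> x))))"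
      by (intro sum_mono add_mono) (auto simp: w_def)
    also have "\<dots> \<le> card (difference_set A A) + card X"
      unfolding S_def using \<rho> by (intro card_difference_set_fibres A X) (auto simp: P_def)
    finally have "(\<Sum>x\<in>X. int (w (fst (\<rho> x)) + w (snd (\<rho> x)))) \<le> int (card (difference_set A A)) + int (card X)"
      by (simp flip: of_nat_sum of_nat_add)
    then have "(2 * int D - 1) * (\<Sum>x\<in>X. int (w (fst (\<rho> x)) + w (snd (\<rho> x)))) \<le> (2 * int D - 1) * (int (card (difference_set A A)) + int (card X))"
      using D by (intro mult_left_mono) auto
    then have "(2 * int D - 1) * (int (card (difference_set A A)) + int (card X)) \<ge> (4 * int D * int D - 2 * int D + 2) * (int (card A) - int (card E))"
      using big sumw by simp
    then have "real_of_int ((2 * int D - 1) * (int (card (difference_set A A)) + int (card X))) \<ge> real_of_int ((4 * int D * int D - 2 * int D + 2) * (int (card A) - int (card E)))"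
      by (simp only: of_int_le_iff)
    then have le: "(2 * real D - 1) * (real (card (difference_set A A)) + real (card X)) \<ge> (4 * real D * real D - 2 * real D + 2) * (real (card A) - real (card E))"
      by simp
    have "2 * real D - 1 > 0" using D by simp
    then have "2 * real D + 2 / (2 * real D - 1) = (4 * real D * real D - 2 * real D + 2) / (2 * real D - 1)"
      by (simp add: field_simps)
    then have 1: "real (card (difference_set A A)) \<ge> (2 * real D + 2 / (2 * real D - 1)) * (real (card A) - card E) - card X"
      using le \<open>2 * real D - 1 > 0\<close> by (simp add: field_simps)
    have "T * card (difference_set P1 P1) \<le> card (difference_set A A)"
    proof -
      have "\<forall>x\<in>difference_set P1 P1. \<exists>r. fst r \<in> P1 \<and> snd r \<in> P1 \<and> x = fst r - snd r"
        by (auto simp: difference_set_def)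
      then obtain r where r: "\<And>x. x \<in> difference_set P1 P1 \<Longrightarrow> fst (r x) \<in> P1 \<and> snd (r x) \<in> P1 \<and> x = fst (r x) - snd (r x)"
        by metis
      \<comment> \<open>One fibre supplies \<open>T\<close>; a single point of the other cancels the
        loss of 1 per difference.\<close>
      have "(\<Sum>x\<in>difference_set P1 P1. T + 1) \<le> (\<Sum>x\<in>difference_set P1 P1. card (S (fst (r x))) + card (S (snd (r x))))"
      proof (intro sum_mono add_mono)
        fix x assume "x \<in> difference_set P1 P1"
        then show "T \<le> card (S (fst (r x)))" "1 \<le> card (S (snd (r x)))" using r[of x] T by (auto simp: P1)
      qed
      also have "\<dots> \<le> card (difference_set A A) + card (difference_set P1 P1)"
        unfolding S_def using r finP by (intro card_difference_set_fibres A) (auto simp: P_def P1)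
      finally show ?thesis by (simp add: algebra_simps)
    qed
    moreover have "T * card P1 \<le> card A"
    proof -
      have "T * card P1 = (\<Sum>p\<in>P1. T)" by simp
      also have "\<dots> \<le> (\<Sum>p\<in>P1. card (S p))" by (intro sum_mono) (auto simp: P1)
      also have "\<dots> \<le> card A" unfolding card_A using finP by (intro sum_mono2) (auto simp: P1)
      finally show ?thesis .
    qed
    moreover have "card X \<le> card (difference_set P1 P1) + 2 * DIM('a) * card P1"
    proof -
      have "int (card X) \<le> int (card (difference_set P1 P1) + 2 * DIM('a) * card P1)"
        using X(3) unfolding DD[symmetric] by simp
      then show ?thesis by (simp only: of_nat_le_iff)
    qed
    then have "T * card X \<le> T * (card (difference_set P1 P1) + 2 * DIM('a) * card P1)"
      by (rule mult_le_mono2)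
    then have "T * card X \<le> T * card (difference_set P1 P1) + 2 * DIM('a) * (T * card P1)"
      by (simp add: algebra_simps)
    moreover have "2 * DIM('a) * (T * card P1) \<le> 2 * DIM('a) * card A"
      using \<open>T * card P1 \<le> card A\<close> by (rule mult_le_mono2)
    ultimately have 2: "T * card X \<le> card (difference_set A A) + 2 * DIM('a) * card A" by linarith
    show ?thesis by (rule large[OF 1 cE 2])
  next
    case True
    obtain u F G where FG: "P1 = F \<union> G" "F \<inter> G = {}" "F = minface u P1" "G = minface (- u) P1"
      "int (card F) = int D" "int (card G) = int D" "aff_dim F = int D - 1" "aff_dim G = int D - 1"
    proof (rule difference_set_extremal[OF finP(2), of "int D"])
      show "aff_dim P1 = int D" "1 \<le> int D" "int (card P1) = 2 * int D" using True D(2) by auto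
      then show "int (card (difference_set P1 P1)) < int D * int (card P1) + 2" using True by simp
    qed (rule that)
    have ne: "F \<noteq> {}" "G \<noteq> {}" using FG(5,6) D(2) by auto
    \<comment> \<open>The functional found on \<open>P1\<close> is turned into one on
      \<open>A\<close> that is constant along \<open>v\<close>; the layers of \<open>P1\<close>
      become layers of \<open>A\<close>.\<close>
    define u' where "u' = orth_proj v u"
    have u': "u \<bullet> orth_proj v x = u' \<bullet> x" for x
      unfolding u'_def by (rule orth_proj_inner_commute)
    have "u' \<noteq> 0"
    proof
      assume "u' = 0"
      then have "u \<bullet> p = 0" if "p \<in> P1" for p using u' that by (auto simp: P1 P_def)
      then have "F = P1" "G = P1" by (auto simp: FG(3,4) minface_def)
      then show False using FG(2) ne by simp
    qed
    have part: "\<exists>t. A' \<subseteq> (+) t ` orth_hyperplane u' \<and> aff_dim A' = int D \<and> card (orth_proj v ` A') = D"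
      if Q: "Q \<subseteq> P1" "Q \<noteq> {}" "\<And>x y. x \<in> Q \<Longrightarrow> y \<in> Q \<Longrightarrow> u \<bullet> x = u \<bullet> y" "int (card Q) = int D" "aff_dim Q = int D - 1"
        and A': "A' = {a \<in> A. orth_proj v a \<in> Q}" for Q A'
    proof -
      have img: "orth_proj v ` A' = Q" using Q(1) by (auto simp: A' P1 P_def)
      obtain p where p: "p \<in> Q" using Q(2) by blast
      \<comment> \<open>Here \<open>T \<ge> 2\<close> matters: a line with two points adds the
        direction \<open>v\<close> and raises the dimension from \<open>D - 1\<close> to
        \<open>D\<close>.\<close>
      then have "card (S p) \<ge> 2" using Q(1) T by (auto simp: P1)
      then obtain x y where xy: "x \<in> S p" "y \<in> S p" "x \<noteq> y"
        by (metis card_le_Suc0_iff_eq fS not_less_eq_eq numeral_2_eq_2)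
      then have xyA: "x \<in> A'" "y \<in> A'" "orth_proj v x = orth_proj v y" using p by (auto simp: S_def A')
      have const: "u' \<bullet> z = u' \<bullet> x" if "z \<in> A'" for z
        using Q(3) that xyA by (simp add: A' flip: u')
      have "z \<in> (+) x ` orth_hyperplane u'" if "z \<in> A'" for z
        using const[OF that] by (intro image_eqI[of _ _ "z - x"]) (auto simp: orth_hyperplane_def inner_diff_right)
      moreover have "aff_dim A' = int D"
      proof (rule antisym)
        have "A' \<subseteq> {z. u' \<bullet> z = u' \<bullet> x}" using const by auto
        then have "aff_dim A' \<le> aff_dim {z. u' \<bullet> z = u' \<bullet> x}" by (rule aff_dim_subset)
        also have "\<dots> = int D" using \<open>u' \<noteq> 0\<close> DD by (simp add: aff_dim_hyperplane)
        finally show "aff_dim A' \<le> int D" .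
        show "int D \<le> aff_dim A'"
          using aff_dim_orth_proj_less[OF v xyA(1,2) xy(3) xyA(3)] img Q(5) by simp
      qed
      ultimately show ?thesis using img Q(4) by auto
    qed
    define A1 where "A1 = {a \<in> A. orth_proj v a \<in> F}"
    define A2 where "A2 = {a \<in> A. orth_proj v a \<in> G}"
    obtain t1 where t1: "A1 \<subseteq> (+) t1 ` orth_hyperplane u'" "aff_dim A1 = int D" "card (orth_proj v ` A1) = D"
      using part[OF _ ne(1) _ FG(5,7) A1_def] minface_eq[of _ u P1] FG(1,3) by blast
    have "u \<bullet> x = u \<bullet> y" if "x \<in> G" "y \<in> G" for x y
      using minface_eq[of x "- u" P1 y] that FG(4) by simp
    then obtain t2 where t2: "A2 \<subseteq> (+) t2 ` orth_hyperplane u'" "aff_dim A2 = int D" "card (orth_proj v ` A2) = D"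
      using part[OF _ ne(2) _ FG(6,8) A2_def] FG(1) by blast
    have "A = A1 \<union> A2 \<union> E" "A1 \<inter> A2 = {}" "A1 \<inter> E = {}" "A2 \<inter> E = {}"
      using FG(1,2) by (auto simp: A1_def A2_def E_def)
    then show ?thesis
      by (rule two_layers[OF _ _ _ _ \<open>u' \<noteq> 0\<close> t1(1) t2(1) t1(2) t2(2) t1(3) t2(3) cE])
  qed
qed

theorem theorem4p1:
  fixes d :: nat
  assumes "CARD('n::finite) = d" and "d \<ge> 4"
  shows "\<exists>\<delta> C :: real. \<delta> > 0 \<and> C > 0 \<and>
    (\<forall>A :: (real ^ 'n) set. finite A \<and> A \<noteq> {} \<and> aff_dim A = int d \<longrightarrow>
       real (card (difference_set A A))
         \<ge> (2 * real d - 2 + 1 / (real d - 1) + 1 / ((2 * real d - 3) * (real d - 1))) * real (card A)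
           - C * real (card A) powr (1 - \<delta>)
       \<or>
       (\<exists>A1 A2 E. A = A1 \<union> A2 \<union> E \<and> A1 \<inter> A2 = {} \<and> A1 \<inter> E = {} \<and> A2 \<inter> E = {} \<and>
          (\<exists>u t1 t2. u \<noteq> 0 \<and> A1 \<subseteq> (+) t1 ` orth_hyperplane u \<and> A2 \<subseteq> (+) t2 ` orth_hyperplane u) \<and>
          aff_dim A1 = int d - 1 \<and> aff_dim A2 = int d - 1 \<and>
          (\<exists>v. v \<noteq> 0 \<and> card (orth_proj v ` A1) = d - 1 \<and> card (orth_proj v ` A2) = d - 1) \<and>
          real (card E) \<le> C * real (card A) powr (1 - \<delta>)))"
proof -
  define D where "D = d - 1"
  have D3: "D \<ge> 3" and dD: "d = D + 1" using assms(2) by (auto simp: D_def)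
  define K where "K = 2 * real D + 2 / (2 * real D - 1)"
  have Keq: "2 * real d - 2 + 1 / (real d - 1) + 1 / ((2 * real d - 3) * (real d - 1)) = K"
  proof -
    have "real D > 0" "2 * real D - 1 > 0" using D3 by auto
    then show ?thesis unfolding K_def dD by (simp add: divide_simps) (simp add: algebra_simps)
  qed
  have K1: "K \<ge> 1"
  proof -
    have "2 / (2 * real D - 1) \<ge> 0" using D3 by simp
    then show ?thesis using D3 unfolding K_def by linarith
  qed
  obtain \<sigma> C0 :: real where \<sigma>: "0 < \<sigma>" "\<sigma> < 1" and C0: "0 < C0"
    and lines: "\<And>A :: (real ^ 'n) set. finite A \<Longrightarrow> A \<noteq> {} \<Longrightarrow> card (difference_set A A) \<le> K * card A \<Longrightarrow>
      \<exists>v. v \<noteq> 0 \<and> card (orth_proj v ` A) \<le> C0 * card A powr (1 - \<sigma>)"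
    by (rule card_orth_proj_le_power[OF K1, where 'a = "real ^ 'n"]) (rule that)
  define \<delta> where "\<delta> = \<sigma> / 2"
  \<comment> \<open>The first summand pays for the points on sparse lines, multiplied by
    \<open>K\<close>, the second for the differences in \<open>X\<close>.\<close>
  define C where "C = 3 * K * C0 + (K + 2 * real d)"
  have Cge: "3 * C0 \<le> C" "C > 0"
  proof -
    have "3 * C0 * 1 \<le> 3 * C0 * K" using K1 C0 by (intro mult_left_mono) auto
    then have "3 * C0 \<le> 3 * K * C0" by (simp add: mult_ac)
    then show "3 * C0 \<le> C" "C > 0" using K1 C0 unfolding C_def by linarith+
  qed
  have main: "real (card (difference_set A A)) \<ge> K * real (card A) - C * real (card A) powr (1 - \<delta>) \<or>
      (\<exists>A1 A2 E. A = A1 \<union> A2 \<union> E \<and> A1 \<inter> A2 = {} \<and> A1 \<inter> E = {} \<and> A2 \<inter> E = {} \<and>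
          (\<exists>u t1 t2. u \<noteq> 0 \<and> A1 \<subseteq> (+) t1 ` orth_hyperplane u \<and> A2 \<subseteq> (+) t2 ` orth_hyperplane u) \<and>
          aff_dim A1 = int d - 1 \<and> aff_dim A2 = int d - 1 \<and>
          (\<exists>v. v \<noteq> 0 \<and> card (orth_proj v ` A1) = d - 1 \<and> card (orth_proj v ` A2) = d - 1) \<and>
          real (card E) \<le> C * real (card A) powr (1 - \<delta>))"
    if A: "finite A" "A \<noteq> {}" "aff_dim A = int d" for A :: "(real ^ 'n) set"
  proof (cases "real (card (difference_set A A)) \<le> K * card A")
    case False
    have "C * real (card A) powr (1 - \<delta>) \<ge> 0" using Cge by simp
    then show ?thesis using False by linarith
  next
    case small: True
    obtain v where v: "v \<noteq> 0" and r: "card (orth_proj v ` A) \<le> C0 * card A powr (1 - \<sigma>)"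
      using lines[OF A(1,2) small] by blast
    define a where "a = real (card A)"
    have a1: "a \<ge> 1" using A by (simp add: a_def Suc_le_eq card_gt_0_iff)
    define y where "y = a powr \<delta>"
    have y1: "y \<ge> 1" using a1 \<sigma> by (simp add: y_def \<delta>_def ge_one_powr_ge_zero)
    define M where "M = a powr (1 - \<delta>)"
    have M: "a = M * y" "a powr (1 - \<sigma>) * y = M"
      using a1 by (simp_all add: M_def y_def \<delta>_def flip: powr_add)
    have M0: "M > 0" using a1 by (simp add: M_def)
    define T where "T = nat \<lceil>y\<rceil> + 1"
    \<comment> \<open>The factor 3 absorbs the rounding: \<open>T \<le> y + 2\<close> and
      \<open>y \<ge> 1\<close>.\<close>
    have T: "T \<ge> 2" "y \<le> real T" "real T \<le> 3 * y" using y1 unfolding T_def by linarith+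
    have r': "real T * card (orth_proj v ` A) \<le> 3 * C0 * M"
    proof -
      have "real T * card (orth_proj v ` A) \<le> (3 * y) * (C0 * a powr (1 - \<sigma>))"
        using T r unfolding a_def by (intro mult_mono) auto
      also have "\<dots> = 3 * C0 * (a powr (1 - \<sigma>) * y)" by (simp add: mult_ac)
      finally show ?thesis using M by simp
    qed
    have dimn: "DIM(real ^ 'n) = d" using assms(1) by simp
    have A': "aff_dim A = int DIM(real ^ 'n)" and D': "D = DIM(real ^ 'n) - 1"
      using A(3) dimn by (simp_all add: D_def)
    show ?thesis
    proof (rule structure_from_lines[OF A(1) A' v D' D3 T(1)])
      fix E X :: nat
      assume 1: "real (card (difference_set A A)) \<ge> (2 * real D + 2 / (2 * real D - 1)) * (real (card A) - E) - X"
        and 2: "E \<le> T * card (orth_proj v ` A)"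
        and 3: "T * X \<le> card (difference_set A A) + 2 * DIM(real ^ 'n) * card A"
      have "real E \<le> real (T * card (orth_proj v ` A))" using 2 by (simp only: of_nat_le_iff)
      then have E: "real E \<le> 3 * C0 * M" using r' by simp
      have "real (T * X) \<le> real (card (difference_set A A) + 2 * DIM(real ^ 'n) * card A)"
        using 3 by (simp only: of_nat_le_iff)
      then have "real T * X \<le> K * a + 2 * d * a" using small dimn by (simp add: a_def)
      moreover have "y * X \<le> real T * X" using T by (intro mult_right_mono) auto
      ultimately have "y * X \<le> y * ((K + 2 * d) * M)" unfolding M(1) by (simp add: algebra_simps)
      then have X: "real X \<le> (K + 2 * d) * M" using y1 by simp
      have "K * E \<le> K * (3 * C0 * M)" using E K1 by (intro mult_left_mono) auto
      then have "K * E + X \<le> C * M" using X by (simp add: C_def algebra_simps)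
      moreover have "real (card (difference_set A A)) \<ge> K * (a - E) - X"
        using 1 by (simp only: K_def a_def)
      ultimately have "real (card (difference_set A A)) \<ge> K * a - C * M" by (simp add: algebra_simps)
      then show ?thesis by (simp add: a_def M_def)
    next
      fix A1 A2 E u t1 t2
      assume *: "A = A1 \<union> A2 \<union> E" "A1 \<inter> A2 = {}" "A1 \<inter> E = {}" "A2 \<inter> E = {}" "u \<noteq> 0"
        "A1 \<subseteq> (+) t1 ` orth_hyperplane u" "A2 \<subseteq> (+) t2 ` orth_hyperplane u"
        "aff_dim A1 = int D" "aff_dim A2 = int D" "card (orth_proj v ` A1) = D" "card (orth_proj v ` A2) = D"
        and E: "card E \<le> T * card (orth_proj v ` A)"
      have "real (card E) \<le> real (T * card (orth_proj v ` A))" using E by (simp only: of_nat_le_iff)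
      also have "\<dots> \<le> 3 * C0 * M" using r' by simp
      also have "\<dots> \<le> C * M" using Cge M0 by (intro mult_right_mono) auto
      finally have "real (card E) \<le> C * real (card A) powr (1 - \<delta>)" by (simp add: M_def a_def)
      moreover have "aff_dim A1 = int d - 1" "aff_dim A2 = int d - 1" using *(8,9) dD by simp_all
      moreover have "\<exists>v. v \<noteq> 0 \<and> card (orth_proj v ` A1) = d - 1 \<and> card (orth_proj v ` A2) = d - 1"
        using v *(10,11) unfolding D_def by blast
      moreover have "\<exists>u t1 t2. u \<noteq> 0 \<and> A1 \<subseteq> (+) t1 ` orth_hyperplane u \<and> A2 \<subseteq> (+) t2 ` orth_hyperplane u"
        using *(5-7) by blast
      ultimately show ?thesis using *(1-4) by (intro disjI2 exI[of _ A1] exI[of _ A2] exI[of _ E] conjI)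
    qed
  qed
  show ?thesis
  proof (intro exI conjI allI impI)
    show "\<delta> > 0" "C > 0" using \<sigma> Cge by (auto simp: \<delta>_def)
  qed (unfold Keq, rule main, auto)
qed

end
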